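(* Let $1\le r,p,p_{1},\dots,p_{m}\le\infty$ with $\frac1p=\frac1{p_{1}}+\dots+\frac1{p_{m}}+\frac1r$. The class $\left(\mathcal{D}_{(p_{1},\dots,p_{m};r)}^{+},d_{(p_{1},\dots,p_{m};r)}^{+}\right)$ of positive $(p_{1},\dots,p_{m};r)$-dominated $m$-linear operators is a positive Banach multi-ideal.
   Context: Scalars are in $\mathbb{K}=\mathbb{R}$ or $\mathbb{C}$. $\mathcal{L}(E_{1},\dots,E_{m};F)$ is the space of bounded $m$-linear operators. $E^{+}$ is the positive cone of a Banach lattice $E$; $E^{*}$ has its natural Banach lattice order; $\mathcal{L}^{+}(E;F)$ is the set of positive bounded linear operators (mapping $E^{+}$ into $F^{+}$). $\|\cdot\|_{p}$ is the $\ell_{p}^{n}$-norm and $\|(x_{i})_{i=1}^{n}\|_{q,w}=\sup_{x^{*}\in B_{X^{*}}}\left(\sum_{i=1}^{n}|\langle x^{*},x_{i}\rangle|^{q}\right)^{1/q}$ for a finite sequence in a Banach space $X$ (with the usual maximum when $q=\infty$). For Banach lattices $E_{1},\dots,E_{m},F$, $T\in\mathcal{L}(E_{1},\dots,E_{m};F)$ is positive $(p_{1},\dots,p_{m};r)$-dominated if there is $C>0$ such that for every $n$, all $(x_{i}^{1},\dots,x_{i}^{m})\in E_{1}^{+}\times\dots\times E_{m}^{+}$ $(1\le i\le n)$ and all $y_{1}^{*},\dots,y_{n}^{*}\in F^{*+}$, $$\left\|\left(\langle T(x_{i}^{1},\dots,x_{i}^{m}),y_{i}^{*}\rangle\right)_{i=1}^{n}\right\|_{p}\le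 C\prod_{j=1}^{m}\left\|(x_{i}^{j})_{i=1}^{n}\right\|_{p_{j},w}\left\|(y_{i}^{*})_{i=1}^{n}\right\|_{r,w}.$$ The space of these operators is $\mathcal{D}_{(p_{1},\dots,p_{m};r)}^{+}(E_{1},\dots,E_{m};F)$, and $d_{(p_{1},\dots,p_{m};r)}^{+}(T)$ is the infimum of all such $C$. A class $\mathcal{M}^{+}$ of bounded $m$-linear operators between Banach lattices, with $\|\cdot\|_{\mathcal{M}^{+}}:\mathcal{M}^{+}\to[0,\infty)$, is a positive Banach multi-ideal if for all Banach lattices $E_{1},\dots,E_{m},F$ the component $\mathcal{M}^{+}(E_{1},\dots,E_{m};F):=\mathcal{L}(E_{1},\dots,E_{m};F)\cap\mathcal{M}^{+}$ satisfies: (i) it is a linear subspace of $\mathcal{L}(E_{1},\dots,E_{m};F)$ containing the $m$-linear mappings of finite rank, i.e. of the form $(x^{1},\dots,x^{m})\mapsto\sum_{i=1}^{k}x_{i,1}^{*}(x^{1})\cdots x_{i,m}^{*}(x^{m})\,y_{i}$ with $x_{i,j}^{*}\in E_{j}^{*}$, $y_{i}\in F$; (ii) if $T\in\mathcal{M}^{+}(E_{1},\dots,E_{m};F)$, $u_{j}\in\mathcal{L}^{+}(G_{j};E_{j})$ $(1\le j\le m)$ and $v\in\mathcal{L}^{+}(F;G)$ with $G_{1},\dots,G_m,G$ Banach lattices, then $v\circ T\circ(u_{1},\dots,u_{m})\in\mathcal{M}^{+}(G_{1},\dots,G_{m};G)$; a) each component is a Banach space under $\|\cdot\|_{\mathcal{M}^{+}}$;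 b) the form $T^{m}:\mathbb{K}^{m}\to\mathbb{K}$, $T^{m}(\lambda^{1},\dots,\lambda^{m})=\lambda^{1}\cdots\lambda^{m}$, satisfies $\|T^{m}\|_{\mathcal{M}^{+}}=1$; c) in the situation of (ii), $\|v\circ T\circ(u_{1},\dots,u_{m})\|_{\mathcal{M}^{+}}\le\|v\|\,\|T\|_{\mathcal{M}^{+}}\|u_{1}\|\cdots\|u_{m}\|$. *)

theory Defs
  imports "HOL-Analysis.Analysis" "HOL-Algebra.Module" "HOL-Algebra.Lattice"
begin

text \<open>
  A statement about all Banach lattices, and about families of different Banach lattices, needs
  spaces with explicit carriers. They are modules in the sense of HOL-Algebra over the scalars
  \<open>K\<close>, which is either \<open>\<real>\<close> or \<open>UNIV\<close> as a set of complex numbers. The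
  record fields for ring multiplication and unit that modules inherit are never used.
  Maps between spaces are extensional, so that equality of maps is equality on the domain.
\<close>

record 'a nspace = "(complex, 'a) module" +
  vnorm :: "'a \<Rightarrow> real"

record 'a blattice = "'a nspace" +
  pcone :: "'a set"

definition scalar_ring :: "complex set \<Rightarrow> complex ring" where
  "scalar_ring K = \<lparr>carrier = K, mult = (*), one = 1, zero = 0, add = (+)\<rparr>"

definition normed_space :: "complex set \<Rightarrow> ('a, 'b) nspace_scheme \<Rightarrow> bool" where
  "normed_space K X \<longleftrightarrow> module (scalar_ring K) X \<and>
     (\<forall>x\<in>carrier X. 0 \<le> vnorm X x \<and> (vnorm X x = 0 \<longleftrightarrow> x = \<zero>\<^bsub>X\<^esub>)) \<and>
     (\<forall>x\<in>carrier X. \<forall>y\<in>carrier X. vnorm X (x \<oplus>\<^bsub>X\<^esub> y) \<le> vnorm X x + vnorm X y) \<and>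
     (\<forall>a\<in>K. \<forall>x\<in>carrier X. vnorm X (a \<odot>\<^bsub>X\<^esub> x) = cmod a * vnorm X x)"

text \<open>The locale \<^locale>\<open>Metric_space\<close> wants a distance that is nonnegative and symmetric on the
  whole type; hence the value 0 off the carrier.\<close>

definition vdist :: "('a, 'b) nspace_scheme \<Rightarrow> 'a \<Rightarrow> 'a \<Rightarrow> real" where
  "vdist X x y = (if x \<in> carrier X \<and> y \<in> carrier X then vnorm X (x \<ominus>\<^bsub>X\<^esub> y) else 0)"

definition banach_space :: "complex set \<Rightarrow> ('a, 'b) nspace_scheme \<Rightarrow> bool" where
  "banach_space K X \<longleftrightarrow> normed_space K X \<and> Metric_space.mcomplete (carrier X) (vdist X)"


section \<open>Banach lattices\<close>

definition cone_order :: "'a blattice \<Rightarrow> 'a gorder" where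
  "cone_order E = \<lparr>carrier = carrier E, eq = (=), le = (\<lambda>x y. y \<ominus>\<^bsub>E\<^esub> x \<in> pcone E)\<rparr>"

definition lattice_abs :: "'a blattice \<Rightarrow> 'a \<Rightarrow> 'a" where
  "lattice_abs E x = x \<squnion>\<^bsub>cone_order E\<^esub> (\<ominus>\<^bsub>E\<^esub> x)"

definition real_banach_lattice :: "'a blattice \<Rightarrow> bool" where
  "real_banach_lattice E \<longleftrightarrow> banach_space \<real> E \<and>
     pcone E \<subseteq> carrier E \<and>
     (\<forall>x\<in>pcone E. \<forall>y\<in>pcone E. x \<oplus>\<^bsub>E\<^esub> y \<in> pcone E) \<and>
     (\<forall>t\<ge>0. \<forall>x\<in>pcone E. complex_of_real t \<odot>\<^bsub>E\<^esub> x \<in> pcone E) \<and>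
     Lattice.lattice (cone_order E) \<and>
     (\<forall>x\<in>carrier E. \<forall>y\<in>carrier E.
        lattice_abs E x \<sqsubseteq>\<^bsub>cone_order E\<^esub> lattice_abs E y \<longrightarrow> vnorm E x \<le> vnorm E y)"

text \<open>A complex Banach lattice is the complexification of a real one, with
  \<open>\<bar>x + i y\<bar> = sup {(cos \<theta>) x + (sin \<theta>) y | \<theta>}\<close> and norm
  \<open>\<parallel>z\<parallel> = \<parallel>\<bar>z\<bar>\<parallel>\<close>.  As a vector lattice is spanned by its positive cone,
  its real part is recovered from the cone.\<close>

definition real_part :: "'a blattice \<Rightarrow> 'a blattice" where
  "real_part E = E\<lparr>carrier := {x \<ominus>\<^bsub>E\<^esub> y | x y. x \<in> pcone E \<and> y \<in> pcone E}\<rparr>"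

definition is_modulus :: "'a blattice \<Rightarrow> 'a \<Rightarrow> 'a \<Rightarrow> 'a \<Rightarrow> bool" where
  "is_modulus E x y w \<longleftrightarrow> least (cone_order (real_part E)) w (Upper (cone_order (real_part E))
     {complex_of_real (cos \<theta>) \<odot>\<^bsub>E\<^esub> x \<oplus>\<^bsub>E\<^esub> complex_of_real (sin \<theta>) \<odot>\<^bsub>E\<^esub> y | \<theta>. True})"

definition complex_banach_lattice :: "'a blattice \<Rightarrow> bool" where
  "complex_banach_lattice E \<longleftrightarrow> banach_space UNIV E \<and> pcone E \<subseteq> carrier E \<and>
     real_banach_lattice (real_part E) \<and>
     (\<forall>z\<in>carrier E. \<exists>!(x, y). x \<in> carrier (real_part E) \<and> y \<in> carrier (real_part E) \<and>
        z = x \<oplus>\<^bsub>E\<^esub> \<i> \<odot>\<^bsub>E\<^esub> y) \<and>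
     (\<forall>x\<in>carrier (real_part E). \<forall>y\<in>carrier (real_part E).
        \<exists>w. is_modulus E x y w \<and> vnorm E (x \<oplus>\<^bsub>E\<^esub> \<i> \<odot>\<^bsub>E\<^esub> y) = vnorm E w)"

definition banach_lattice :: "complex set \<Rightarrow> 'a blattice \<Rightarrow> bool" where
  "banach_lattice K E \<longleftrightarrow>
     K = \<real> \<and> real_banach_lattice E \<or> K = UNIV \<and> complex_banach_lattice E"

definition scalar_space :: "complex set \<Rightarrow> complex blattice" where
  "scalar_space K = \<lparr>carrier = K, mult = (*), one = 1, zero = 0, add = (+), smult = (*),
     vnorm = cmod, pcone = \<real>\<^sub>\<ge>\<^sub>0\<rparr>"


section \<open>Linear and multilinear operators, duals\<close>

definition linear_map ::
  "complex set \<Rightarrow> ('a, 'c) nspace_scheme \<Rightarrow> ('b, 'd) nspace_scheme \<Rightarrow> ('a \<Rightarrow> 'b) \<Rightarrow> bool" where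
  "linear_map K X Y f \<longleftrightarrow> f \<in> carrier X \<rightarrow>\<^sub>E carrier Y \<and>
     (\<forall>x\<in>carrier X. \<forall>y\<in>carrier X. f (x \<oplus>\<^bsub>X\<^esub> y) = f x \<oplus>\<^bsub>Y\<^esub> f y) \<and>
     (\<forall>a\<in>K. \<forall>x\<in>carrier X. f (a \<odot>\<^bsub>X\<^esub> x) = a \<odot>\<^bsub>Y\<^esub> f x)"

definition bounded_linear_ops ::
  "complex set \<Rightarrow> ('a, 'c) nspace_scheme \<Rightarrow> ('b, 'd) nspace_scheme \<Rightarrow> ('a \<Rightarrow> 'b) set" where
  "bounded_linear_ops K X Y =
     {f. linear_map K X Y f \<and> (\<exists>C. \<forall>x\<in>carrier X. vnorm Y (f x) \<le> C * vnorm X x)}"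

definition op_norm :: "('a, 'c) nspace_scheme \<Rightarrow> ('b, 'd) nspace_scheme \<Rightarrow> ('a \<Rightarrow> 'b) \<Rightarrow> real" where
  "op_norm X Y f = (SUP x\<in>{x \<in> carrier X. vnorm X x \<le> 1}. vnorm Y (f x))"

definition positive_ops :: "complex set \<Rightarrow> 'a blattice \<Rightarrow> 'b blattice \<Rightarrow> ('a \<Rightarrow> 'b) set" where
  "positive_ops K E F = {u \<in> bounded_linear_ops K E F. \<forall>x\<in>pcone E. u x \<in> pcone F}"

text \<open>A set \<open>A\<close> of maps from \<open>D\<close> to \<open>Y\<close> with the pointwise operations and a given norm.\<close>

definition map_space ::
  "'a set \<Rightarrow> ('b, 'c) nspace_scheme \<Rightarrow> ('a \<Rightarrow> 'b) set \<Rightarrow> (('a \<Rightarrow> 'b) \<Rightarrow> real) \<Rightarrow> ('a \<Rightarrow> 'b) nspace" where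
  "map_space D Y A N = \<lparr>carrier = A, mult = undefined, one = undefined,
     zero = (\<lambda>x\<in>D. \<zero>\<^bsub>Y\<^esub>), add = (\<lambda>f g. \<lambda>x\<in>D. f x \<oplus>\<^bsub>Y\<^esub> g x),
     smult = (\<lambda>a f. \<lambda>x\<in>D. a \<odot>\<^bsub>Y\<^esub> f x), vnorm = N\<rparr>"

definition dual :: "complex set \<Rightarrow> ('a, 'c) nspace_scheme \<Rightarrow> ('a \<Rightarrow> complex) nspace" where
  "dual K X = map_space (carrier X) (scalar_space K)
     (bounded_linear_ops K X (scalar_space K)) (op_norm X (scalar_space K))"

definition dual_cone :: "complex set \<Rightarrow> 'a blattice \<Rightarrow> ('a \<Rightarrow> complex) set" where
  "dual_cone K E = positive_ops K E (scalar_space K)"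

text \<open>The index type \<open>'m\<close> plays the role of \<open>{1, \<dots>, m}\<close>.\<close>

definition mdom :: "('m \<Rightarrow> ('a, 'c) nspace_scheme) \<Rightarrow> ('m \<Rightarrow> 'a) set" where
  "mdom E = {x. \<forall>j. x j \<in> carrier (E j)}"

definition multilinear_map :: "complex set \<Rightarrow> ('m \<Rightarrow> ('a, 'c) nspace_scheme) \<Rightarrow>
    ('b, 'd) nspace_scheme \<Rightarrow> (('m \<Rightarrow> 'a) \<Rightarrow> 'b) \<Rightarrow> bool" where
  "multilinear_map K E F T \<longleftrightarrow> T \<in> mdom E \<rightarrow>\<^sub>E carrier F \<and>
     (\<forall>j. \<forall>x\<in>mdom E. linear_map K (E j) F (\<lambda>y\<in>carrier (E j). T (x(j := y))))"

definition bounded_multilinear_ops :: "complex set \<Rightarrow> ('m::finite \<Rightarrow> ('a, 'c) nspace_scheme) \<Rightarrow>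
    ('b, 'd) nspace_scheme \<Rightarrow> (('m \<Rightarrow> 'a) \<Rightarrow> 'b) set" where
  "bounded_multilinear_ops K E F = {T. multilinear_map K E F T \<and>
     (\<exists>C. \<forall>x\<in>mdom E. vnorm F (T x) \<le> C * (\<Prod>j\<in>UNIV. vnorm (E j) (x j)))}"

definition multilinear_norm ::
  "('m \<Rightarrow> ('a, 'c) nspace_scheme) \<Rightarrow> ('b, 'd) nspace_scheme \<Rightarrow> (('m \<Rightarrow> 'a) \<Rightarrow> 'b) \<Rightarrow> real" where
  "multilinear_norm E F T = (SUP x\<in>{x \<in> mdom E. \<forall>j. vnorm (E j) (x j) \<le> 1}. vnorm F (T x))"

definition multilinear_space :: "complex set \<Rightarrow> ('m::finite \<Rightarrow> ('a, 'c) nspace_scheme) \<Rightarrow>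
    ('b, 'd) nspace_scheme \<Rightarrow> (('m \<Rightarrow> 'a) \<Rightarrow> 'b) nspace" where
  "multilinear_space K E F =
     map_space (mdom E) F (bounded_multilinear_ops K E F) (multilinear_norm E F)"

definition finite_rank_ops :: "complex set \<Rightarrow> ('m::finite \<Rightarrow> ('a, 'c) nspace_scheme) \<Rightarrow>
    ('b, 'd) nspace_scheme \<Rightarrow> (('m \<Rightarrow> 'a) \<Rightarrow> 'b) set" where
  "finite_rank_ops K E F =
     {(\<lambda>x\<in>mdom E. \<Oplus>\<^bsub>F\<^esub>i\<in>{..<k}. (\<Prod>j\<in>UNIV. \<phi> i j (x j)) \<odot>\<^bsub>F\<^esub> y i) | (k::nat) \<phi> y.
        (\<forall>i<k. y i \<in> carrier F \<and> (\<forall>j. \<phi> i j \<in> carrier (dual K (E j))))}"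


section \<open>Strong and weak summing norms, positive dominated operators\<close>

text \<open>Finite sequences of length \<open>n \<ge> 1\<close> are indexed by \<open>{..<n}\<close>.\<close>

definition lp_norm :: "ennreal \<Rightarrow> nat \<Rightarrow> (nat \<Rightarrow> complex) \<Rightarrow> real" where
  "lp_norm p n a = (if p = \<infinity> then (MAX i\<in>{..<n}. cmod (a i))
     else (\<Sum>i<n. cmod (a i) powr enn2real p) powr (1 / enn2real p))"

definition weak_norm ::
  "complex set \<Rightarrow> ('a, 'c) nspace_scheme \<Rightarrow> ennreal \<Rightarrow> nat \<Rightarrow> (nat \<Rightarrow> 'a) \<Rightarrow> real" where
  "weak_norm K X q n x =
     (SUP f\<in>{f \<in> carrier (dual K X). vnorm (dual K X) f \<le> 1}. lp_norm q n (\<lambda>i. f (x i)))"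

definition dominated_by :: "complex set \<Rightarrow> ennreal \<Rightarrow> ('m::finite \<Rightarrow> ennreal) \<Rightarrow> ennreal \<Rightarrow>
    ('m \<Rightarrow> 'a blattice) \<Rightarrow> 'a blattice \<Rightarrow> (('m \<Rightarrow> 'a) \<Rightarrow> 'a) \<Rightarrow> real \<Rightarrow> bool" where
  "dominated_by K p ps r E F T C \<longleftrightarrow>
     (\<forall>n\<ge>1. \<forall>x :: nat \<Rightarrow> 'm \<Rightarrow> 'a. \<forall>y :: nat \<Rightarrow> 'a \<Rightarrow> complex.
        (\<forall>i<n. (\<forall>j. x i j \<in> pcone (E j)) \<and> y i \<in> dual_cone K F) \<longrightarrow>
        lp_norm p n (\<lambda>i. y i (T (x i))) \<le>
          C * (\<Prod>j\<in>UNIV. weak_norm K (E j) (ps j) n (\<lambda>i. x i j)) * weak_norm K (dual K F) r n y)"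

definition positive_dominated_ops :: "complex set \<Rightarrow> ennreal \<Rightarrow> ('m::finite \<Rightarrow> ennreal) \<Rightarrow> ennreal \<Rightarrow>
    ('m \<Rightarrow> 'a blattice) \<Rightarrow> 'a blattice \<Rightarrow> (('m \<Rightarrow> 'a) \<Rightarrow> 'a) set" where
  "positive_dominated_ops K p ps r E F =
     {T \<in> bounded_multilinear_ops K E F. \<exists>C>0. dominated_by K p ps r E F T C}"

definition positive_dominated_norm :: "complex set \<Rightarrow> ennreal \<Rightarrow> ('m::finite \<Rightarrow> ennreal) \<Rightarrow> ennreal \<Rightarrow>
    ('m \<Rightarrow> 'a blattice) \<Rightarrow> 'a blattice \<Rightarrow> (('m \<Rightarrow> 'a) \<Rightarrow> 'a) \<Rightarrow> real" where
  "positive_dominated_norm K p ps r E F T = Inf {C. C > 0 \<and> dominated_by K p ps r E F T C}"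


section \<open>Positive Banach multi-ideals\<close>

text \<open>All Banach lattices of an ideal live in one type.  It is a sum type whose left summand hosts
  the scalars; the right summand is an arbitrary type \<open>'a\<close>, so that
  Banach lattices of any cardinality occur up to isomorphism.\<close>

definition scalar_lattice :: "complex set \<Rightarrow> (complex + 'a) blattice" where
  "scalar_lattice K = \<lparr>carrier = Inl ` K,
     mult = (\<lambda>x y. Inl (projl x * projl y)), one = Inl 1,
     zero = Inl 0, add = (\<lambda>x y. Inl (projl x + projl y)), smult = (\<lambda>a x. Inl (a * projl x)),
     vnorm = (\<lambda>x. cmod (projl x)), pcone = Inl ` \<real>\<^sub>\<ge>\<^sub>0\<rparr>"

definition scalar_form :: "complex set \<Rightarrow> ('m::finite \<Rightarrow> complex + 'a) \<Rightarrow> complex + 'a" where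
  "scalar_form K = (\<lambda>x\<in>mdom (\<lambda>_. scalar_lattice K). Inl (\<Prod>j\<in>UNIV. projl (x j)))"

definition compose_ops :: "('m \<Rightarrow> 'a blattice) \<Rightarrow> ('a \<Rightarrow> 'a) \<Rightarrow> (('m \<Rightarrow> 'a) \<Rightarrow> 'a) \<Rightarrow>
    ('m \<Rightarrow> 'a \<Rightarrow> 'a) \<Rightarrow> ('m \<Rightarrow> 'a) \<Rightarrow> 'a" where
  "compose_ops G v T u = (\<lambda>x\<in>mdom G. v (T (\<lambda>j. u j (x j))))"

text \<open>The class is given by its components \<open>M E F\<close>, with norm \<open>N E F\<close> on \<open>M E F\<close>.\<close>

definition positive_banach_multi_ideal :: "complex set \<Rightarrow>
    (('m::finite \<Rightarrow> (complex + 'a) blattice) \<Rightarrow> (complex + 'a) blattice \<Rightarrow>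
      (('m \<Rightarrow> complex + 'a) \<Rightarrow> complex + 'a) set) \<Rightarrow>
    (('m \<Rightarrow> (complex + 'a) blattice) \<Rightarrow> (complex + 'a) blattice \<Rightarrow>
      (('m \<Rightarrow> complex + 'a) \<Rightarrow> complex + 'a) \<Rightarrow> real) \<Rightarrow> bool" where
  "positive_banach_multi_ideal K M N \<longleftrightarrow>
     (\<forall>E F. (\<forall>j. banach_lattice K (E j)) \<and> banach_lattice K F \<longrightarrow>
        submodule (M E F) (scalar_ring K) (multilinear_space K E F) \<and>
        finite_rank_ops K E F \<subseteq> M E F \<and>
        banach_space K (map_space (mdom E) F (M E F) (N E F))) \<and>
     (\<forall>E F G H T u v. (\<forall>j. banach_lattice K (E j)) \<and> banach_lattice K F \<and>
        (\<forall>j. banach_lattice K (G j)) \<and> banach_lattice K H \<and>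
        T \<in> M E F \<and> (\<forall>j. u j \<in> positive_ops K (G j) (E j)) \<and> v \<in> positive_ops K F H \<longrightarrow>
        compose_ops G v T u \<in> M G H \<and>
        N G H (compose_ops G v T u) \<le>
          op_norm F H v * N E F T * (\<Prod>j\<in>UNIV. op_norm (G j) (E j) (u j))) \<and>
     N (\<lambda>_. scalar_lattice K) (scalar_lattice K) (scalar_form K) = 1"

end

theory Submission
  imports Defs
begin

text \<open>
  Almost every clause of the ideal property is a manipulation of the defining inequality of positive
  dominated operators.  Sums are handled by Minkowski's inequality (\<open>lp_norm_triangle\<close>).  Operators
  of rank one, and with them all operators of finite rank, are dominated by Hoelder's inequality with
  the exponents \<open>p\<^sub>1, \<dots>, p\<^sub>m, r\<close> (\<open>lp_norm_Hoelder\<close>, \<open>dominated_rank_one\<close>); this is where the relation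
  between the exponents enters.  The product form on the scalars is of rank one as well, which bounds
  its norm by 1, and the test with a single vector shows that no smaller constant will do.  In a composition
  \<open>v \<circ> T \<circ> (u\<^sub>1, \<dots>, u\<^sub>m)\<close> the maps \<open>u\<^sub>j\<close> and the adjoint of \<open>v\<close> preserve positivity and enlarge weak
  norms at most by their operator norms (\<open>weak_norm_image\<close>, \<open>adjoint\<close>).

  What remains is that the dominated norm is definite and complete.  Both follow once it is
  known to control the supremum norm up to a constant (\<open>dominated_bound\<close>), although the defining inequality
  only tests positive vectors and positive functionals.  The passage to arbitrary vectors uses that
  every vector is a combination of at most four positive ones of comparable norm
  (\<open>combination_of_positives\<close>).  The passage to the norm of the value uses that positive functionals determine
  the norm up to a constant factor (\<open>positive_functionals_norming\<close>).  To find them, the Hahn-Banach theorem is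
  applied to the gauge \<open>x \<mapsto> \<parallel>x\<^sup>+\<parallel>\<close>: a linear functional below this gauge is automatically positive and
  contractive, and it may be chosen to take the value \<open>\<parallel>z\<^sup>+\<parallel>\<close> at a given \<open>z\<close>.  For complex lattices these
  functionals are complexified.  A Cauchy sequence of dominated operators then converges pointwise, and the
  inequalities pass to the limit because each of them involves only finitely many values.
\<close>

section \<open>Finite-dimensional \<open>\<ell>\<^sub>p\<close>-norms\<close>

lemma enn2real_ge_1:
  assumes "1 \<le> (p::ennreal)" "p \<noteq> \<infinity>"
  shows "1 \<le> enn2real p"
  using assms by (metis enn2real_1 enn2real_mono infinity_ennreal_def top.not_eq_extremum)

lemma lp_norm_top: "lp_norm top_class.top n a = (MAX i\<in>{..<n}. cmod (a i))"
  by (simp add: lp_norm_def)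

lemma lp_norm_finite:
  "p \<noteq> \<infinity> \<Longrightarrow> lp_norm p n a = (\<Sum>i<n. cmod (a i) powr enn2real p) powr (1 / enn2real p)"
  by (simp add: lp_norm_def)

lemma lp_norm_top_le_iff:
  assumes "1 \<le> n" "0 < s"
  shows "lp_norm top_class.top n a \<le> s \<longleftrightarrow> (\<forall>i<n. cmod (a i) / s \<le> 1)"
proof -
  have "{..<n} \<noteq> {}" using assms by (auto simp: lessThan_empty_iff)
  then show ?thesis using assms by (auto simp: lp_norm_top lessThan_empty_iff)
qed

lemma lp_norm_finite_le_iff:
  assumes "1 \<le> p" "p \<noteq> \<infinity>" "0 < s"
  shows "lp_norm p n a \<le> s \<longleftrightarrow> (\<Sum>i<n. (cmod (a i) / s) powr enn2real p) \<le> 1"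
proof -
  define P where "P = enn2real p"
  have P: "1 \<le> P" using enn2real_ge_1[OF assms(1,2)] by (simp add: P_def)
  define S where "S = (\<Sum>i<n. cmod (a i) powr P)"
  have S0: "0 \<le> S" by (simp add: S_def sum_nonneg)
  have sP: "0 < s powr P" using assms by simp
  have "(\<Sum>i<n. (cmod (a i) / s) powr P) = S / s powr P"
    using assms by (simp add: S_def sum_divide_distrib powr_divide)
  then have "(\<Sum>i<n. (cmod (a i) / s) powr P) \<le> 1 \<longleftrightarrow> S \<le> s powr P"
    using sP by (simp add: divide_le_eq)
  also have "\<dots> \<longleftrightarrow> S powr (1 / P) \<le> s"
  proof
    assume "S \<le> s powr P"
    then have "S powr (1 / P) \<le> (s powr P) powr (1 / P)"
      using S0 P by (intro powr_mono2) auto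
    also have "\<dots> = s" using P assms by (simp add: powr_powr)
    finally show "S powr (1 / P) \<le> s" .
  next
    assume "S powr (1 / P) \<le> s"
    then have "(S powr (1 / P)) powr P \<le> s powr P"
      using P by (intro powr_mono2) auto
    moreover have "(S powr (1 / P)) powr P = S" using S0 P by (simp add: powr_powr)
    ultimately show "S \<le> s powr P" by simp
  qed
  finally show ?thesis using assms by (simp add: lp_norm_finite S_def P_def)
qed

lemma lp_norm_mono:
  assumes "1 \<le> p" "1 \<le> n" "\<And>i. i < n \<Longrightarrow> cmod (a i) \<le> cmod (b i)"
  shows "lp_norm p n a \<le> lp_norm p n b"
proof (cases "p = \<infinity>")
  case True
  have "cmod (a i) \<le> (MAX i\<in>{..<n}. cmod (b i))" if "i < n" for i
    using assms(3)[OF that] that by (intro order_trans[OF _ Max_ge]) auto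
  then show ?thesis using True assms by (simp add: lp_norm_top lessThan_empty_iff)
next
  case False
  then show ?thesis
    using assms enn2real_ge_1[OF assms(1) False]
    by (auto simp: lp_norm_finite intro!: powr_mono2 sum_mono sum_nonneg)
qed

lemma lp_norm_nonneg: "1 \<le> n \<Longrightarrow> 0 \<le> lp_norm p n a"
proof (cases "p = \<infinity>")
  case True
  assume "1 \<le> n"
  then have "cmod (a 0) \<le> lp_norm p n a"
    using True by (auto simp: lp_norm_top intro!: Max_ge)
  then show ?thesis by (meson norm_ge_zero order_trans)
qed (simp add: lp_norm_finite)

lemma lp_norm_one:
  assumes "1 \<le> p"
  shows "lp_norm p 1 a = cmod (a 0)"
proof (cases "p = \<infinity>")
  case False
  then show ?thesis
    using enn2real_ge_1[OF assms False] by (simp add: lp_norm_finite powr_powr)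
qed (simp add: lp_norm_top lessThan_Suc)

lemma lp_norm_scale:
  assumes "1 \<le> p" "1 \<le> n"
  shows "lp_norm p n (\<lambda>i. c * a i) = cmod c * lp_norm p n a"
proof (cases "p = \<infinity>")
  case True
  have "cmod c * (MAX i\<in>{..<n}. cmod (a i)) = Max ((\<lambda>x. cmod c * x) ` (\<lambda>i. cmod (a i)) ` {..<n})"
    using assms lessThan_empty_iff[of n] by (intro mono_Max_commute) (auto simp: mono_def mult_left_mono)
  then show ?thesis using True by (simp add: lp_norm_top norm_mult image_image)
next
  case False
  define P where "P = enn2real p"
  have P: "1 \<le> P" using enn2real_ge_1[OF assms(1) False] by (simp add: P_def)
  have "(\<Sum>i<n. cmod (c * a i) powr P) = cmod c powr P * (\<Sum>i<n. cmod (a i) powr P)"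
    by (simp add: norm_mult powr_mult sum_distrib_left)
  then show ?thesis
    using False P by (simp add: lp_norm_finite P_def[symmetric] powr_mult powr_powr sum_nonneg)
qed

text \<open>This crude bound makes \<open>\<ell>\<^sub>p\<close>-norms of fixed length tend to 0 with the coordinates.\<close>

lemma lp_norm_coord_bound:
  assumes "1 \<le> p" "1 \<le> n" "0 \<le> d" "\<And>i. i < n \<Longrightarrow> cmod (a i) \<le> d"
  shows "lp_norm p n a \<le> d * lp_norm p n (\<lambda>_. 1)"
proof -
  have "lp_norm p n a \<le> lp_norm p n (\<lambda>i. of_real d * 1)"
    using assms by (intro lp_norm_mono) auto
  also have "\<dots> = d * lp_norm p n (\<lambda>_. 1)"
    using assms by (subst lp_norm_scale) auto
  finally show ?thesis .
qed

lemma powr_convex_nonneg: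
  fixes x y :: real
  assumes "1 \<le> p" "0 \<le> u" "0 \<le> v" "u + v = 1" "0 \<le> x" "0 \<le> y"
  shows "(u * x + v * y) powr p \<le> u * x powr p + v * y powr p"
proof -
  have shrink: "w powr p \<le> w" if "0 \<le> w" "w \<le> 1" for w :: real
    using powr_mono'[of 1 p w] that assms(1) by (cases "w = 0") auto
  consider "x = 0" | "y = 0" | "0 < x" "0 < y" using assms by linarith
  then show ?thesis
  proof cases
    case 1
    then show ?thesis using assms shrink[of v]
      by (auto simp: powr_mult intro!: mult_right_mono)
  next
    case 2
    then show ?thesis using assms shrink[of u]
      by (auto simp: powr_mult intro!: mult_right_mono)
  next
    case 3
    have u: "u = 1 - v" using assms by simp
    then show ?thesis
      unfolding u using convex_onD[OF powr_convex[OF assms(1)], of v x y] 3 assms by simp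
  qed
qed

text \<open>Minkowski's inequality.  The unit ball is convex because \<open>t \<mapsto> t\<^sup>p\<close> is, so
  \<open>a / s\<close> and \<open>b / t\<close> in the unit ball force \<open>(a + b) / (s + t)\<close> into it.
  Letting \<open>s\<close> and \<open>t\<close> be strictly larger than the two norms avoids division by zero.\<close>

lemma lp_norm_triangle:
  assumes p: "1 \<le> p" and n: "1 \<le> n"
  shows "lp_norm p n (\<lambda>i. a i + b i) \<le> lp_norm p n a + lp_norm p n b"
proof (rule field_le_epsilon)
  fix e :: real assume e: "0 < e"
  define s where "s = lp_norm p n a + e / 2"
  define t where "t = lp_norm p n b + e / 2"
  have st: "0 < s" "0 < t" using lp_norm_nonneg[OF n] e by (auto simp: s_def t_def add_nonneg_pos)
  have la: "lp_norm p n a \<le> s" and lb: "lp_norm p n b \<le> t" using e by (auto simp: s_def t_def)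
  define u where "u = s / (s + t)"
  define v where "v = t / (s + t)"
  have uv: "0 \<le> u" "0 \<le> v" "u + v = 1"
    using st by (auto simp: u_def v_def add_divide_distrib[symmetric])
  have le: "cmod (a i + b i) / (s + t) \<le> u * (cmod (a i) / s) + v * (cmod (b i) / t)" for i
    using st norm_triangle_ineq[of "a i" "b i"]
    by (simp add: u_def v_def add_divide_distrib[symmetric] divide_right_mono)
  have "lp_norm p n (\<lambda>i. a i + b i) \<le> s + t"
  proof (cases "p = \<infinity>")
    case True
    have "cmod (a i + b i) / (s + t) \<le> 1" if "i < n" for i
    proof -
      have "cmod (a i) / s \<le> 1" "cmod (b i) / t \<le> 1"
        using la lb st that True by (auto simp: lp_norm_top_le_iff[OF n])
      then have "u * (cmod (a i) / s) + v * (cmod (b i) / t) \<le> u * 1 + v * 1"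
        using uv by (intro add_mono mult_left_mono) auto
      then show ?thesis using le[of i] uv by simp
    qed
    then show ?thesis using True st by (simp add: lp_norm_top_le_iff[OF n])
  next
    case False
    define P where "P = enn2real p"
    have P: "1 \<le> P" using enn2real_ge_1[OF p False] by (simp add: P_def)
    have sa: "(\<Sum>i<n. (cmod (a i) / s) powr P) \<le> 1" and sb: "(\<Sum>i<n. (cmod (b i) / t) powr P) \<le> 1"
      using la lb st False by (auto simp: lp_norm_finite_le_iff[OF p False] P_def)
    have "(\<Sum>i<n. (cmod (a i + b i) / (s + t)) powr P)
        \<le> (\<Sum>i<n. (u * (cmod (a i) / s) + v * (cmod (b i) / t)) powr P)"
      using P st by (intro sum_mono powr_mono2 le) auto
    also have "\<dots> \<le> (\<Sum>i<n. u * (cmod (a i) / s) powr P + v * (cmod (b i) / t) powr P)"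
      using P st uv by (intro sum_mono powr_convex_nonneg) auto
    also have "\<dots> = u * (\<Sum>i<n. (cmod (a i) / s) powr P) + v * (\<Sum>i<n. (cmod (b i) / t) powr P)"
      by (simp add: sum.distrib sum_distrib_left)
    also have "\<dots> \<le> u * 1 + v * 1" using uv sa sb by (intro add_mono mult_left_mono) auto
    also have "\<dots> = 1" using uv by simp
    finally show ?thesis using st by (simp add: lp_norm_finite_le_iff[OF p False] P_def)
  qed
  then show "lp_norm p n (\<lambda>i. a i + b i) \<le> lp_norm p n a + lp_norm p n b + e"
    by (simp add: s_def t_def)
qed

text \<open>Concavity of \<open>ln\<close>, applied to the positive \<open>x j\<close>; a vanishing \<open>x j\<close> makes the product 0
  even for \<open>w j = 0\<close>, by the convention \<open>0 powr 0 = 0\<close>.\<close>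

lemma weighted_arith_geom_mean:
  fixes x w :: "'i \<Rightarrow> real"
  assumes "finite J" "\<And>j. j \<in> J \<Longrightarrow> 0 \<le> w j" "sum w J = 1" "\<And>j. j \<in> J \<Longrightarrow> 0 \<le> x j"
  shows "(\<Prod>j\<in>J. x j powr w j) \<le> (\<Sum>j\<in>J. w j * x j)"
proof (cases "\<exists>j\<in>J. x j = 0")
  case True
  then have "(\<Prod>j\<in>J. x j powr w j) = 0" using assms(1) by (auto intro!: prod_zero)
  moreover have "0 \<le> (\<Sum>j\<in>J. w j * x j)" using assms by (intro sum_nonneg) auto
  ultimately show ?thesis by simp
next
  case False
  then have pos: "0 < x j" if "j \<in> J" for j using assms(4)[OF that] that by fastforce
  have ne: "J \<noteq> {}" using assms(3) by auto
  obtain j0 where j0: "j0 \<in> J" "0 < w j0"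
    using assms by (metis less_eq_real_def sum.neutral zero_neq_one)
  have sp: "0 < (\<Sum>j\<in>J. w j * x j)"
    using assms pos j0 by (intro sum_pos2[of _ j0]) (auto simp: less_imp_le)
  have "(\<Sum>j\<in>J. w j * ln (x j)) \<le> ln (\<Sum>j\<in>J. w j *\<^sub>R x j)"
    using assms pos ne by (intro concave_on_sum[OF _ _ ln_concave]) auto
  then have "exp (\<Sum>j\<in>J. w j * ln (x j)) \<le> (\<Sum>j\<in>J. w j * x j)"
    using sp by (simp add: ln_ge_iff)
  moreover have "(\<Prod>j\<in>J. x j powr w j) = exp (\<Sum>j\<in>J. w j * ln (x j))"
    unfolding exp_sum[OF assms(1)] using pos
    by (intro prod.cong refl) (auto simp: powr_def dest!: pos)
  ultimately show ?thesis by simp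
qed

text \<open>The relation between the exponents as one between real numbers, where infinite exponents
  contribute nothing.\<close>

lemma inverse_exponents_real:
  fixes q :: "'i \<Rightarrow> ennreal"
  assumes "1 \<le> p" "\<And>j. j \<in> J \<Longrightarrow> 1 \<le> q j" "finite J" "1 / p = (\<Sum>j\<in>J. 1 / q j)"
  shows "(if p = \<infinity> then 0 else 1 / enn2real p) = (\<Sum>j\<in>{j\<in>J. q j \<noteq> \<infinity>}. 1 / enn2real (q j))"
proof -
  have conv: "enn2real (1 / a) = (if a = \<infinity> then 0 else 1 / enn2real a) \<and> 1 / a < top_class.top"
    if "1 \<le> a" for a :: ennreal
  proof (cases "a = \<infinity>")
    case False
    define A where "A = enn2real a"
    have A: "1 \<le> A" using enn2real_ge_1[OF that False] by (simp add: A_def)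
    have aA: "a = ennreal A" using False by (simp add: A_def less_top)
    have "1 / a = ennreal (1 / A)"
      unfolding aA using divide_ennreal[of 1 A] A by simp
    then show ?thesis using False A by (simp add: A_def[symmetric])
  qed auto
  have "enn2real (\<Sum>j\<in>J. 1 / q j) = (\<Sum>j\<in>J. enn2real (1 / q j))"
    by (subst enn2real_sum) (use conv assms(2) in \<open>auto simp: o_def\<close>)
  also have "\<dots> = (\<Sum>j\<in>J. if q j = \<infinity> then 0 else 1 / enn2real (q j))"
    by (rule sum.cong) (use conv assms(2) in auto)
  also have "\<dots> = (\<Sum>j\<in>{j\<in>J. q j \<noteq> \<infinity>}. 1 / enn2real (q j))"
    using assms(3) by (simp add: sum.If_cases Int_def)
  finally have "enn2real (1 / p) = (\<Sum>j\<in>{j\<in>J. q j \<noteq> \<infinity>}. 1 / enn2real (q j))"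
    using assms(4) by simp
  then show ?thesis using conv[OF assms(1)] by simp
qed

text \<open>Hoelder's inequality for arbitrarily many factors.  If each \<open>a\<^sub>j / s\<^sub>j\<close> lies in the unit ball
  for the exponent \<open>q\<^sub>j\<close>, then the weighted AM-GM inequality with the weights \<open>p / q\<^sub>j\<close> puts the product into the
  unit ball for \<open>p\<close>; factors with infinite exponent are bounded by 1.  As for Minkowski's inequality,
  \<open>s\<^sub>j\<close> first exceeds the norm of \<open>a\<^sub>j\<close>, and then tends to it.\<close>

lemma lp_norm_Hoelder:
  fixes q :: "'i \<Rightarrow> ennreal"
  assumes p: "1 \<le> p" and q: "\<And>j. j \<in> J \<Longrightarrow> 1 \<le> q j" and fin: "finite J"
    and pq: "1 / p = (\<Sum>j\<in>J. 1 / q j)" and n: "1 \<le> n"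
  shows "lp_norm p n (\<lambda>i. \<Prod>j\<in>J. a j i) \<le> (\<Prod>j\<in>J. lp_norm (q j) n (a j))"
proof -
  have weak: "lp_norm p n (\<lambda>i. \<Prod>j\<in>J. a j i) \<le> (\<Prod>j\<in>J. s j)"
    if s: "\<And>j. j \<in> J \<Longrightarrow> 0 < s j" "\<And>j. j \<in> J \<Longrightarrow> lp_norm (q j) n (a j) \<le> s j" for s
  proof -
    define S where "S = (\<Prod>j\<in>J. s j)"
    define \<alpha> where "\<alpha> j i = cmod (a j i) / s j" for j i
    have S: "0 < S" using s by (auto simp: S_def intro: prod_pos)
    have \<alpha>0: "0 \<le> \<alpha> j i" if "j \<in> J" for j i using s(1)[OF that] by (simp add: \<alpha>_def)
    have \<alpha>: "cmod (\<Prod>j\<in>J. a j i) / S = (\<Prod>j\<in>J. \<alpha> j i)" for i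
      by (simp add: \<alpha>_def S_def prod_dividef prod_norm)
    have \<alpha>1: "\<alpha> j i \<le> 1" if "j \<in> J" "q j = \<infinity>" "i < n" for j i
      using s[OF that(1)] that(2,3) by (auto simp: lp_norm_top_le_iff[OF n] \<alpha>_def)
    define J' where "J' = {j\<in>J. q j \<noteq> \<infinity>}"
    have J': "finite J'" "J' \<subseteq> J" using fin by (auto simp: J'_def)
    have prod_le: "(\<Prod>j\<in>J. \<alpha> j i) \<le> (\<Prod>j\<in>J'. \<alpha> j i)" if "i < n" for i
    proof -
      have "(\<Prod>j\<in>J. \<alpha> j i) = (\<Prod>j\<in>J'. \<alpha> j i) * (\<Prod>j\<in>J - J'. \<alpha> j i)"
        using fin J' by (metis mult.commute prod.subset_diff)
      also have "\<dots> \<le> (\<Prod>j\<in>J'. \<alpha> j i) * 1"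
        using \<alpha>0 \<alpha>1 that J' by (intro mult_left_mono prod_le_1 prod_nonneg) (auto simp: J'_def)
      finally show ?thesis by simp
    qed
    note inv = inverse_exponents_real[OF p q fin pq, folded J'_def]
    show ?thesis
    proof (cases "p = \<infinity>")
      case True
      have "J' = {}"
      proof (rule ccontr)
        assume "J' \<noteq> {}"
        moreover have "0 < 1 / enn2real (q j)" if "j \<in> J'" for j
          using enn2real_ge_1[of "q j"] q that by (auto simp: J'_def)
        ultimately have "0 < (\<Sum>j\<in>J'. 1 / enn2real (q j))" using J' by (intro sum_pos) auto
        then show False using inv True by simp
      qed
      then show ?thesis using True S prod_le \<alpha>
        by (simp add: lp_norm_top_le_iff[OF n] flip: S_def)
    next
      case False
      define P where "P = enn2real p"
      have P: "1 \<le> P" using enn2real_ge_1[OF p False] by (simp add: P_def)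
      define Q where "Q j = enn2real (q j)" for j
      have Q: "1 \<le> Q j" if "j \<in> J'" for j
        using enn2real_ge_1[of "q j"] q that by (auto simp: J'_def Q_def)
      have w1: "(\<Sum>j\<in>J'. P / Q j) = 1"
      proof -
        have "(\<Sum>j\<in>J'. P / Q j) = P * (\<Sum>j\<in>J'. 1 / Q j)" by (simp add: sum_distrib_left)
        also have "(\<Sum>j\<in>J'. 1 / Q j) = 1 / P" using inv False by (simp add: P_def Q_def)
        finally show ?thesis using P by simp
      qed
      have le: "(cmod (\<Prod>j\<in>J. a j i) / S) powr P \<le> (\<Sum>j\<in>J'. P / Q j * \<alpha> j i powr Q j)"
        if "i < n" for i
      proof -
        have "(cmod (\<Prod>j\<in>J. a j i) / S) powr P \<le> (\<Prod>j\<in>J'. \<alpha> j i) powr P"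
          unfolding \<alpha> using P prod_le[OF that] \<alpha>0 by (intro powr_mono2 prod_nonneg) auto
        also have "\<dots> = (\<Prod>j\<in>J'. (\<alpha> j i powr Q j) powr (P / Q j))"
        proof -
          have "(\<Prod>j\<in>J'. \<alpha> j i) powr P = (\<Prod>j\<in>J'. \<alpha> j i powr P)"
            by (rule prod_powr_distrib)
          also have "\<dots> = (\<Prod>j\<in>J'. (\<alpha> j i powr Q j) powr (P / Q j))"
            using Q by (intro prod.cong refl) (force simp: powr_powr)
          finally show ?thesis .
        qed
        also have "\<dots> \<le> (\<Sum>j\<in>J'. P / Q j * \<alpha> j i powr Q j)"
          using J' w1 P Q by (intro weighted_arith_geom_mean) (auto intro!: divide_nonneg_nonneg dest: Q)
        finally show ?thesis .
      qed
      have "(\<Sum>i<n. (cmod (\<Prod>j\<in>J. a j i) / S) powr P)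
          \<le> (\<Sum>i<n. \<Sum>j\<in>J'. P / Q j * \<alpha> j i powr Q j)"
        by (intro sum_mono le) auto
      also have "\<dots> = (\<Sum>j\<in>J'. P / Q j * (\<Sum>i<n. \<alpha> j i powr Q j))"
        by (subst sum.swap) (simp add: sum_distrib_left)
      also have "\<dots> \<le> (\<Sum>j\<in>J'. P / Q j * 1)"
      proof (intro sum_mono mult_left_mono)
        fix j assume j: "j \<in> J'"
        then have jJ: "j \<in> J" and fq: "q j \<noteq> \<infinity>" by (auto simp: J'_def)
        show "(\<Sum>i<n. \<alpha> j i powr Q j) \<le> 1"
          using s[OF jJ] fq by (auto simp: lp_norm_finite_le_iff[OF q[OF jJ] fq] \<alpha>_def Q_def)
        show "0 \<le> P / Q j" using P Q[OF j] by simp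
      qed
      also have "\<dots> = 1" using w1 by simp
      finally show ?thesis using False S
        by (simp add: lp_norm_finite_le_iff[OF p False] P_def flip: S_def)
    qed
  qed
  have "((\<lambda>e. \<Prod>j\<in>J. lp_norm (q j) n (a j) + e) \<longlongrightarrow> (\<Prod>j\<in>J. lp_norm (q j) n (a j) + 0)) (at_right 0)"
    by (intro tendsto_prod tendsto_add tendsto_const tendsto_ident_at)
  then have "lp_norm p n (\<lambda>i. \<Prod>j\<in>J. a j i) \<le> (\<Prod>j\<in>J. lp_norm (q j) n (a j) + 0)"
  proof (rule tendsto_lowerbound)
    show "\<forall>\<^sub>F e in at_right 0. lp_norm p n (\<lambda>i. \<Prod>j\<in>J. a j i) \<le> (\<Prod>j\<in>J. lp_norm (q j) n (a j) + e)"
      unfolding eventually_at_right_field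
      by (intro exI[of _ 1]) (auto intro!: weak add_nonneg_pos lp_norm_nonneg n)
  qed auto
  then show ?thesis by simp
qed

section \<open>Normed spaces with explicit carrier\<close>

lemma scalar_ring_simps [simp]:
  "carrier (scalar_ring K) = K" "a \<oplus>\<^bsub>scalar_ring K\<^esub> b = a + b" "a \<otimes>\<^bsub>scalar_ring K\<^esub> b = a * b"
  "\<one>\<^bsub>scalar_ring K\<^esub> = 1" "\<zero>\<^bsub>scalar_ring K\<^esub> = 0"
  by (simp_all add: scalar_ring_def)

lemma scalars_closed:
  assumes "K = \<real> \<or> K = UNIV"
  shows "0 \<in> K" "1 \<in> K" "of_real t \<in> K" "a \<in> K \<Longrightarrow> b \<in> K \<Longrightarrow> a + b \<in> K"
    "a \<in> K \<Longrightarrow> b \<in> K \<Longrightarrow> a * b \<in> K" "a \<in> K \<Longrightarrow> - a \<in> K"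
    "a \<in> K \<Longrightarrow> b \<in> K \<Longrightarrow> a - b \<in> K"
  using assms by auto

lemma scalar_ring_cring:
  assumes K: "K = \<real> \<or> K = UNIV"
  shows "cring (scalar_ring K)"
proof (rule cringI)
  show "abelian_group (scalar_ring K)"
  proof (rule abelian_groupI)
    fix x assume "x \<in> carrier (scalar_ring K)"
    then show "\<exists>y\<in>carrier (scalar_ring K). y \<oplus>\<^bsub>scalar_ring K\<^esub> x = \<zero>\<^bsub>scalar_ring K\<^esub>"
      using scalars_closed[OF K] by (intro bexI[of _ "- x"]) auto
  qed (use scalars_closed[OF K] in auto)
  show "Group.comm_monoid (scalar_ring K)"
    by (rule comm_monoidI) (use scalars_closed[OF K] in auto)
qed (auto simp: algebra_simps)

locale nspace =
  fixes K :: "complex set" and X (structure)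
  assumes K: "K = \<real> \<or> K = UNIV" and ns: "normed_space K X"
begin

lemma vmodule: "module (scalar_ring K) X"
  using ns by (simp add: normed_space_def)

sublocale abelian_group X
  by (rule module.axioms(2)[OF vmodule])

lemmas scalars = scalars_closed[OF K]

lemma smult_closed [simp, intro]: "a \<in> K \<Longrightarrow> x \<in> carrier X \<Longrightarrow> a \<odot> x \<in> carrier X"
  using module.smult_closed[OF vmodule] by simp

lemma smult_add_left: "a \<in> K \<Longrightarrow> b \<in> K \<Longrightarrow> x \<in> carrier X \<Longrightarrow> (a + b) \<odot> x = a \<odot> x \<oplus> b \<odot> x"
  using module.smult_l_distr[OF vmodule] by simp

lemma smult_add_right:
  "a \<in> K \<Longrightarrow> x \<in> carrier X \<Longrightarrow> y \<in> carrier X \<Longrightarrow> a \<odot> (x \<oplus> y) = a \<odot> x \<oplus> a \<odot> y"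
  using module.smult_r_distr[OF vmodule] by simp

lemma smult_smult: "a \<in> K \<Longrightarrow> b \<in> K \<Longrightarrow> x \<in> carrier X \<Longrightarrow> a \<odot> (b \<odot> x) = (a * b) \<odot> x"
  using module.smult_assoc1[OF vmodule] by simp

lemma smult_one [simp]: "x \<in> carrier X \<Longrightarrow> 1 \<odot> x = x"
  using module.smult_one[OF vmodule] by simp

lemma smult_zero_left [simp]: "x \<in> carrier X \<Longrightarrow> 0 \<odot> x = \<zero>"
  using module.smult_l_null[OF vmodule] by simp

lemma smult_zero_right [simp]: "a \<in> K \<Longrightarrow> a \<odot> \<zero> = \<zero>"
  using module.smult_r_null[OF vmodule] by simp

lemma uminus_smult: "x \<in> carrier X \<Longrightarrow> \<ominus> x = (- 1) \<odot> x"
proof -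
  assume x: "x \<in> carrier X"
  have "(- 1) \<odot> x \<oplus> x = (- 1) \<odot> x \<oplus> 1 \<odot> x" using x by simp
  also have "\<dots> = \<zero>" using x scalars by (subst smult_add_left[symmetric]) auto
  finally show ?thesis using x scalars by (metis minus_equality smult_closed)
qed

lemma minus_smult: "x \<in> carrier X \<Longrightarrow> y \<in> carrier X \<Longrightarrow> x \<ominus> y = x \<oplus> (- 1) \<odot> y"
  by (simp add: a_minus_def uminus_smult)

lemma smult_minus:
  "a \<in> K \<Longrightarrow> x \<in> carrier X \<Longrightarrow> y \<in> carrier X \<Longrightarrow> a \<odot> (x \<ominus> y) = a \<odot> x \<ominus> a \<odot> y"
  using scalars by (simp add: minus_smult smult_add_right smult_smult mult.commute)

lemma minus_add_cancel: "x \<in> carrier X \<Longrightarrow> y \<in> carrier X \<Longrightarrow> (x \<ominus> y) \<oplus> y = x"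
  by (simp add: a_minus_def a_assoc l_neg)

lemma add_minus_cancel: "x \<in> carrier X \<Longrightarrow> y \<in> carrier X \<Longrightarrow> (x \<oplus> y) \<ominus> y = x"
  by (simp add: a_minus_def a_assoc r_neg)

lemma minus_minus_swap: "x \<in> carrier X \<Longrightarrow> y \<in> carrier X \<Longrightarrow> \<ominus> (x \<ominus> y) = y \<ominus> x"
  by (simp add: a_minus_def minus_add a_comm)

lemma add_minus_add:
  "x \<in> carrier X \<Longrightarrow> y \<in> carrier X \<Longrightarrow> z \<in> carrier X \<Longrightarrow> w \<in> carrier X \<Longrightarrow>
   (x \<oplus> y) \<ominus> (z \<oplus> w) = (x \<ominus> z) \<oplus> (y \<ominus> w)"
  by (simp add: a_minus_def minus_add a_ac)

lemma minus_split: "x \<in> carrier X \<Longrightarrow> y \<in> carrier X \<Longrightarrow> z \<in> carrier X \<Longrightarrow> x \<ominus> z = (x \<ominus> y) \<oplus> (y \<ominus> z)"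
proof -
  assume c: "x \<in> carrier X" "y \<in> carrier X" "z \<in> carrier X"
  have "(x \<ominus> y) \<oplus> (y \<ominus> z) = x \<oplus> ((\<ominus> y \<oplus> y) \<oplus> \<ominus> z)"
    using c by (simp only: a_minus_def a_assoc a_closed a_inv_closed)
  then show ?thesis using c by (simp add: l_neg a_minus_def)
qed

lemma norm_ge_zero [simp]: "x \<in> carrier X \<Longrightarrow> 0 \<le> vnorm X x"
  and norm_eq_zero: "x \<in> carrier X \<Longrightarrow> vnorm X x = 0 \<longleftrightarrow> x = \<zero>"
  and norm_triangle: "x \<in> carrier X \<Longrightarrow> y \<in> carrier X \<Longrightarrow> vnorm X (x \<oplus> y) \<le> vnorm X x + vnorm X y"
  and norm_smult: "a \<in> K \<Longrightarrow> x \<in> carrier X \<Longrightarrow> vnorm X (a \<odot> x) = cmod a * vnorm X x"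
  using ns by (auto simp: normed_space_def)

lemma norm_zero [simp]: "vnorm X \<zero> = 0"
  by (simp add: norm_eq_zero)

lemma norm_uminus [simp]: "x \<in> carrier X \<Longrightarrow> vnorm X (\<ominus> x) = vnorm X x"
  using scalars by (simp add: uminus_smult norm_smult)

lemma norm_minus_commute:
  "x \<in> carrier X \<Longrightarrow> y \<in> carrier X \<Longrightarrow> vnorm X (x \<ominus> y) = vnorm X (y \<ominus> x)"
  by (metis minus_minus_swap norm_uminus minus_closed)

lemma norm_minus_le:
  "x \<in> carrier X \<Longrightarrow> y \<in> carrier X \<Longrightarrow> vnorm X (x \<ominus> y) \<le> vnorm X x + vnorm X y"
  using norm_triangle[of x "\<ominus> y"] by (simp add: a_minus_def)

lemma norm_minus_triangle:
  "x \<in> carrier X \<Longrightarrow> y \<in> carrier X \<Longrightarrow> z \<in> carrier X \<Longrightarrow>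
   vnorm X (x \<ominus> z) \<le> vnorm X (x \<ominus> y) + vnorm X (y \<ominus> z)"
  using norm_triangle[of "x \<ominus> y" "y \<ominus> z"] by (simp flip: minus_split)

lemma minus_eq_zero: "x \<in> carrier X \<Longrightarrow> y \<in> carrier X \<Longrightarrow> x \<ominus> y = \<zero> \<longleftrightarrow> x = y"
  by (metis a_minus_def r_neg minus_add_cancel l_zero)

lemma vdist_metric: "Metric_space (carrier X) (vdist X)"
proof
  fix x y z
  show "0 \<le> vdist X x y" by (simp add: vdist_def)
  show "vdist X x y = vdist X y x" by (simp add: vdist_def norm_minus_commute)
  show "vdist X x y = 0 \<longleftrightarrow> x = y" if "x \<in> carrier X" "y \<in> carrier X"
    using that by (simp add: vdist_def norm_eq_zero minus_eq_zero)
  show "vdist X x z \<le> vdist X x y + vdist X y z"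
    if "x \<in> carrier X" "y \<in> carrier X" "z \<in> carrier X"
    using that norm_minus_triangle by (simp add: vdist_def)
qed

lemma complete_iff:
  "Metric_space.mcomplete (carrier X) (vdist X) \<longleftrightarrow>
    (\<forall>s. (\<forall>n::nat. s n \<in> carrier X) \<longrightarrow>
       (\<forall>e>0. \<exists>N. \<forall>n\<ge>N. \<forall>k\<ge>N. vnorm X (s n \<ominus> s k) < e) \<longrightarrow>
       (\<exists>l\<in>carrier X. \<forall>e>0. \<exists>N. \<forall>n\<ge>N. vnorm X (s n \<ominus> l) < e))"
proof -
  interpret Metric_space "carrier X" "vdist X" by (rule vdist_metric)
  have 1: "MCauchy s \<longleftrightarrow> (\<forall>n. s n \<in> carrier X) \<and>
      (\<forall>e>0. \<exists>N. \<forall>n\<ge>N. \<forall>k\<ge>N. vnorm X (s n \<ominus> s k) < e)" for s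
    unfolding MCauchy_def by (auto simp: vdist_def image_subset_iff)
  have 2: "limitin mtopology s l sequentially \<longleftrightarrow>
      l \<in> carrier X \<and> (\<forall>e>0. \<exists>N. \<forall>n\<ge>N. vnorm X (s n \<ominus> l) < e)"
    if "\<forall>n. s n \<in> carrier X" for s l
    unfolding limit_metric_sequentially using that by (auto simp: vdist_def)
  have "(MCauchy s \<longrightarrow> (\<exists>l. limitin mtopology s l sequentially)) \<longleftrightarrow>
      ((\<forall>n. s n \<in> carrier X) \<longrightarrow>
       (\<forall>e>0. \<exists>N. \<forall>n\<ge>N. \<forall>k\<ge>N. vnorm X (s n \<ominus> s k) < e) \<longrightarrow>
       (\<exists>l\<in>carrier X. \<forall>e>0. \<exists>N. \<forall>n\<ge>N. vnorm X (s n \<ominus> l) < e))" for s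
    using 1[of s] 2[of s] by blast
  then show ?thesis unfolding mcomplete_def by simp
qed

definition converges :: "(nat \<Rightarrow> 'a) \<Rightarrow> 'a \<Rightarrow> bool" where
  "converges s l \<longleftrightarrow> (\<forall>n. s n \<in> carrier X) \<and> l \<in> carrier X \<and> (\<lambda>n. vnorm X (s n \<ominus> l)) \<longlonglongrightarrow> 0"

lemma converges_unique:
  assumes "converges s l" "converges s l'"
  shows "l = l'"
proof -
  have c: "s n \<in> carrier X" "l \<in> carrier X" "l' \<in> carrier X" for n using assms by (auto simp: converges_def)
  have "(\<lambda>n. vnorm X (s n \<ominus> l) + vnorm X (s n \<ominus> l')) \<longlonglongrightarrow> 0"
    using assms by (intro tendsto_add_zero) (auto simp: converges_def)
  moreover have "vnorm X (l \<ominus> l') \<le> vnorm X (s n \<ominus> l) + vnorm X (s n \<ominus> l')" for n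
    using norm_minus_triangle[OF c(2) c(1)[of n] c(3)] norm_minus_commute[OF c(2) c(1)[of n]] by simp
  ultimately have "vnorm X (l \<ominus> l') \<le> 0" by (intro LIMSEQ_le_const) auto
  then have "l \<ominus> l' = \<zero>" using c norm_eq_zero norm_ge_zero by (metis minus_closed order_antisym)
  then show ?thesis using c minus_eq_zero by blast
qed

lemma converges_add:
  assumes "converges s l" "converges t k"
  shows "converges (\<lambda>n. s n \<oplus> t n) (l \<oplus> k)"
proof -
  have c: "s n \<in> carrier X" "l \<in> carrier X" "t n \<in> carrier X" "k \<in> carrier X" for n
    using assms by (auto simp: converges_def)
  have lim: "(\<lambda>n. vnorm X (s n \<ominus> l) + vnorm X (t n \<ominus> k)) \<longlonglongrightarrow> 0"
    using assms by (intro tendsto_add_zero) (auto simp: converges_def)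
  have "norm (vnorm X ((s n \<oplus> t n) \<ominus> (l \<oplus> k))) \<le> vnorm X (s n \<ominus> l) + vnorm X (t n \<ominus> k)" for n
    using c by (simp add: add_minus_add norm_triangle)
  then have "(\<lambda>n. vnorm X ((s n \<oplus> t n) \<ominus> (l \<oplus> k))) \<longlonglongrightarrow> 0"
    by (intro Lim_null_comparison[OF always_eventually lim] allI)
  then show ?thesis using c by (simp add: converges_def)
qed

lemma converges_smult:
  assumes "converges s l" "a \<in> K"
  shows "converges (\<lambda>n. a \<odot> s n) (a \<odot> l)"
proof -
  have c: "s n \<in> carrier X" "l \<in> carrier X" for n using assms by (auto simp: converges_def)
  have "(\<lambda>n. cmod a * vnorm X (s n \<ominus> l)) \<longlonglongrightarrow> cmod a * 0"
    using assms by (intro tendsto_mult tendsto_const) (auto simp: converges_def)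
  moreover have "vnorm X (a \<odot> s n \<ominus> a \<odot> l) = cmod a * vnorm X (s n \<ominus> l)" for n
    using c assms(2) by (simp add: norm_smult flip: smult_minus)
  ultimately show ?thesis using c assms(2) by (simp add: converges_def)
qed

lemma complete_converges:
  assumes "Metric_space.mcomplete (carrier X) (vdist X)" "\<And>n. s n \<in> carrier X"
    "\<And>e. 0 < e \<Longrightarrow> \<exists>n0. \<forall>n\<ge>n0. \<forall>k\<ge>n0. vnorm X (s n \<ominus> s k) < e"
  shows "\<exists>l. converges s l"
proof -
  have "\<exists>l\<in>carrier X. \<forall>e>0. \<exists>n0. \<forall>n\<ge>n0. vnorm X (s n \<ominus> l) < e"
  proof (rule assms(1)[unfolded complete_iff, THEN spec, THEN mp, THEN mp])
    show "\<forall>n. s n \<in> carrier X" using assms(2) by blast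
    show "\<forall>e>0. \<exists>n0. \<forall>n\<ge>n0. \<forall>k\<ge>n0. vnorm X (s n \<ominus> s k) < e" using assms(3) by blast
  qed
  then obtain l where l: "l \<in> carrier X" "\<And>e. 0 < e \<Longrightarrow> \<exists>n0. \<forall>n\<ge>n0. vnorm X (s n \<ominus> l) < e"
    by blast
  have "(\<lambda>n. vnorm X (s n \<ominus> l)) \<longlonglongrightarrow> 0"
    unfolding LIMSEQ_iff using l(2) assms(2) l(1) by simp
  then show ?thesis using l assms(2) by (auto simp: converges_def)
qed

end

section \<open>The Hahn-Banach theorem\<close>

text \<open>The values off the carrier are pinned to 0, so that functionals can be compared as functions
  on the whole type.\<close>

definition sublinear :: "('a, 'b) nspace_scheme \<Rightarrow> ('a \<Rightarrow> real) \<Rightarrow> bool" where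
  "sublinear X q \<longleftrightarrow>
     (\<forall>x\<in>carrier X. \<forall>y\<in>carrier X. q (x \<oplus>\<^bsub>X\<^esub> y) \<le> q x + q y) \<and>
     (\<forall>t>0. \<forall>x\<in>carrier X. q (complex_of_real t \<odot>\<^bsub>X\<^esub> x) \<le> t * q x) \<and>
     q \<zero>\<^bsub>X\<^esub> = 0 \<and> (\<forall>x. x \<notin> carrier X \<longrightarrow> q x = 0)"

context nspace begin

lemma sublinear_scale:
  assumes q: "sublinear X q" and x: "x \<in> carrier X" and t: "0 \<le> t"
  shows "q (complex_of_real t \<odot> x) = t * q x"
proof (cases "t = 0")
  case True
  then show ?thesis using q x by (simp add: sublinear_def)
next
  case False
  then have t: "0 < t" using t by simp
  let ?y = "complex_of_real t \<odot> x"
  have y: "?y \<in> carrier X" using x scalars by simp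
  have "complex_of_real (1 / t) \<odot> ?y = x"
    using t x scalars(3)[of "1 / t"] scalars(3)[of t] smult_smult[of "complex_of_real (1 / t)" "complex_of_real t" x]
    by simp
  moreover have "q (complex_of_real (1 / t) \<odot> ?y) \<le> (1 / t) * q ?y"
  proof -
    have "\<forall>t>0. \<forall>x\<in>carrier X. q (complex_of_real t \<odot> x) \<le> t * q x"
      using q unfolding sublinear_def by blast
    then show ?thesis using y t zero_less_divide_1_iff by blast
  qed
  ultimately have "q x \<le> (1 / t) * q ?y" by simp
  then have "t * q x \<le> q ?y" using t by (simp add: field_simps)
  moreover have "q ?y \<le> t * q x" using q x t by (simp add: sublinear_def)
  ultimately show ?thesis by simp
qed

lemma sublinear_uminus:
  assumes q: "sublinear X q" and x: "x \<in> carrier X"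
  shows "- q (\<ominus> x) \<le> q x"
proof -
  have "q (x \<oplus> \<ominus> x) \<le> q x + q (\<ominus> x)" using q x by (auto simp: sublinear_def simp del: r_neg)
  then show ?thesis using q x by (simp add: r_neg sublinear_def)
qed

text \<open>A sublinear functional with \<open>q (- x) > - q x\<close> can be lowered.  The term \<open>t * q x\<close> is the growth that
  \<open>q\<close> would have along \<open>x\<close> if it were linear there; the infimum of what is left stays sublinear.\<close>

definition lower_along :: "('a \<Rightarrow> real) \<Rightarrow> 'a \<Rightarrow> 'a \<Rightarrow> real" where
  "lower_along q x y = (if y \<in> carrier X
     then INF t\<in>{0..}. q (y \<oplus> complex_of_real t \<odot> x) - t * q x else 0)"

lemma lower_along:
  assumes q: "sublinear X q" and x: "x \<in> carrier X"
  shows "sublinear X (lower_along q x)" "\<And>y. lower_along q x y \<le> q y"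
    "lower_along q x (\<ominus> x) \<le> - q x"
proof -
  let ?g = "\<lambda>y t. q (y \<oplus> complex_of_real t \<odot> x) - t * q x"
  have sub: "q (a \<oplus> b) \<le> q a + q b" if "a \<in> carrier X" "b \<in> carrier X" for a b
    using q that by (simp add: sublinear_def)
  have q0: "q \<zero> = 0" using q by (simp add: sublinear_def)
  have tx: "complex_of_real t \<odot> x \<in> carrier X" for t using x scalars by simp
  have lb: "- q (\<ominus> y) \<le> ?g y t" if y: "y \<in> carrier X" and t: "0 \<le> t" for y t
  proof -
    have "(y \<oplus> complex_of_real t \<odot> x) \<oplus> \<ominus> y = complex_of_real t \<odot> x"
      using y tx[of t] by (metis a_comm add_minus_cancel a_minus_def)
    then have "t * q x \<le> q (y \<oplus> complex_of_real t \<odot> x) + q (\<ominus> y)"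
      using sub[of "y \<oplus> complex_of_real t \<odot> x" "\<ominus> y"] y tx[of t] sublinear_scale[OF q x t] by simp
    then show ?thesis by simp
  qed
  have bdd: "bdd_below (?g y ` {0..})" if "y \<in> carrier X" for y
    using lb[OF that] by (intro bdd_belowI2[of _ "- q (\<ominus> y)"]) auto
  have le: "lower_along q x y \<le> ?g y t" if "y \<in> carrier X" "0 \<le> t" for y t
    using that bdd by (auto simp: lower_along_def intro!: cINF_lower)
  have ge: "c \<le> lower_along q x y" if "y \<in> carrier X" "\<And>t. 0 \<le> t \<Longrightarrow> c \<le> ?g y t" for y c
    using that by (auto simp: lower_along_def intro!: cINF_greatest)
  show "lower_along q x y \<le> q y" for y
    using le[of y 0] q x by (cases "y \<in> carrier X") (auto simp: lower_along_def sublinear_def)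
  show "lower_along q x (\<ominus> x) \<le> - q x"
    using le[of "\<ominus> x" 1] x q0 by (simp add: l_neg)
  have add: "lower_along q x (y \<oplus> z) \<le> lower_along q x y + lower_along q x z"
    if y: "y \<in> carrier X" and z: "z \<in> carrier X" for y z
  proof -
    have *: "lower_along q x (y \<oplus> z) \<le> ?g y s + ?g z t" if "0 \<le> s" "0 \<le> t" for s t
    proof -
      have "(y \<oplus> z) \<oplus> complex_of_real (s + t) \<odot> x
          = (y \<oplus> complex_of_real s \<odot> x) \<oplus> (z \<oplus> complex_of_real t \<odot> x)"
        using y z x tx scalars by (simp add: smult_add_left a_ac)
      then show ?thesis
        using le[of "y \<oplus> z" "s + t"] sub[of "y \<oplus> complex_of_real s \<odot> x" "z \<oplus> complex_of_real t \<odot> x"]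
          y z tx that by (simp add: algebra_simps)
    qed
    have "lower_along q x (y \<oplus> z) - ?g y s \<le> lower_along q x z" if "0 \<le> s" for s
      using *[OF that] by (intro ge[OF z]) (simp add: algebra_simps)
    then have "lower_along q x (y \<oplus> z) - lower_along q x z \<le> lower_along q x y"
      by (intro ge[OF y]) (simp add: algebra_simps)
    then show ?thesis by simp
  qed
  have scale: "lower_along q x (complex_of_real c \<odot> y) \<le> c * lower_along q x y"
    if c: "0 < c" and y: "y \<in> carrier X" for c y
  proof -
    have "lower_along q x (complex_of_real c \<odot> y) / c \<le> ?g y t" if t: "0 \<le> t" for t
    proof -
      have "complex_of_real c \<odot> y \<oplus> complex_of_real (c * t) \<odot> x
          = complex_of_real c \<odot> (y \<oplus> complex_of_real t \<odot> x)"
        using y x tx scalars by (simp add: smult_add_right smult_smult)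
      then have "q (complex_of_real c \<odot> y \<oplus> complex_of_real (c * t) \<odot> x)
          = c * q (y \<oplus> complex_of_real t \<odot> x)"
        using sublinear_scale[OF q _ less_imp_le[OF c]] y tx by simp
      then have "lower_along q x (complex_of_real c \<odot> y) \<le> c * ?g y t"
        using le[of "complex_of_real c \<odot> y" "c * t"] c t y scalars by (simp add: right_diff_distrib)
      then show ?thesis using c by (simp add: pos_divide_le_eq mult.commute)
    qed
    then have "lower_along q x (complex_of_real c \<odot> y) / c \<le> lower_along q x y" by (rule ge[OF y])
    then show ?thesis using c by (simp add: divide_le_eq mult.commute)
  qed
  have "lower_along q x \<zero> = 0"
  proof (rule antisym)
    show "lower_along q x \<zero> \<le> 0" using le[of \<zero> 0] x q0 by simp
    have "\<ominus> \<zero> = \<zero>" using r_neg[of \<zero>] by simp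
    then have "q (\<ominus> \<zero>) = 0" using q0 by (simp only:)
    then show "0 \<le> lower_along q x \<zero>" using lb[of \<zero>] by (intro ge) auto
  qed
  then show "sublinear X (lower_along q x)"
    using add scale by (auto simp: sublinear_def lower_along_def)
qed

text \<open>Zorn's lemma.  The pointwise infimum of a chain is finite because a sublinear \<open>q \<le> p\<close> satisfies
  \<open>q x \<ge> - q (- x) \<ge> - p (- x)\<close>.\<close>

lemma minimal_sublinear_exists:
  assumes p: "sublinear X p"
  shows "\<exists>m. sublinear X m \<and> (\<forall>x. m x \<le> p x) \<and>
    (\<forall>q. sublinear X q \<and> (\<forall>x. q x \<le> m x) \<longrightarrow> q = m)"
proof -
  define A where "A = {q. sublinear X q \<and> (\<forall>x. q x \<le> p x)}"
  \<comment> \<open>The reversed pointwise order, so that maximal elements are minimal functionals.\<close>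
  define P where "P q q' \<longleftrightarrow> (\<forall>x. q' x \<le> q x)" for q q' :: "'a \<Rightarrow> real"
  have "\<exists>m\<in>A. \<forall>q\<in>A. P m q \<longrightarrow> q = m"
  proof (rule predicate_Zorn)
    show "partial_order_on A (relation_of P A)"
      unfolding partial_order_on_def preorder_on_def refl_on_def trans_on_def antisym_def relation_of_def P_def
      by (auto intro: order_trans intro!: ext antisym)
    fix C assume C: "C \<in> Chains (relation_of P A)"
    then have CA: "C \<subseteq> A" and tot: "\<And>a b. a \<in> C \<Longrightarrow> b \<in> C \<Longrightarrow> P a b \<or> P b a"
      by (auto simp: Chains_def relation_of_def)
    show "\<exists>u\<in>A. \<forall>a\<in>C. P a u"
    proof (cases "C = {}")
      case True
      then show ?thesis using p by (auto simp: A_def intro!: bexI[of _ p])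
    next
      case False
      define u where "u x = (INF q\<in>C. q x)" for x
      have Cs: "sublinear X q" "\<And>x. q x \<le> p x" if "q \<in> C" for q using CA that by (auto simp: A_def)
      have bdd: "bdd_below ((\<lambda>q. q x) ` C)" for x
      proof (cases "x \<in> carrier X")
        case True
        have "- p (\<ominus> x) \<le> q x" if "q \<in> C" for q
          using sublinear_uminus[OF Cs(1)[OF that] True] Cs(2)[OF that, of "\<ominus> x"] by linarith
        then show ?thesis by (auto intro!: bdd_belowI2)
      next
        case False
        then have "q x = 0" if "q \<in> C" for q using Cs(1)[OF that] by (simp add: sublinear_def)
        then show ?thesis by (metis bdd_belowI2 order_refl)
      qed
      have le: "u x \<le> q x" if "q \<in> C" for x q
        unfolding u_def using bdd that by (rule cINF_lower)
      have ge: "c \<le> u x" if "\<And>q. q \<in> C \<Longrightarrow> c \<le> q x" for c x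
        unfolding u_def using False that by (rule cINF_greatest)
      have add: "u (x \<oplus> y) \<le> u x + u y" if x: "x \<in> carrier X" and y: "y \<in> carrier X" for x y
      proof -
        have *: "u (x \<oplus> y) \<le> a x + b y" if a: "a \<in> C" and b: "b \<in> C" for a b
        proof -
          obtain q where q: "q \<in> C" "q x \<le> a x" "q y \<le> b y"
            using tot[OF a b] a b unfolding P_def by blast
          have "u (x \<oplus> y) \<le> q (x \<oplus> y)" using le q by blast
          also have "\<dots> \<le> q x + q y" using Cs(1)[OF q(1)] x y by (simp add: sublinear_def)
          finally show ?thesis using q by simp
        qed
        have "u (x \<oplus> y) - a x \<le> u y" if "a \<in> C" for a
          using *[OF that] by (intro ge) (simp add: algebra_simps)
        then have "u (x \<oplus> y) - u y \<le> u x" by (intro ge) (simp add: algebra_simps)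
        then show ?thesis by simp
      qed
      have scale: "u (complex_of_real t \<odot> x) \<le> t * u x" if t: "0 < t" and x: "x \<in> carrier X" for t x
      proof -
        have "u (complex_of_real t \<odot> x) / t \<le> u x"
        proof (rule ge)
          fix q assume q: "q \<in> C"
          have "u (complex_of_real t \<odot> x) \<le> t * q x"
            using le[OF q, of "complex_of_real t \<odot> x"] sublinear_scale[OF Cs(1)[OF q] x, of t] t by simp
          then show "u (complex_of_real t \<odot> x) / t \<le> q x" using t by (simp add: divide_le_eq mult.commute)
        qed
        then show ?thesis using t by (simp add: divide_le_eq mult.commute)
      qed
      have off: "u x = 0" if "\<forall>q\<in>C. q x = 0" for x
      proof -
        have "(\<lambda>q. q x) ` C = {0}" using that False by auto
        then show ?thesis by (simp add: u_def)
      qed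
      have "sublinear X u"
        using add scale off Cs(1) by (auto simp: sublinear_def)
      moreover have "u x \<le> p x" for x
        using False le Cs(2) by (meson ex_in_conv order_trans)
      ultimately show ?thesis using le by (auto simp: A_def P_def intro!: bexI[of _ u])
    qed
  qed
  then obtain m where m: "m \<in> A" "\<And>q. q \<in> A \<Longrightarrow> P m q \<Longrightarrow> q = m" by blast
  show ?thesis
  proof (intro exI[of _ m] conjI allI impI)
    fix q assume "sublinear X q \<and> (\<forall>x. q x \<le> m x)"
    then show "q = m" using m by (intro m(2)) (auto simp: A_def P_def intro: order_trans)
  qed (use m in \<open>auto simp: A_def\<close>)
qed

text \<open>A minimal sublinear functional cannot be lowered along any vector, so it is odd; an odd
  sublinear functional is linear.  Lowering \<open>p\<close> along \<open>z\<close> beforehand forces the value at \<open>z\<close>.\<close>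

lemma Hahn_Banach:
  assumes p: "sublinear X p" and z: "z \<in> carrier X"
  obtains f where
    "\<And>x y. x \<in> carrier X \<Longrightarrow> y \<in> carrier X \<Longrightarrow> f (x \<oplus> y) = f x + f y"
    "\<And>t x. x \<in> carrier X \<Longrightarrow> f (complex_of_real t \<odot> x) = t * f x"
    "\<And>x. f x \<le> p x" "f z = p z"
proof -
  note pz = lower_along[OF p z]
  obtain m where m: "sublinear X m" "\<And>x. m x \<le> lower_along p z x"
      "\<And>q. sublinear X q \<Longrightarrow> (\<And>x. q x \<le> m x) \<Longrightarrow> q = m"
    using minimal_sublinear_exists[OF pz(1)] by blast
  have odd: "m (\<ominus> x) = - m x" if x: "x \<in> carrier X" for x
  proof -
    have "lower_along m x = m" using lower_along[OF m(1) x] by (intro m(3)) auto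
    then have "m (\<ominus> x) \<le> - m x" using lower_along(3)[OF m(1) x] by simp
    then show ?thesis using sublinear_uminus[OF m(1) x] by simp
  qed
  have sub: "m (a \<oplus> b) \<le> m a + m b" if "a \<in> carrier X" "b \<in> carrier X" for a b
    using m(1) that by (simp add: sublinear_def)
  show ?thesis
  proof
    show "m (x \<oplus> y) = m x + m y" if x: "x \<in> carrier X" and y: "y \<in> carrier X" for x y
    proof -
      have "m x \<le> m (x \<oplus> y) + m (\<ominus> y)"
        using sub[of "x \<oplus> y" "\<ominus> y"] add_minus_cancel[OF x y] x y by (simp add: a_minus_def)
      then show ?thesis using odd[OF y] sub[OF x y] by simp
    qed
    show "m (complex_of_real t \<odot> x) = t * m x" if x: "x \<in> carrier X" for t x
    proof (cases "0 \<le> t")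
      case False
      have "complex_of_real t \<odot> x = \<ominus> (complex_of_real (- t) \<odot> x)"
        using x scalars by (simp add: uminus_smult smult_smult)
      then show ?thesis
        using odd[of "complex_of_real (- t) \<odot> x"] sublinear_scale[OF m(1) x, of "- t"] False x scalars
        by simp
    qed (simp add: sublinear_scale[OF m(1) x])
    show "m x \<le> p x" for x using m(2) pz(2) order_trans by blast
    have "m (\<ominus> z) \<le> - p z" using m(2) pz(3) order_trans by blast
    then show "m z = p z" using odd[OF z] \<open>\<And>x. m x \<le> p x\<close>[of z] by simp
  qed
qed

end

section \<open>Spaces of operators, duals and weak norms\<close>

lemma scalar_space_simps [simp]:
  "carrier (scalar_space K) = K" "a \<oplus>\<^bsub>scalar_space K\<^esub> b = a + b" "a \<odot>\<^bsub>scalar_space K\<^esub> b = a * b"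
  "\<zero>\<^bsub>scalar_space K\<^esub> = 0" "vnorm (scalar_space K) = cmod" "pcone (scalar_space K) = \<real>\<^sub>\<ge>\<^sub>0"
  by (simp_all add: scalar_space_def)

lemma map_space_simps [simp]:
  "carrier (map_space D Y A N) = A" "\<zero>\<^bsub>map_space D Y A N\<^esub> = (\<lambda>x\<in>D. \<zero>\<^bsub>Y\<^esub>)"
  "f \<oplus>\<^bsub>map_space D Y A N\<^esub> g = (\<lambda>x\<in>D. f x \<oplus>\<^bsub>Y\<^esub> g x)"
  "a \<odot>\<^bsub>map_space D Y A N\<^esub> f = (\<lambda>x\<in>D. a \<odot>\<^bsub>Y\<^esub> f x)" "vnorm (map_space D Y A N) = N"
  by (simp_all add: map_space_def)

lemma nspace_scalar_space:
  assumes K: "K = \<real> \<or> K = UNIV"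
  shows "nspace K (scalar_space K)"
proof
  have "abelian_group (scalar_space K)"
  proof (rule abelian_groupI)
    fix x assume "x \<in> carrier (scalar_space K)"
    then show "\<exists>y\<in>carrier (scalar_space K). y \<oplus>\<^bsub>scalar_space K\<^esub> x = \<zero>\<^bsub>scalar_space K\<^esub>"
      using scalars_closed[OF K] by (intro bexI[of _ "- x"]) auto
  qed (use scalars_closed[OF K] in auto)
  then have "module (scalar_ring K) (scalar_space K)"
    by (intro moduleI scalar_ring_cring K) (use scalars_closed[OF K] in \<open>auto simp: algebra_simps\<close>)
  then show "normed_space K (scalar_space K)"
    by (auto simp: normed_space_def norm_mult norm_triangle_ineq)
qed (rule K)

text \<open>Closure under negation comes for free, as \<open>- f = (- 1) f\<close>.\<close>

lemma map_space_module:
  assumes Y: "nspace K Y" and A: "A \<subseteq> D \<rightarrow>\<^sub>E carrier Y" and z: "(\<lambda>x\<in>D. \<zero>\<^bsub>Y\<^esub>) \<in> A"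
    and add: "\<And>f g. f \<in> A \<Longrightarrow> g \<in> A \<Longrightarrow> (\<lambda>x\<in>D. f x \<oplus>\<^bsub>Y\<^esub> g x) \<in> A"
    and smult: "\<And>a f. a \<in> K \<Longrightarrow> f \<in> A \<Longrightarrow> (\<lambda>x\<in>D. a \<odot>\<^bsub>Y\<^esub> f x) \<in> A"
  shows "module (scalar_ring K) (map_space D Y A N)"
proof -
  interpret Y: nspace K Y by (rule Y)
  have val: "f x \<in> carrier Y" if "f \<in> A" "x \<in> D" for f x using A that by auto
  have eqI: "f = g" if "f \<in> A" "g \<in> A" "\<And>x. x \<in> D \<Longrightarrow> f x = g x" for f g
    using A that by (intro PiE_ext[of f D "\<lambda>_. carrier Y" g]) auto
  have "abelian_group (map_space D Y A N)"
  proof (rule abelian_groupI)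
    fix f assume "f \<in> carrier (map_space D Y A N)"
    then have f: "f \<in> A" by simp
    have "(\<lambda>x\<in>D. (- 1) \<odot>\<^bsub>Y\<^esub> f x) \<oplus>\<^bsub>map_space D Y A N\<^esub> f = \<zero>\<^bsub>map_space D Y A N\<^esub>"
      using val[OF f] Y.scalars by (auto simp: Y.uminus_smult[symmetric] Y.l_neg)
    then show "\<exists>g\<in>carrier (map_space D Y A N). g \<oplus>\<^bsub>map_space D Y A N\<^esub> f = \<zero>\<^bsub>map_space D Y A N\<^esub>"
      using smult[OF _ f, of "- 1"] Y.scalars by (intro bexI) auto
  next
    fix f assume "f \<in> carrier (map_space D Y A N)"
    then have f: "f \<in> A" by simp
    then show "\<zero>\<^bsub>map_space D Y A N\<^esub> \<oplus>\<^bsub>map_space D Y A N\<^esub> f = f"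
      using add[OF z f] val by (intro eqI) auto
  qed (use add z val Y.a_assoc Y.a_comm in auto)
  then show ?thesis
  proof (intro moduleI scalar_ring_cring Y.K)
    fix f assume "f \<in> carrier (map_space D Y A N)"
    then have f: "f \<in> A" by simp
    then show "\<one>\<^bsub>scalar_ring K\<^esub> \<odot>\<^bsub>map_space D Y A N\<^esub> f = f"
      using smult[of 1 f] val Y.scalars by (intro eqI) auto
  qed (use smult val Y.smult_add_left Y.smult_add_right Y.smult_smult in auto)
qed

lemma map_space_uminus:
  assumes "module (scalar_ring K) (map_space D Y A N)" "nspace K Y" "f \<in> A" "A \<subseteq> D \<rightarrow>\<^sub>E carrier Y"
  shows "\<ominus>\<^bsub>map_space D Y A N\<^esub> f = (\<lambda>x\<in>D. \<ominus>\<^bsub>Y\<^esub> f x)"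
proof -
  interpret Y: nspace K Y by (rule assms(2))
  interpret M: module "scalar_ring K" "map_space D Y A N" by (rule assms(1))
  have "\<ominus>\<^bsub>scalar_ring K\<^esub> \<one>\<^bsub>scalar_ring K\<^esub> = - 1"
    by (rule M.R.minus_equality) (use Y.scalars in auto)
  then have "\<ominus>\<^bsub>map_space D Y A N\<^esub> f = (- 1) \<odot>\<^bsub>map_space D Y A N\<^esub> f"
    using M.smult_l_minus[of 1 f] M.smult_one[of f] assms(3) Y.scalars by simp
  also have "\<dots> = (\<lambda>x\<in>D. \<ominus>\<^bsub>Y\<^esub> f x)"
  proof -
    have "f x \<in> carrier Y" if "x \<in> D" for x using assms(3,4) that by auto
    then show ?thesis by (simp add: Y.uminus_smult cong: restrict_cong)
  qed
  finally show ?thesis .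
qed

lemma map_space_minus:
  assumes "module (scalar_ring K) (map_space D Y A N)" "nspace K Y" "f \<in> A" "g \<in> A"
    "A \<subseteq> D \<rightarrow>\<^sub>E carrier Y"
  shows "f \<ominus>\<^bsub>map_space D Y A N\<^esub> g = (\<lambda>x\<in>D. f x \<ominus>\<^bsub>Y\<^esub> g x)"
  using assms by (auto simp: a_minus_def map_space_uminus)

lemma linear_mapD:
  assumes "linear_map K X Y f"
  shows "x \<in> carrier X \<Longrightarrow> f x \<in> carrier Y"
    "x \<in> carrier X \<Longrightarrow> y \<in> carrier X \<Longrightarrow> f (x \<oplus>\<^bsub>X\<^esub> y) = f x \<oplus>\<^bsub>Y\<^esub> f y"
    "a \<in> K \<Longrightarrow> x \<in> carrier X \<Longrightarrow> f (a \<odot>\<^bsub>X\<^esub> x) = a \<odot>\<^bsub>Y\<^esub> f x"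
    "f \<in> carrier X \<rightarrow>\<^sub>E carrier Y"
  using assms by (auto simp: linear_map_def)

lemma bounded_linear_opsD: "f \<in> bounded_linear_ops K X Y \<Longrightarrow> linear_map K X Y f"
  by (simp add: bounded_linear_ops_def)

lemmas bounded_linear_ops_linear = linear_mapD[OF bounded_linear_opsD]

lemma linear_map_zero:
  assumes "nspace K X" "nspace K Y" "linear_map K X Y f"
  shows "f \<zero>\<^bsub>X\<^esub> = \<zero>\<^bsub>Y\<^esub>"
proof -
  interpret X: nspace K X by fact
  interpret Y: nspace K Y by fact
  have "f (0 \<odot>\<^bsub>X\<^esub> \<zero>\<^bsub>X\<^esub>) = 0 \<odot>\<^bsub>Y\<^esub> f \<zero>\<^bsub>X\<^esub>"
    using linear_mapD(3)[OF assms(3), of 0] X.scalars by simp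
  then show ?thesis using linear_mapD(1)[OF assms(3) X.zero_closed] by simp
qed

lemma bounded_linear_ops_bound:
  assumes "nspace K X" "nspace K Y" "f \<in> bounded_linear_ops K X Y"
  obtains C where "0 \<le> C" "\<And>x. x \<in> carrier X \<Longrightarrow> vnorm Y (f x) \<le> C * vnorm X x"
proof -
  interpret X: nspace K X by fact
  obtain C where C: "\<And>x. x \<in> carrier X \<Longrightarrow> vnorm Y (f x) \<le> C * vnorm X x"
    using assms(3) by (auto simp: bounded_linear_ops_def)
  have "vnorm Y (f x) \<le> \<bar>C\<bar> * vnorm X x" if "x \<in> carrier X" for x
    using C[OF that] X.norm_ge_zero[OF that] by (meson abs_ge_self mult_right_mono order_trans)
  then show ?thesis using that[of "\<bar>C\<bar>"] by simp
qed

lemma op_norm_upper: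
  assumes X: "nspace K X" and Y: "nspace K Y" and f: "f \<in> bounded_linear_ops K X Y"
    and x: "x \<in> carrier X" "vnorm X x \<le> 1"
  shows "vnorm Y (f x) \<le> op_norm X Y f"
proof -
  interpret X: nspace K X by fact
  obtain C where C: "0 \<le> C" "\<And>x. x \<in> carrier X \<Longrightarrow> vnorm Y (f x) \<le> C * vnorm X x"
    using bounded_linear_ops_bound[OF X Y f] by blast
  have "vnorm Y (f x) \<le> C" if "x \<in> carrier X" "vnorm X x \<le> 1" for x
    using C(2)[OF that(1)] mult_left_le[OF that(2) C(1)] by linarith
  then have "bdd_above ((\<lambda>x. vnorm Y (f x)) ` {x \<in> carrier X. vnorm X x \<le> 1})"
    by (auto intro!: bdd_aboveI2)
  then show ?thesis unfolding op_norm_def using x by (intro cSUP_upper) auto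
qed

lemma op_norm_nonneg:
  assumes X: "nspace K X" and Y: "nspace K Y" and f: "f \<in> bounded_linear_ops K X Y"
  shows "0 \<le> op_norm X Y f"
proof -
  interpret X: nspace K X by fact
  interpret Y: nspace K Y by fact
  have "0 \<le> vnorm Y (f \<zero>\<^bsub>X\<^esub>)" using bounded_linear_ops_linear[OF f] by simp
  also have "\<dots> \<le> op_norm X Y f" by (rule op_norm_upper[OF assms]) auto
  finally show ?thesis .
qed

lemma op_norm_bound:
  assumes X: "nspace K X" and Y: "nspace K Y" and f: "f \<in> bounded_linear_ops K X Y"
    and x: "x \<in> carrier X"
  shows "vnorm Y (f x) \<le> op_norm X Y f * vnorm X x"
proof (cases "vnorm X x = 0")
  interpret X: nspace K X by fact
  interpret Y: nspace K Y by fact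
  {
    case True
    then have "f x = \<zero>\<^bsub>Y\<^esub>" 
      using x linear_map_zero[OF X Y bounded_linear_opsD[OF f]] by (simp add: X.norm_eq_zero)
    then show ?thesis using True by simp
  next
    case False
    define t where "t = vnorm X x"
    have t: "0 < t" using False X.norm_ge_zero[OF x] by (simp add: t_def)
    have tK: "complex_of_real (1 / t) \<in> K" by (rule X.scalars)
    let ?u = "complex_of_real (1 / t) \<odot>\<^bsub>X\<^esub> x"
    have fx: "f x \<in> carrier Y" using bounded_linear_ops_linear[OF f] x by simp
    have u: "?u \<in> carrier X" using x tK by simp
    have "vnorm X ?u = 1" using t X.norm_smult[OF tK x] by (simp add: t_def norm_divide)
    then have "vnorm Y (f ?u) \<le> op_norm X Y f" using op_norm_upper[OF X Y f u] by simp
    moreover have "vnorm Y (f ?u) = vnorm Y (f x) / t"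
      using bounded_linear_ops_linear(3)[OF f tK x] Y.norm_smult[OF tK fx] t by (simp add: norm_divide)
    ultimately show ?thesis using t by (simp add: t_def[symmetric] pos_divide_le_eq)
  }
qed

lemma op_norm_le:
  assumes X: "nspace K X" and "0 \<le> C" "\<And>x. x \<in> carrier X \<Longrightarrow> vnorm Y (f x) \<le> C * vnorm X x"
  shows "op_norm X Y f \<le> C"
proof -
  interpret X: nspace K X by fact
  have "vnorm Y (f x) \<le> C" if "x \<in> carrier X" "vnorm X x \<le> 1" for x
    using assms(3)[OF that(1)] mult_left_le[OF that(2) assms(2)] by linarith
  moreover have "{x \<in> carrier X. vnorm X x \<le> 1} \<noteq> {}"
    by (auto intro!: exI[of _ "\<zero>\<^bsub>X\<^esub>"])
  ultimately show ?thesis unfolding op_norm_def by (intro cSUP_least) auto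
qed

lemma bounded_linear_opsI:
  assumes "f \<in> carrier X \<rightarrow>\<^sub>E carrier Y"
    "\<And>x y. x \<in> carrier X \<Longrightarrow> y \<in> carrier X \<Longrightarrow> f (x \<oplus>\<^bsub>X\<^esub> y) = f x \<oplus>\<^bsub>Y\<^esub> f y"
    "\<And>a x. a \<in> K \<Longrightarrow> x \<in> carrier X \<Longrightarrow> f (a \<odot>\<^bsub>X\<^esub> x) = a \<odot>\<^bsub>Y\<^esub> f x"
    "\<And>x. x \<in> carrier X \<Longrightarrow> vnorm Y (f x) \<le> C * vnorm X x"
  shows "f \<in> bounded_linear_ops K X Y"
  using assms unfolding bounded_linear_ops_def linear_map_def
  by (intro CollectI conjI exI[of _ C]) auto

lemma nspace_bounded_linear_ops:
  assumes X: "nspace K X" and Y: "nspace K Y"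
  shows "nspace K (map_space (carrier X) Y (bounded_linear_ops K X Y) (op_norm X Y))"
proof
  interpret X: nspace K X by fact
  interpret Y: nspace K Y by fact
  let ?B = "bounded_linear_ops K X Y" and ?M = "map_space (carrier X) Y (bounded_linear_ops K X Y) (op_norm X Y)"
  show "K = \<real> \<or> K = UNIV" by (rule X.K)
  have sub: "?B \<subseteq> carrier X \<rightarrow>\<^sub>E carrier Y" using bounded_linear_ops_linear(4) by blast
  have zero: "(\<lambda>x\<in>carrier X. \<zero>\<^bsub>Y\<^esub>) \<in> ?B"
    by (rule bounded_linear_opsI[where C = 0]) auto
  have sum_bound: "vnorm Y (f x \<oplus>\<^bsub>Y\<^esub> g x) \<le> (op_norm X Y f + op_norm X Y g) * vnorm X x"
    if "f \<in> ?B" "g \<in> ?B" "x \<in> carrier X" for f g x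
  proof -
    have "vnorm Y (f x \<oplus>\<^bsub>Y\<^esub> g x) \<le> vnorm Y (f x) + vnorm Y (g x)"
      using that bounded_linear_ops_linear(1)[OF that(1,3)] bounded_linear_ops_linear(1)[OF that(2,3)]
      by (intro Y.norm_triangle)
    also have "\<dots> \<le> op_norm X Y f * vnorm X x + op_norm X Y g * vnorm X x"
      using that by (intro add_mono op_norm_bound[OF X Y]) auto
    finally show ?thesis by (simp add: distrib_right)
  qed
  have add: "(\<lambda>x\<in>carrier X. f x \<oplus>\<^bsub>Y\<^esub> g x) \<in> ?B" if f: "f \<in> ?B" and g: "g \<in> ?B" for f g
    using bounded_linear_ops_linear[OF f] bounded_linear_ops_linear[OF g] sum_bound[OF f g]
    by (intro bounded_linear_opsI[where C = "op_norm X Y f + op_norm X Y g"])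
       (auto simp: Y.smult_add_right Y.a_ac)
  have smult_norm: "vnorm Y (a \<odot>\<^bsub>Y\<^esub> f x) \<le> (cmod a * op_norm X Y f) * vnorm X x"
    if a: "a \<in> K" and f: "f \<in> ?B" and x: "x \<in> carrier X" for a f x
    using op_norm_bound[OF X Y f x] bounded_linear_ops_linear(1)[OF f x]
    by (simp add: Y.norm_smult[OF a] mult.assoc mult_left_mono)
  have smult: "(\<lambda>x\<in>carrier X. a \<odot>\<^bsub>Y\<^esub> f x) \<in> ?B" if a: "a \<in> K" and f: "f \<in> ?B" for a f
    using bounded_linear_ops_linear[OF f] smult_norm[OF a f] a
    by (intro bounded_linear_opsI[where C = "cmod a * op_norm X Y f"])
       (auto simp: Y.smult_add_right Y.smult_smult mult.commute)
  have smult_le: "op_norm X Y (\<lambda>x\<in>carrier X. a \<odot>\<^bsub>Y\<^esub> f x) \<le> cmod a * op_norm X Y f"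
    if a: "a \<in> K" and f: "f \<in> ?B" for a f
    using op_norm_nonneg[OF X Y f] smult_norm[OF a f] by (intro op_norm_le[OF X]) auto
  have mod: "module (scalar_ring K) ?M" by (rule map_space_module[OF Y sub zero add smult])
  have eq_smult: "op_norm X Y (\<lambda>x\<in>carrier X. a \<odot>\<^bsub>Y\<^esub> f x) = cmod a * op_norm X Y f"
    if a: "a \<in> K" and f: "f \<in> ?B" for a f
  proof (cases "a = 0")
    case True
    then show ?thesis using smult_le[OF a f] op_norm_nonneg[OF X Y smult[OF a f]] by simp
  next
    case False
    have ia: "inverse a \<in> K" using X.K a by (auto simp: Reals_inverse)
    have "(\<lambda>x\<in>carrier X. inverse a \<odot>\<^bsub>Y\<^esub> (\<lambda>x\<in>carrier X. a \<odot>\<^bsub>Y\<^esub> f x) x) = f"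
      using bounded_linear_ops_linear(1,4)[OF f] False a ia
      by (intro PiE_ext[of _ "carrier X" "\<lambda>_. carrier Y"]) (auto simp: Y.smult_smult)
    then have "op_norm X Y f \<le> cmod (inverse a) * op_norm X Y (\<lambda>x\<in>carrier X. a \<odot>\<^bsub>Y\<^esub> f x)"
      using smult_le[OF ia smult[OF a f]] by simp
    then have "cmod a * op_norm X Y f
        \<le> cmod a * (cmod (inverse a) * op_norm X Y (\<lambda>x\<in>carrier X. a \<odot>\<^bsub>Y\<^esub> f x))"
      by (rule mult_left_mono) simp
    also have "\<dots> = op_norm X Y (\<lambda>x\<in>carrier X. a \<odot>\<^bsub>Y\<^esub> f x)"
      using False by (simp add: norm_inverse)
    finally have "cmod a * op_norm X Y f \<le> op_norm X Y (\<lambda>x\<in>carrier X. a \<odot>\<^bsub>Y\<^esub> f x)" .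
    then show ?thesis using smult_le[OF a f] by simp
  qed
  show "normed_space K ?M"
    unfolding normed_space_def
  proof (intro conjI ballI mod)
    fix f assume "f \<in> carrier ?M"
    then have f: "f \<in> ?B" by simp
    show "0 \<le> vnorm ?M f" using op_norm_nonneg[OF X Y f] by simp
    show "vnorm ?M f = 0 \<longleftrightarrow> f = \<zero>\<^bsub>?M\<^esub>"
    proof
      assume "vnorm ?M f = 0"
      then have "f x = \<zero>\<^bsub>Y\<^esub>" if "x \<in> carrier X" for x
        using op_norm_bound[OF X Y f that] Y.norm_ge_zero Y.norm_eq_zero bounded_linear_ops_linear(1)[OF f that]
        by (metis map_space_simps(5) mult_zero_left order_antisym)
      then show "f = \<zero>\<^bsub>?M\<^esub>" using sub f by (intro PiE_ext[of f "carrier X" "\<lambda>_. carrier Y"]) auto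
    next
      assume "f = \<zero>\<^bsub>?M\<^esub>"
      then have "op_norm X Y f \<le> 0" by (intro op_norm_le[OF X]) auto
      then show "vnorm ?M f = 0" using op_norm_nonneg[OF X Y f] by simp
    qed
    fix g assume "g \<in> carrier ?M"
    then have g: "g \<in> ?B" by simp
    show "vnorm ?M (f \<oplus>\<^bsub>?M\<^esub> g) \<le> vnorm ?M f + vnorm ?M g"
      using sum_bound[OF f g] op_norm_nonneg[OF X Y f] op_norm_nonneg[OF X Y g]
      by (auto intro!: op_norm_le[OF X])
  next
    fix a f assume "a \<in> K" "f \<in> carrier ?M"
    then show "vnorm ?M (a \<odot>\<^bsub>?M\<^esub> f) = cmod a * vnorm ?M f" using eq_smult by simp
  qed
qed

lemma dual_simps [simp]:
  "carrier (dual K X) = bounded_linear_ops K X (scalar_space K)"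
  "vnorm (dual K X) = op_norm X (scalar_space K)"
  "f \<oplus>\<^bsub>dual K X\<^esub> g = (\<lambda>x\<in>carrier X. f x + g x)"
  "a \<odot>\<^bsub>dual K X\<^esub> f = (\<lambda>x\<in>carrier X. a * f x)"
  "\<zero>\<^bsub>dual K X\<^esub> = (\<lambda>x\<in>carrier X. 0)"
  by (simp_all add: dual_def)

lemma nspace_dual:
  assumes "nspace K X"
  shows "nspace K (dual K X)"
  unfolding dual_def
  using nspace_bounded_linear_ops[OF assms nspace_scalar_space[OF nspace.K[OF assms]]] .

lemma dual_bound:
  assumes "nspace K X" "f \<in> carrier (dual K X)" "x \<in> carrier X"
  shows "cmod (f x) \<le> vnorm (dual K X) f * vnorm X x"
  using op_norm_bound[OF assms(1) nspace_scalar_space[OF nspace.K[OF assms(1)]], of f x] assms by simp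

lemma compose_bounded_linear:
  assumes X: "nspace K X" and Y: "nspace K Y" and Z: "nspace K Z"
    and u: "u \<in> bounded_linear_ops K X Y" and v: "v \<in> bounded_linear_ops K Y Z"
  shows "(\<lambda>x\<in>carrier X. v (u x)) \<in> bounded_linear_ops K X Z"
    "op_norm X Z (\<lambda>x\<in>carrier X. v (u x)) \<le> op_norm Y Z v * op_norm X Y u"
proof -
  interpret X: nspace K X by fact
  note ul = bounded_linear_ops_linear[OF u] and vl = bounded_linear_ops_linear[OF v]
  have b: "vnorm Z (v (u x)) \<le> (op_norm Y Z v * op_norm X Y u) * vnorm X x" if x: "x \<in> carrier X" for x
  proof -
    have "vnorm Z (v (u x)) \<le> op_norm Y Z v * vnorm Y (u x)"
      using x ul by (intro op_norm_bound[OF Y Z v]) auto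
    also have "\<dots> \<le> op_norm Y Z v * (op_norm X Y u * vnorm X x)"
      using x op_norm_nonneg[OF Y Z v] by (intro mult_left_mono op_norm_bound[OF X Y u]) auto
    finally show ?thesis by (simp add: mult.assoc)
  qed
  show "(\<lambda>x\<in>carrier X. v (u x)) \<in> bounded_linear_ops K X Z"
    using ul vl b by (intro bounded_linear_opsI[where C = "op_norm Y Z v * op_norm X Y u"]) auto
  show "op_norm X Z (\<lambda>x\<in>carrier X. v (u x)) \<le> op_norm Y Z v * op_norm X Y u"
    using b op_norm_nonneg[OF Y Z v] op_norm_nonneg[OF X Y u] by (intro op_norm_le[OF X]) auto
qed

text \<open>The values of a sequence of functionals at one point can be estimated by the weak norm of the
  sequence, because the canonical embedding into the bidual is contractive.\<close>

lemma evaluation_in_bidual: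
  assumes X: "nspace K X" and x: "x \<in> carrier X"
  shows "(\<lambda>f\<in>carrier (dual K X). f x) \<in> carrier (dual K (dual K X))"
    "vnorm (dual K (dual K X)) (\<lambda>f\<in>carrier (dual K X). f x) \<le> vnorm X x"
proof -
  interpret X: nspace K X by fact
  interpret D: nspace K "dual K X" by (rule nspace_dual[OF X])
  have b: "cmod (f x) \<le> vnorm X x * vnorm (dual K X) f" if "f \<in> carrier (dual K X)" for f
    using dual_bound[OF X that x] by (simp add: mult.commute)
  have cl: "f x \<in> K" if "f \<in> carrier (dual K X)" for f
    using that x bounded_linear_ops_linear(1) by fastforce
  show "(\<lambda>f\<in>carrier (dual K X). f x) \<in> carrier (dual K (dual K X))"
    unfolding dual_simps(1)[of K "dual K X"]
  proof (rule bounded_linear_opsI[where C = "vnorm X x"])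
    fix f g assume "f \<in> carrier (dual K X)" "g \<in> carrier (dual K X)"
    then show "(\<lambda>f\<in>carrier (dual K X). f x) (f \<oplus>\<^bsub>dual K X\<^esub> g) =
      (\<lambda>f\<in>carrier (dual K X). f x) f \<oplus>\<^bsub>scalar_space K\<^esub> (\<lambda>f\<in>carrier (dual K X). f x) g"
      using D.a_closed[of f g] x by simp
  next
    fix a f assume "a \<in> K" "f \<in> carrier (dual K X)"
    then show "(\<lambda>f\<in>carrier (dual K X). f x) (a \<odot>\<^bsub>dual K X\<^esub> f) =
      a \<odot>\<^bsub>scalar_space K\<^esub> (\<lambda>f\<in>carrier (dual K X). f x) f"
      using D.smult_closed[of a f] x by simp
  qed (use b cl in auto)
  show "vnorm (dual K (dual K X)) (\<lambda>f\<in>carrier (dual K X). f x) \<le> vnorm X x"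
    unfolding dual_simps(2)[of K "dual K X"]
    using b x by (intro op_norm_le[OF nspace_dual[OF X]]) auto
qed

lemma adjoint:
  assumes X: "nspace K X" and Y: "nspace K Y" and v: "v \<in> bounded_linear_ops K X Y"
  defines "v' \<equiv> \<lambda>y\<in>carrier (dual K Y). \<lambda>x\<in>carrier X. y (v x)"
  shows "v' \<in> bounded_linear_ops K (dual K Y) (dual K X)"
    "op_norm (dual K Y) (dual K X) v' \<le> op_norm X Y v"
proof -
  interpret X: nspace K X by fact
  interpret Y: nspace K Y by fact
  interpret D: nspace K "dual K Y" by (rule nspace_dual[OF Y])
  note S = nspace_scalar_space[OF X.K]
  note vl = bounded_linear_ops_linear[OF v]
  have c: "v' y \<in> carrier (dual K X)" "vnorm (dual K X) (v' y) \<le> op_norm X Y v * vnorm (dual K Y) y"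
    if "y \<in> carrier (dual K Y)" for y
    using compose_bounded_linear[OF X Y S v, of y] that by (auto simp: v'_def mult.commute)
  show "v' \<in> bounded_linear_ops K (dual K Y) (dual K X)"
  proof (rule bounded_linear_opsI[where C = "op_norm X Y v"])
    show "v' \<in> carrier (dual K Y) \<rightarrow>\<^sub>E carrier (dual K X)"
      by (rule PiE_I) (rule c(1), simp_all only: v'_def restrict_apply if_False)
    fix f g assume "f \<in> carrier (dual K Y)" "g \<in> carrier (dual K Y)"
    then show "v' (f \<oplus>\<^bsub>dual K Y\<^esub> g) = v' f \<oplus>\<^bsub>dual K X\<^esub> v' g"
      using D.a_closed[of f g] vl(1) by (auto simp: v'_def)
  next
    fix a f assume "a \<in> K" "f \<in> carrier (dual K Y)"
    then show "v' (a \<odot>\<^bsub>dual K Y\<^esub> f) = a \<odot>\<^bsub>dual K X\<^esub> v' f"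
      using D.smult_closed[of a f] vl(1) by (auto simp: v'_def)
  qed (rule c(2))
  show "op_norm (dual K Y) (dual K X) v' \<le> op_norm X Y v"
    using c(2) op_norm_nonneg[OF X Y v] by (intro op_norm_le[OF nspace_dual[OF Y]]) auto
qed

lemma weak_norm_upper:
  assumes X: "nspace K X" and q: "1 \<le> q" and n: "1 \<le> n" and x: "\<And>i. i < n \<Longrightarrow> x i \<in> carrier X"
    and f: "f \<in> carrier (dual K X)" "vnorm (dual K X) f \<le> 1"
  shows "lp_norm q n (\<lambda>i. f (x i)) \<le> weak_norm K X q n x"
proof -
  interpret X: nspace K X by fact
  have "lp_norm q n (\<lambda>i. g (x i)) \<le> lp_norm q n (\<lambda>i. of_real (vnorm X (x i)))"
    if g: "g \<in> carrier (dual K X)" "vnorm (dual K X) g \<le> 1" for g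
  proof (rule lp_norm_mono[OF q n])
    fix i assume i: "i < n"
    have "cmod (g (x i)) \<le> vnorm (dual K X) g * vnorm X (x i)" by (rule dual_bound[OF X g(1) x[OF i]])
    also have "\<dots> \<le> 1 * vnorm X (x i)" using g x[OF i] by (intro mult_right_mono) auto
    finally show "cmod (g (x i)) \<le> cmod (of_real (vnorm X (x i)))" using x[OF i] by simp
  qed
  then have "bdd_above ((\<lambda>f. lp_norm q n (\<lambda>i. f (x i))) ` {f \<in> carrier (dual K X). vnorm (dual K X) f \<le> 1})"
    by (auto intro!: bdd_aboveI2)
  then show ?thesis unfolding weak_norm_def using f by (intro cSUP_upper) auto
qed

lemma weak_norm_least:
  assumes X: "nspace K X"
    and "\<And>f. f \<in> carrier (dual K X) \<Longrightarrow> vnorm (dual K X) f \<le> 1 \<Longrightarrow> lp_norm q n (\<lambda>i. f (x i)) \<le> B"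
  shows "weak_norm K X q n x \<le> B"
proof -
  interpret D: nspace K "dual K X" by (rule nspace_dual[OF X])
  have "{f \<in> carrier (dual K X). vnorm (dual K X) f \<le> 1} \<noteq> {}"
  proof -
    have "vnorm (dual K X) \<zero>\<^bsub>dual K X\<^esub> \<le> 1" by (simp only: D.norm_zero zero_le_one)
    then show ?thesis using D.zero_closed by blast
  qed
  then show ?thesis unfolding weak_norm_def using assms(2) by (intro cSUP_least) auto
qed

lemma weak_norm_nonneg:
  assumes X: "nspace K X" and q: "1 \<le> q" and n: "1 \<le> n" and x: "\<And>i. i < n \<Longrightarrow> x i \<in> carrier X"
  shows "0 \<le> weak_norm K X q n x"
proof -
  interpret D: nspace K "dual K X" by (rule nspace_dual[OF X])
  have "0 \<le> lp_norm q n (\<lambda>i. \<zero>\<^bsub>dual K X\<^esub> (x i))" by (rule lp_norm_nonneg[OF n])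
  also have "\<dots> \<le> weak_norm K X q n x"
    by (rule weak_norm_upper[OF assms D.zero_closed]) (simp_all only: D.norm_zero zero_le_one)
  finally show ?thesis .
qed

text \<open>The definition of the weak norm, homogenized in the functional.\<close>

lemma lp_norm_functional_le:
  assumes X: "nspace K X" and q: "1 \<le> q" and n: "1 \<le> n" and x: "\<And>i. i < n \<Longrightarrow> x i \<in> carrier X"
    and f: "f \<in> carrier (dual K X)" "vnorm (dual K X) f \<le> C"
  shows "lp_norm q n (\<lambda>i. f (x i)) \<le> C * weak_norm K X q n x"
proof -
  interpret X: nspace K X by fact
  interpret D: nspace K "dual K X" by (rule nspace_dual[OF X])
  have C: "0 \<le> C" using D.norm_ge_zero[OF f(1)] f(2) by linarith
  show ?thesis
  proof (cases "C = 0")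
    case True
    have "cmod (f (x i)) \<le> 0" if "i < n" for i
    proof -
      have "cmod (f (x i)) \<le> vnorm (dual K X) f * vnorm X (x i)" by (rule dual_bound[OF X f(1) x[OF that]])
      also have "\<dots> \<le> 0 * vnorm X (x i)" using f(2) True x[OF that] by (intro mult_right_mono) auto
      finally show ?thesis by simp
    qed
    then have "lp_norm q n (\<lambda>i. f (x i)) \<le> 0 * lp_norm q n (\<lambda>_. 1)"
      by (intro lp_norm_coord_bound[OF q n]) auto
    then show ?thesis using True by simp
  next
    case False
    with C have C: "0 < C" by simp
    have CK: "complex_of_real (1 / C) \<in> K" by (rule X.scalars)
    let ?g = "complex_of_real (1 / C) \<odot>\<^bsub>dual K X\<^esub> f"
    have g: "?g \<in> carrier (dual K X)" using f(1) CK by (rule D.smult_closed[rotated])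
    have "vnorm (dual K X) ?g = vnorm (dual K X) f / C"
      using D.norm_smult[OF CK f(1)] C by (simp add: norm_divide)
    then have "vnorm (dual K X) ?g \<le> 1" using f(2) C by simp
    note gn = this
    have "lp_norm q n (\<lambda>i. ?g (x i)) \<le> weak_norm K X q n x"
      by (rule weak_norm_upper[where x = x, OF X q n x g gn])
    moreover have "lp_norm q n (\<lambda>i. f (x i)) \<le> lp_norm q n (\<lambda>i. of_real C * ?g (x i))"
      using x C by (intro lp_norm_mono[OF q n]) (auto simp: norm_mult norm_divide)
    moreover have "lp_norm q n (\<lambda>i. of_real C * ?g (x i)) = C * lp_norm q n (\<lambda>i. ?g (x i))"
      using C by (subst lp_norm_scale[OF q n]) auto
    ultimately show ?thesis using C by (smt (verit) mult_left_mono)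
  qed
qed

lemma weak_norm_one:
  assumes X: "nspace K X" and q: "1 \<le> q" and x: "x 0 \<in> carrier X"
  shows "weak_norm K X q 1 x \<le> vnorm X (x 0)"
proof (rule weak_norm_least[OF X])
  interpret X: nspace K X by fact
  fix f assume f: "f \<in> carrier (dual K X)" "vnorm (dual K X) f \<le> 1"
  have "cmod (f (x 0)) \<le> vnorm (dual K X) f * vnorm X (x 0)" by (rule dual_bound[OF X f(1) x])
  also have "\<dots> \<le> 1 * vnorm X (x 0)" using f x by (intro mult_right_mono) auto
  finally show "lp_norm q 1 (\<lambda>i. f (x i)) \<le> vnorm X (x 0)" by (simp only: lp_norm_one[OF q])
qed

lemma weak_norm_image:
  assumes X: "nspace K X" and Y: "nspace K Y" and q: "1 \<le> q" and n: "1 \<le> n"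
    and x: "\<And>i. i < n \<Longrightarrow> x i \<in> carrier X" and u: "u \<in> bounded_linear_ops K X Y"
  shows "weak_norm K Y q n (\<lambda>i. u (x i)) \<le> op_norm X Y u * weak_norm K X q n x"
proof (rule weak_norm_least[OF Y])
  interpret X: nspace K X by fact
  note S = nspace_scalar_space[OF X.K]
  fix f assume f: "f \<in> carrier (dual K Y)" "vnorm (dual K Y) f \<le> 1"
  let ?g = "\<lambda>x\<in>carrier X. f (u x)"
  have f': "f \<in> bounded_linear_ops K Y (scalar_space K)" using f by simp
  note g = compose_bounded_linear[OF X Y S u f']
  have "op_norm Y (scalar_space K) f * op_norm X Y u \<le> 1 * op_norm X Y u"
    using f op_norm_nonneg[OF X Y u] by (intro mult_right_mono) auto
  then have gn: "vnorm (dual K X) ?g \<le> op_norm X Y u" using g(2) by simp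
  have "lp_norm q n (\<lambda>i. f (u (x i))) \<le> lp_norm q n (\<lambda>i. ?g (x i))"
    using x by (intro lp_norm_mono[OF q n]) auto
  also have "\<dots> \<le> op_norm X Y u * weak_norm K X q n x"
  proof (rule lp_norm_functional_le[where x = x, OF X q n x _ gn])
    show "?g \<in> carrier (dual K X)" using g(1) by (simp only: dual_simps)
  qed
  finally show "lp_norm q n (\<lambda>i. f (u (x i))) \<le> op_norm X Y u * weak_norm K X q n x" .
qed

section \<open>Real Banach lattices\<close>

lemma cone_order_simps [simp]:
  "carrier (cone_order E) = carrier E"
  "x \<sqsubseteq>\<^bsub>cone_order E\<^esub> y \<longleftrightarrow> y \<ominus>\<^bsub>E\<^esub> x \<in> pcone E"
  by (simp_all add: cone_order_def)

definition pos_part :: "'a blattice \<Rightarrow> 'a \<Rightarrow> 'a" where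
  "pos_part E x = x \<squnion>\<^bsub>cone_order E\<^esub> \<zero>\<^bsub>E\<^esub>"

locale real_lattice =
  fixes E (structure)
  assumes real_banach_lattice: "real_banach_lattice E"

sublocale real_lattice \<subseteq> nspace \<real> E
  using real_banach_lattice by unfold_locales (auto simp: real_banach_lattice_def banach_space_def)

context real_lattice begin

sublocale L: Lattice.lattice "cone_order E"
  using real_banach_lattice by (simp add: real_banach_lattice_def)

lemma cone_closed: "x \<in> pcone E \<Longrightarrow> x \<in> carrier E"
  and cone_add: "x \<in> pcone E \<Longrightarrow> y \<in> pcone E \<Longrightarrow> x \<oplus> y \<in> pcone E"
  and cone_smult: "0 \<le> t \<Longrightarrow> x \<in> pcone E \<Longrightarrow> complex_of_real t \<odot> x \<in> pcone E"
  and abs_norm_mono: "x \<in> carrier E \<Longrightarrow> y \<in> carrier E \<Longrightarrow>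
    lattice_abs E y \<ominus> lattice_abs E x \<in> pcone E \<Longrightarrow> vnorm E x \<le> vnorm E y"
  using real_banach_lattice unfolding real_banach_lattice_def by auto

lemma minus_zero_right [simp]: "x \<in> carrier E \<Longrightarrow> x \<ominus> \<zero> = x"
  using add_minus_cancel[of x \<zero>] by simp

lemma zero_minus [simp]: "x \<in> carrier E \<Longrightarrow> \<zero> \<ominus> x = \<ominus> x"
  by (simp add: a_minus_def)

lemma minus_uminus [simp]: "x \<in> carrier E \<Longrightarrow> y \<in> carrier E \<Longrightarrow> x \<ominus> (\<ominus> y) = x \<oplus> y"
  by (simp add: a_minus_def)

lemma pos_part_closed [simp]: "x \<in> carrier E \<Longrightarrow> pos_part E x \<in> carrier E"
  using L.join_closed[of x \<zero>] by (simp add: pos_part_def)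

lemma pos_part_cone: "x \<in> carrier E \<Longrightarrow> pos_part E x \<in> pcone E"
  using L.join_right[of x \<zero>] pos_part_closed[of x] by (simp add: pos_part_def)

lemma pos_part_ge: "x \<in> carrier E \<Longrightarrow> pos_part E x \<ominus> x \<in> pcone E"
  using L.join_left[of x \<zero>] by (simp add: pos_part_def)

lemma pos_part_least:
  "x \<in> carrier E \<Longrightarrow> y \<in> pcone E \<Longrightarrow> y \<ominus> x \<in> pcone E \<Longrightarrow> y \<ominus> pos_part E x \<in> pcone E"
  using L.join_le[of x y \<zero>] cone_closed[of y] by (simp add: pos_part_def)

lemma zero_cone: "\<zero> \<in> pcone E"
  using cone_smult[of 0 "pos_part E \<zero>"] pos_part_cone[of \<zero>] by simp

lemma lattice_abs_closed [simp]: "x \<in> carrier E \<Longrightarrow> lattice_abs E x \<in> carrier E"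
  using L.join_closed[of x "\<ominus> x"] by (simp add: lattice_abs_def)

lemma lattice_abs_ge: "x \<in> carrier E \<Longrightarrow> lattice_abs E x \<ominus> x \<in> pcone E"
  "x \<in> carrier E \<Longrightarrow> lattice_abs E x \<oplus> x \<in> pcone E"
  using L.join_left[of x "\<ominus> x"] L.join_right[of x "\<ominus> x"] lattice_abs_closed[of x]
  by (simp_all add: lattice_abs_def)

lemma lattice_abs_least:
  "x \<in> carrier E \<Longrightarrow> y \<in> carrier E \<Longrightarrow> y \<ominus> x \<in> pcone E \<Longrightarrow> y \<oplus> x \<in> pcone E \<Longrightarrow>
   y \<ominus> lattice_abs E x \<in> pcone E"
  using L.join_le[of x y "\<ominus> x"] by (simp add: lattice_abs_def)

text \<open>The reason is \<open>2 x = (x - y) + (x + y)\<close>.\<close>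

lemma cone_half:
  assumes x: "x \<in> carrier E" "y \<in> carrier E" and le: "x \<ominus> y \<in> pcone E" "x \<oplus> y \<in> pcone E"
  shows "x \<in> pcone E"
proof -
  have "(x \<ominus> y) \<oplus> (x \<oplus> y) = (x \<oplus> x) \<oplus> (\<ominus> y \<oplus> y)"
    using x by (simp only: a_minus_def a_ac a_closed a_inv_closed)
  also have "\<dots> = x \<oplus> x" using x by (simp add: l_neg)
  finally have "x \<oplus> x \<in> pcone E" using cone_add[OF le] by simp
  then have "complex_of_real (1/2) \<odot> (x \<oplus> x) \<in> pcone E" by (intro cone_smult) auto
  moreover have "complex_of_real (1/2) \<odot> (x \<oplus> x) = (complex_of_real (1/2) + complex_of_real (1/2)) \<odot> x"
    using x scalars(3)[of "1/2"] by (subst smult_add_left) (auto simp: smult_add_right)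
  ultimately show ?thesis using x by simp
qed

lemma lattice_abs_cone:
  assumes x: "x \<in> carrier E"
  shows "lattice_abs E x \<in> pcone E"
  by (rule cone_half[OF lattice_abs_closed[OF x] x lattice_abs_ge[OF x]])

lemma lattice_abs_of_cone:
  assumes x: "x \<in> pcone E"
  shows "lattice_abs E x = x"
proof (rule L.le_antisym)
  note xc = cone_closed[OF x]
  have "x \<ominus> x = \<zero>" using xc by (simp add: minus_eq_zero)
  then show "lattice_abs E x \<sqsubseteq>\<^bsub>cone_order E\<^esub> x"
    using lattice_abs_least[OF xc xc] zero_cone cone_add[OF x x] by simp
  show "x \<sqsubseteq>\<^bsub>cone_order E\<^esub> lattice_abs E x" using lattice_abs_ge(1)[OF xc] by simp
qed (use cone_closed[OF x] in auto)

text \<open>The hypotheses say \<open>\<bar>x\<bar> \<le> w\<close>, which forces \<open>w = \<bar>w\<bar>\<close>.\<close>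

lemma norm_dominated:
  assumes x: "x \<in> carrier E" and w: "w \<in> carrier E" "w \<ominus> x \<in> pcone E" "w \<oplus> x \<in> pcone E"
  shows "vnorm E x \<le> vnorm E w"
proof -
  have "w \<in> pcone E" by (rule cone_half[OF w(1) x w(2,3)])
  then show ?thesis
    using lattice_abs_least[OF x w] lattice_abs_of_cone x w(1) by (intro abs_norm_mono) auto
qed

lemma cone_norm_mono:
  assumes x: "x \<in> pcone E" and w: "w \<in> carrier E" "w \<ominus> x \<in> pcone E"
  shows "vnorm E x \<le> vnorm E w"
proof (rule norm_dominated)
  note xc = cone_closed[OF x]
  have "w \<oplus> x = (w \<ominus> x) \<oplus> (x \<oplus> x)"
    using w(1) xc by (metis a_assoc minus_add_cancel minus_closed)
  then show "w \<oplus> x \<in> pcone E" using cone_add[OF w(2) cone_add[OF x x]] by simp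
qed (use cone_closed[OF x] w in auto)

lemma norm_pos_part:
  assumes x: "x \<in> carrier E"
  shows "vnorm E (pos_part E x) \<le> vnorm E x"
proof (rule abs_norm_mono)
  show "lattice_abs E x \<ominus> lattice_abs E (pos_part E x) \<in> pcone E"
    using pos_part_least[OF x lattice_abs_cone[OF x] lattice_abs_ge(1)[OF x]]
      lattice_abs_of_cone[OF pos_part_cone[OF x]] by simp
qed (use x in auto)

text \<open>The reason is \<open>\<bar>x\<bar> \<le> x\<^sup>+ + (- x)\<^sup>+\<close>.\<close>

lemma norm_le_pos_parts:
  assumes x: "x \<in> carrier E"
  shows "vnorm E x \<le> vnorm E (pos_part E x) + vnorm E (pos_part E (\<ominus> x))"
proof -
  let ?p = "pos_part E x" and ?n = "pos_part E (\<ominus> x)"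
  have c: "?p \<in> carrier E" "?n \<in> carrier E" using x by auto
  have "(?p \<oplus> ?n) \<ominus> x = (?p \<ominus> x) \<oplus> ?n" using x c by (simp add: a_minus_def a_ac)
  then have 1: "(?p \<oplus> ?n) \<ominus> x \<in> pcone E"
    using cone_add[OF pos_part_ge[OF x] pos_part_cone[of "\<ominus> x"]] x by simp
  have "(?p \<oplus> ?n) \<oplus> x = ?p \<oplus> (?n \<ominus> (\<ominus> x))" using x c by (simp add: a_ac)
  then have 2: "(?p \<oplus> ?n) \<oplus> x \<in> pcone E"
    using cone_add[OF pos_part_cone[OF x] pos_part_ge[of "\<ominus> x"]] x by (simp del: minus_uminus)
  have "vnorm E x \<le> vnorm E (?p \<oplus> ?n)" by (rule norm_dominated[OF x _ 1 2]) (use c in auto)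
  also have "\<dots> \<le> vnorm E ?p + vnorm E ?n" by (rule norm_triangle[OF c])
  finally show ?thesis .
qed

text \<open>Subadditivity follows from \<open>(x + y)\<^sup>+ \<le> x\<^sup>+ + y\<^sup>+\<close> and the monotonicity of the norm on the cone.\<close>

lemma sublinear_norm_pos_part:
  "sublinear E (\<lambda>x. if x \<in> carrier E then vnorm E (pos_part E x) else 0)"
proof -
  have add: "vnorm E (pos_part E (x \<oplus> y)) \<le> vnorm E (pos_part E x) + vnorm E (pos_part E y)"
    if x: "x \<in> carrier E" and y: "y \<in> carrier E" for x y
  proof -
    let ?w = "pos_part E x \<oplus> pos_part E y"
    have w: "?w \<in> pcone E" using cone_add pos_part_cone x y by blast
    have "?w \<ominus> (x \<oplus> y) = (pos_part E x \<ominus> x) \<oplus> (pos_part E y \<ominus> y)"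
      using x y by (intro add_minus_add) auto
    then have "?w \<ominus> (x \<oplus> y) \<in> pcone E" using cone_add pos_part_ge x y by simp
    then have "?w \<ominus> pos_part E (x \<oplus> y) \<in> pcone E" using w x y by (intro pos_part_least) auto
    then have "vnorm E (pos_part E (x \<oplus> y)) \<le> vnorm E ?w"
      using x y by (intro cone_norm_mono pos_part_cone) auto
    also have "\<dots> \<le> vnorm E (pos_part E x) + vnorm E (pos_part E y)" using x y by (intro norm_triangle) auto
    finally show ?thesis .
  qed
  have scale: "vnorm E (pos_part E (complex_of_real t \<odot> x)) \<le> t * vnorm E (pos_part E x)"
    if t: "0 < t" and x: "x \<in> carrier E" for t x
  proof -
    let ?w = "complex_of_real t \<odot> pos_part E x"
    have w: "?w \<in> pcone E" using cone_smult pos_part_cone t x by simp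
    have "?w \<ominus> complex_of_real t \<odot> x = complex_of_real t \<odot> (pos_part E x \<ominus> x)"
      using x by (simp add: smult_minus)
    also have "\<dots> \<in> pcone E" using cone_smult pos_part_ge t x by simp
    finally have "?w \<ominus> pos_part E (complex_of_real t \<odot> x) \<in> pcone E"
      using w x by (intro pos_part_least) auto
    then have "vnorm E (pos_part E (complex_of_real t \<odot> x)) \<le> vnorm E ?w"
      using x by (intro cone_norm_mono pos_part_cone) auto
    also have "\<dots> = t * vnorm E (pos_part E x)" using t x by (simp add: norm_smult)
    finally show ?thesis .
  qed
  have "vnorm E (pos_part E \<zero>) = 0"
    using norm_pos_part[of \<zero>] by (intro antisym) auto
  then show ?thesis using add scale by (auto simp: sublinear_def)
qed

text \<open>The gauge \<open>x \<mapsto> \<parallel>x\<^sup>+\<parallel>\<close> vanishes on the negative cone, so a linear functional below it is positive;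
  it is contractive because \<open>\<parallel>x\<^sup>+\<parallel> \<le> \<parallel>x\<parallel>\<close>.\<close>

lemma positive_functional_exists:
  assumes z: "z \<in> carrier E"
  obtains f where
    "\<And>x y. x \<in> carrier E \<Longrightarrow> y \<in> carrier E \<Longrightarrow> f (x \<oplus> y) = f x + f y"
    "\<And>t x. x \<in> carrier E \<Longrightarrow> f (complex_of_real t \<odot> x) = t * f x"
    "\<And>x. x \<in> carrier E \<Longrightarrow> \<bar>f x\<bar> \<le> vnorm E x"
    "\<And>x. x \<in> pcone E \<Longrightarrow> 0 \<le> f x"
    "f z = vnorm E (pos_part E z)"
proof -
  let ?p = "\<lambda>x. if x \<in> carrier E then vnorm E (pos_part E x) else 0"
  obtain f where f:
    "\<And>x y. x \<in> carrier E \<Longrightarrow> y \<in> carrier E \<Longrightarrow> f (x \<oplus> y) = f x + f y"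
    "\<And>t x. x \<in> carrier E \<Longrightarrow> f (complex_of_real t \<odot> x) = t * f x"
    "\<And>x. f x \<le> ?p x" "f z = ?p z"
    using Hahn_Banach[OF sublinear_norm_pos_part z] by blast
  have neg: "f (\<ominus> x) = - f x" if "x \<in> carrier E" for x
    using f(2)[OF that, of "- 1"] that by (simp add: uminus_smult)
  have le: "f x \<le> vnorm E x" if "x \<in> carrier E" for x
    using f(3)[of x] norm_pos_part[OF that] that by simp
  show ?thesis
  proof
    show "\<bar>f x\<bar> \<le> vnorm E x" if "x \<in> carrier E" for x
      using le[OF that] le[of "\<ominus> x"] neg[OF that] that by simp
    show "0 \<le> f x" if x: "x \<in> pcone E" for x
    proof -
      note xc = cone_closed[OF x]
      have "\<zero> \<ominus> pos_part E (\<ominus> x) \<in> pcone E"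
        by (rule pos_part_least) (use xc x zero_cone in auto)
      then have "vnorm E (pos_part E (\<ominus> x)) \<le> vnorm E \<zero>"
        using xc by (intro cone_norm_mono pos_part_cone) auto
      then show ?thesis using f(3)[of "\<ominus> x"] neg[OF xc] xc by simp
    qed
  qed (use f z in auto)
qed

end

section \<open>Complex Banach lattices\<close>

locale complex_lattice =
  fixes E (structure)
  assumes complex_banach_lattice: "complex_banach_lattice E"

sublocale complex_lattice \<subseteq> nspace UNIV E
  using complex_banach_lattice by unfold_locales (auto simp: complex_banach_lattice_def banach_space_def)

sublocale complex_lattice \<subseteq> R: real_lattice "real_part E"
  using complex_banach_lattice by unfold_locales (auto simp: complex_banach_lattice_def)

lemma real_part_simps [simp]:
  "x \<oplus>\<^bsub>real_part E\<^esub> y = x \<oplus>\<^bsub>E\<^esub> y" "a \<odot>\<^bsub>real_part E\<^esub> x = a \<odot>\<^bsub>E\<^esub> x"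
  "\<zero>\<^bsub>real_part E\<^esub> = \<zero>\<^bsub>E\<^esub>" "vnorm (real_part E) = vnorm E" "pcone (real_part E) = pcone E"
  by (simp_all add: real_part_def)

context complex_lattice begin

abbreviation Re_carrier where "Re_carrier \<equiv> carrier (real_part E)"

lemma cone_carrier: "x \<in> pcone E \<Longrightarrow> x \<in> carrier E"
  using complex_banach_lattice by (auto simp: complex_banach_lattice_def)

lemma Re_carrier_closed: "x \<in> Re_carrier \<Longrightarrow> x \<in> carrier E"
  by (auto simp: real_part_def cone_carrier)

lemma Re_carrier_add: "x \<in> Re_carrier \<Longrightarrow> y \<in> Re_carrier \<Longrightarrow> x \<oplus> y \<in> Re_carrier"
  using R.a_closed[of x y] by simp

lemma Re_carrier_smult: "x \<in> Re_carrier \<Longrightarrow> complex_of_real t \<odot> x \<in> Re_carrier"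
  using R.smult_closed[of "complex_of_real t" x] by simp

lemma decomposition_ex1:
  "z \<in> carrier E \<Longrightarrow> \<exists>!(x, y). x \<in> Re_carrier \<and> y \<in> Re_carrier \<and> z = x \<oplus> \<i> \<odot> y"
  using complex_banach_lattice[unfolded complex_banach_lattice_def, THEN conjunct2, THEN conjunct2,
      THEN conjunct2, THEN conjunct1] by (rule bspec)

lemma decomposition:
  assumes z: "z \<in> carrier E"
  obtains x y where "x \<in> Re_carrier" "y \<in> Re_carrier" "z = x \<oplus> \<i> \<odot> y"
  using ex1_implies_ex[OF decomposition_ex1[OF z]] by (auto simp: split_paired_Ex)

lemma decomposition_unique:
  assumes "x \<in> Re_carrier" "y \<in> Re_carrier" "x' \<in> Re_carrier" "y' \<in> Re_carrier"
    and eq: "x \<oplus> \<i> \<odot> y = x' \<oplus> \<i> \<odot> y'"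
  shows "x = x'" "y = y'"
proof -
  let ?P = "\<lambda>(a, b). a \<in> Re_carrier \<and> b \<in> Re_carrier \<and> x \<oplus> \<i> \<odot> y = a \<oplus> \<i> \<odot> b"
  have "x \<oplus> \<i> \<odot> y \<in> carrier E" using assms Re_carrier_closed by simp
  then have ex: "\<exists>!p. ?P p" by (rule decomposition_ex1)
  have "(THE p. ?P p) = (x, y)" by (rule the1_equality[OF ex]) (use assms(1,2) in simp)
  moreover have "(THE p. ?P p) = (x', y')" by (rule the1_equality[OF ex]) (use assms(3,4) eq in simp)
  ultimately have "(x, y) = (x', y')" by simp
  then show "x = x'" "y = y'" by auto
qed

text \<open>The modulus of \<open>x + \<i> y\<close> is an upper bound of \<open>\<plusminus> x\<close> (angles \<open>0\<close> and \<open>\<pi>\<close>) and of \<open>\<plusminus> y\<close>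
  (angles \<open>\<plusminus> \<pi> / 2\<close>).\<close>

lemma norm_decomposition:
  assumes x: "x \<in> Re_carrier" and y: "y \<in> Re_carrier"
  shows "vnorm E x \<le> vnorm E (x \<oplus> \<i> \<odot> y)" "vnorm E y \<le> vnorm E (x \<oplus> \<i> \<odot> y)"
proof -
  obtain w where w: "is_modulus E x y w" and n: "vnorm E (x \<oplus> \<i> \<odot> y) = vnorm E w"
    using complex_banach_lattice[unfolded complex_banach_lattice_def, THEN conjunct2, THEN conjunct2,
        THEN conjunct2, THEN conjunct2] x y by blast
  let ?r = "\<lambda>\<theta>. complex_of_real (cos \<theta>) \<odot> x \<oplus> complex_of_real (sin \<theta>) \<odot> y"
  have r: "?r \<theta> \<in> Re_carrier" for \<theta> using x y by (intro Re_carrier_add Re_carrier_smult)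
  have wc: "w \<in> Re_carrier" and up: "w \<ominus>\<^bsub>real_part E\<^esub> ?r \<theta> \<in> pcone E" for \<theta>
    using w r[of \<theta>] unfolding is_modulus_def least_def Upper_def by auto
  have neg: "\<ominus>\<^bsub>real_part E\<^esub> a = (- 1) \<odot> a" if "a \<in> Re_carrier" for a
    using R.uminus_smult[OF that] by simp
  have le: "vnorm E a \<le> vnorm E w"
    if a: "a \<in> Re_carrier" "?r \<theta> = a" "?r \<theta>' = (- 1) \<odot> a" for a \<theta> \<theta>'
  proof -
    have "w \<ominus>\<^bsub>real_part E\<^esub> (\<ominus>\<^bsub>real_part E\<^esub> a) \<in> pcone E" using up[of \<theta>'] a neg by simp
    then have "w \<oplus> a \<in> pcone E" using R.minus_uminus[OF wc a(1)] by simp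
    then show ?thesis using R.norm_dominated[OF a(1) wc] up[of \<theta>] a by simp
  qed
  note c = Re_carrier_closed[OF x] Re_carrier_closed[OF y]
  show "vnorm E x \<le> vnorm E (x \<oplus> \<i> \<odot> y)"
    unfolding n by (rule le[of _ 0 pi]) (use x c in auto)
  show "vnorm E y \<le> vnorm E (x \<oplus> \<i> \<odot> y)"
    unfolding n by (rule le[of _ "pi/2" "- (pi/2)"]) (use y c in auto)
qed

end

context complex_lattice begin

text \<open>The extension \<open>f x + \<i> f y\<close> is complex linear.  The bound 2 comes from the two parts of \<open>x + \<i> y\<close>,
  each of norm at most \<open>\<parallel>x + \<i> y\<parallel>\<close>.\<close>

lemma complexify_functional:
  assumes add: "\<And>x y. x \<in> Re_carrier \<Longrightarrow> y \<in> Re_carrier \<Longrightarrow> f (x \<oplus> y) = f x + f y"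
    and scale: "\<And>t x. x \<in> Re_carrier \<Longrightarrow> f (complex_of_real t \<odot> x) = t * f x"
    and bound: "\<And>x. x \<in> Re_carrier \<Longrightarrow> \<bar>f x\<bar> \<le> vnorm E x"
    and pos: "\<And>x. x \<in> pcone E \<Longrightarrow> 0 \<le> f x"
  obtains \<phi> where "\<phi> \<in> dual_cone UNIV E" "op_norm E (scalar_space UNIV) \<phi> \<le> 2"
    "\<And>x y. x \<in> Re_carrier \<Longrightarrow> y \<in> Re_carrier \<Longrightarrow> \<phi> (x \<oplus> \<i> \<odot> y) = Complex (f x) (f y)"
proof -
  define \<phi> where "\<phi> = (\<lambda>z\<in>carrier E. THE c. \<exists>x\<in>Re_carrier. \<exists>y\<in>Re_carrier.
    z = x \<oplus> \<i> \<odot> y \<and> c = Complex (f x) (f y))"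
  have val: "\<phi> (x \<oplus> \<i> \<odot> y) = Complex (f x) (f y)" if x: "x \<in> Re_carrier" and y: "y \<in> Re_carrier" for x y
  proof -
    have "x \<oplus> \<i> \<odot> y \<in> carrier E" using x y Re_carrier_closed by simp
    moreover have "(THE c. \<exists>x'\<in>Re_carrier. \<exists>y'\<in>Re_carrier.
        x \<oplus> \<i> \<odot> y = x' \<oplus> \<i> \<odot> y' \<and> c = Complex (f x') (f y')) = Complex (f x) (f y)"
      using x y decomposition_unique[OF x y] by (intro the_equality) blast+
    ultimately show ?thesis by (simp add: \<phi>_def)
  qed
  have S: "nspace UNIV (scalar_space UNIV)" by (rule nspace_scalar_space) simp
  have bd: "cmod (\<phi> z) \<le> 2 * vnorm E z" if z: "z \<in> carrier E" for z
  proof -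
    obtain x y where xy: "x \<in> Re_carrier" "y \<in> Re_carrier" "z = x \<oplus> \<i> \<odot> y" using decomposition[OF z] .
    have "cmod (\<phi> z) \<le> \<bar>f x\<bar> + \<bar>f y\<bar>" unfolding xy(3) val[OF xy(1,2)] by (metis cmod_le complex.sel)
    also have "\<dots> \<le> vnorm E x + vnorm E y" using bound xy by (intro add_mono) auto
    also have "\<dots> \<le> 2 * vnorm E z" using norm_decomposition[OF xy(1,2)] by (simp add: xy(3))
    finally show ?thesis .
  qed
  have blo: "\<phi> \<in> bounded_linear_ops UNIV E (scalar_space UNIV)"
  proof (rule bounded_linear_opsI[where C = 2])
    fix z w assume z: "z \<in> carrier E" and w: "w \<in> carrier E"
    obtain x y where xy: "x \<in> Re_carrier" "y \<in> Re_carrier" "z = x \<oplus> \<i> \<odot> y" using decomposition[OF z] .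
    obtain x' y' where xy': "x' \<in> Re_carrier" "y' \<in> Re_carrier" "w = x' \<oplus> \<i> \<odot> y'" using decomposition[OF w] .
    note c = xy(1,2)[THEN Re_carrier_closed] xy'(1,2)[THEN Re_carrier_closed]
    have "z \<oplus> w = (x \<oplus> x') \<oplus> \<i> \<odot> (y \<oplus> y')"
      using c by (simp add: xy(3) xy'(3) smult_add_right a_ac)
    then have "\<phi> (z \<oplus> w) = Complex (f (x \<oplus> x')) (f (y \<oplus> y'))"
      using val[OF Re_carrier_add[OF xy(1) xy'(1)] Re_carrier_add[OF xy(2) xy'(2)]] by simp
    then show "\<phi> (z \<oplus> w) = \<phi> z \<oplus>\<^bsub>scalar_space UNIV\<^esub> \<phi> w"
      using xy xy' by (simp add: add val complex_add)
  next
    fix a z assume z: "z \<in> carrier E"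
    obtain x y where xy: "x \<in> Re_carrier" "y \<in> Re_carrier" "z = x \<oplus> \<i> \<odot> y" using decomposition[OF z] .
    note c = xy(1,2)[THEN Re_carrier_closed]
    obtain s t where a: "a = complex_of_real s + \<i> * complex_of_real t" using complex_eq by blast
    let ?s = "complex_of_real s" and ?t = "complex_of_real t" and ?u = "complex_of_real (- t)"
    have ai: "a * \<i> = ?u + \<i> * ?s" by (simp add: a algebra_simps)
    have "a \<odot> z = a \<odot> x \<oplus> (a * \<i>) \<odot> y" using c by (simp add: xy(3) smult_add_right smult_smult)
    also have "\<dots> = (?s \<odot> x \<oplus> (\<i> * ?t) \<odot> x) \<oplus> (?u \<odot> y \<oplus> (\<i> * ?s) \<odot> y)"
      unfolding ai unfolding a using c by (simp only: smult_add_left UNIV_I)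
    also have "\<dots> = (?s \<odot> x \<oplus> ?u \<odot> y) \<oplus> ((\<i> * ?s) \<odot> y \<oplus> (\<i> * ?t) \<odot> x)"
      using c by (simp add: a_ac del: of_real_minus)
    also have "(\<i> * ?s) \<odot> y \<oplus> (\<i> * ?t) \<odot> x = \<i> \<odot> (?s \<odot> y \<oplus> ?t \<odot> x)"
      using c by (simp add: smult_add_right smult_smult)
    finally have az: "a \<odot> z = (?s \<odot> x \<oplus> ?u \<odot> y) \<oplus> \<i> \<odot> (?s \<odot> y \<oplus> ?t \<odot> x)" .
    note R = xy(1,2)[THEN Re_carrier_smult]
    have "\<phi> (a \<odot> z) = Complex (f (?s \<odot> x \<oplus> ?u \<odot> y)) (f (?s \<odot> y \<oplus> ?t \<odot> x))"
      unfolding az by (intro val Re_carrier_add R)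
    also have "\<dots> = Complex (s * f x - t * f y) (s * f y + t * f x)"
      using add[OF R(1)[of s] R(2)[of "- t"]] add[OF R(2)[of s] R(1)[of t]] scale xy(1,2) 
      by (simp only: scale) simp
    also have "\<dots> = a * Complex (f x) (f y)" by (simp add: a complex_eq_iff)
    finally show "\<phi> (a \<odot> z) = a \<odot>\<^bsub>scalar_space UNIV\<^esub> \<phi> z"
      using val[OF xy(1,2)] by (simp add: xy(3))
  qed (use bd in \<open>auto simp: \<phi>_def\<close>)
  have real_val: "\<phi> x = complex_of_real (f x)" if x: "x \<in> Re_carrier" for x
  proof -
    have z: "\<zero> \<in> Re_carrier" using R.zero_closed by simp
    have "f \<zero> = 0" using scale[OF z, of 0] z by simp
    then show ?thesis
      using val[OF x z] Re_carrier_closed[OF x] by (simp add: complex_of_real_def)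
  qed
  show ?thesis
  proof
    have "\<phi> x \<in> \<real>\<^sub>\<ge>\<^sub>0" if "x \<in> pcone E" for x
      using real_val[of x] pos[OF that] R.cone_closed[of x] that by simp
    then show "\<phi> \<in> dual_cone UNIV E" using blo by (simp add: dual_cone_def positive_ops_def)
    show "op_norm E (scalar_space UNIV) \<phi> \<le> 2" using bd nspace_axioms by (intro op_norm_le) auto
  qed (rule val)
qed

text \<open>The factor 4 counts the positive parts \<open>(\<plusminus> a)\<^sup>+\<close> and \<open>(\<plusminus> b)\<^sup>+\<close> of \<open>z = a + \<i> b\<close>.  The norm of each is attained at
  \<open>\<plusminus> a\<close> or \<open>\<plusminus> b\<close> by a positive functional, whose complexification has at least that modulus at \<open>z\<close>.\<close>

lemma positive_functional_norming:
  assumes z: "z \<in> carrier E"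
    and B: "\<And>y. y \<in> dual_cone UNIV E \<Longrightarrow> op_norm E (scalar_space UNIV) y \<le> 2 \<Longrightarrow> cmod (y z) \<le> B"
  shows "vnorm E z \<le> 4 * B"
proof -
  obtain a b where ab: "a \<in> Re_carrier" "b \<in> Re_carrier" "z = a \<oplus> \<i> \<odot> b" using decomposition[OF z] .
  note abc = ab(1,2)[THEN Re_carrier_closed]
  \<comment> \<open>The second premise says that \<open>\<bar>f x\<bar>\<close> is at most the modulus of the complexification of \<open>f\<close> at \<open>z\<close>.\<close>
  have part: "vnorm E (pos_part (real_part E) x) \<le> B"
    if x: "x \<in> Re_carrier" and dom: "\<And>f. (\<And>t x. x \<in> Re_carrier \<Longrightarrow> f (complex_of_real t \<odot> x) = t * f x)
      \<Longrightarrow> \<bar>f x\<bar> \<le> cmod (Complex (f a) (f b))" for x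
  proof -
    obtain f where f: "\<And>x y. x \<in> Re_carrier \<Longrightarrow> y \<in> Re_carrier \<Longrightarrow> f (x \<oplus> y) = f x + f y"
      "\<And>t x. x \<in> Re_carrier \<Longrightarrow> f (complex_of_real t \<odot> x) = t * f x"
      "\<And>x. x \<in> Re_carrier \<Longrightarrow> \<bar>f x\<bar> \<le> vnorm E x"
      "\<And>x. x \<in> pcone E \<Longrightarrow> 0 \<le> f x"
      "f x = vnorm E (pos_part (real_part E) x)"
      using R.positive_functional_exists[OF x] unfolding real_part_simps by blast
    obtain \<phi> where \<phi>: "\<phi> \<in> dual_cone UNIV E" "op_norm E (scalar_space UNIV) \<phi> \<le> 2"
      "\<And>x y. x \<in> Re_carrier \<Longrightarrow> y \<in> Re_carrier \<Longrightarrow> \<phi> (x \<oplus> \<i> \<odot> y) = Complex (f x) (f y)"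
      using complexify_functional[OF f(1-4)] by blast
    have "vnorm E (pos_part (real_part E) x) \<le> cmod (Complex (f a) (f b))"
      using dom[of f] f(2,5) by simp
    also have "\<dots> = cmod (\<phi> z)" using \<phi>(3)[OF ab(1,2)] by (simp add: ab(3))
    also have "\<dots> \<le> B" by (rule B[OF \<phi>(1,2)])
    finally show ?thesis .
  qed
  have neg: "\<ominus>\<^bsub>real_part E\<^esub> x = complex_of_real (- 1) \<odot> x" if "x \<in> Re_carrier" for x
    using R.uminus_smult[OF that] by simp
  have half: "vnorm E x \<le> 2 * B" if x: "x \<in> Re_carrier" and
      dom: "\<And>f. \<bar>f x\<bar> \<le> cmod (Complex (f a) (f b))" for x
  proof -
    have "vnorm E (pos_part (real_part E) x) \<le> B" by (rule part[OF x dom])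
    moreover have "vnorm E (pos_part (real_part E) (\<ominus>\<^bsub>real_part E\<^esub> x)) \<le> B"
    proof (rule part)
      fix f :: "'a \<Rightarrow> real"
      assume "\<And>t x. x \<in> Re_carrier \<Longrightarrow> f (complex_of_real t \<odot> x) = t * f x"
      then have "f (\<ominus>\<^bsub>real_part E\<^esub> x) = - f x" using x neg[OF x] by (simp del: of_real_minus)
      then show "\<bar>f (\<ominus>\<^bsub>real_part E\<^esub> x)\<bar> \<le> cmod (Complex (f a) (f b))" using dom by simp
    qed (use x in auto)
    ultimately show ?thesis using R.norm_le_pos_parts[OF x] by simp
  qed
  have "vnorm E a \<le> 2 * B" by (rule half[OF ab(1)]) (metis abs_Re_le_cmod complex.sel(1))
  moreover have "vnorm E b \<le> 2 * B" by (rule half[OF ab(2)]) (metis abs_Im_le_cmod complex.sel(2))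
  moreover have "vnorm E z \<le> vnorm E a + vnorm E b"
    using norm_triangle[of a "\<i> \<odot> b"] abc by (simp add: ab(3) norm_smult)
  ultimately show ?thesis by simp
qed

end

section \<open>Norming functionals and positive decompositions\<close>

text \<open>Here a factor 2 would do; 4 agrees with the complex case.\<close>

lemma (in real_lattice) positive_functional_norming:
  assumes z: "z \<in> carrier E"
    and B: "\<And>y. y \<in> dual_cone \<real> E \<Longrightarrow> op_norm E (scalar_space \<real>) y \<le> 2 \<Longrightarrow> cmod (y z) \<le> B"
  shows "vnorm E z \<le> 4 * B"
proof -
  have part: "vnorm E (pos_part E x) \<le> B \<and> 0 \<le> B" if x: "x = z \<or> x = \<ominus> z" for x
  proof -
    have xc: "x \<in> carrier E" using x z by auto
    obtain f where f: "\<And>x y. x \<in> carrier E \<Longrightarrow> y \<in> carrier E \<Longrightarrow> f (x \<oplus> y) = f x + f y"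
      "\<And>t x. x \<in> carrier E \<Longrightarrow> f (complex_of_real t \<odot> x) = t * f x"
      "\<And>x. x \<in> carrier E \<Longrightarrow> \<bar>f x\<bar> \<le> vnorm E x"
      "\<And>x. x \<in> pcone E \<Longrightarrow> 0 \<le> f x"
      "f x = vnorm E (pos_part E x)"
      using positive_functional_exists[OF xc] by blast
    define \<phi> where "\<phi> = (\<lambda>x\<in>carrier E. complex_of_real (f x))"
    have blo: "\<phi> \<in> bounded_linear_ops \<real> E (scalar_space \<real>)"
    proof (rule bounded_linear_opsI[where C = 1])
      fix a :: complex and x assume "a \<in> \<real>" and x: "x \<in> carrier E"
      then obtain t where "a = complex_of_real t" by (auto elim: Reals_cases)
      then show "\<phi> (a \<odot> x) = a \<odot>\<^bsub>scalar_space \<real>\<^esub> \<phi> x" using x f(2) by (simp add: \<phi>_def)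
    qed (use f(1,3) in \<open>auto simp: \<phi>_def\<close>)
    moreover have "\<phi> x \<in> \<real>\<^sub>\<ge>\<^sub>0" if "x \<in> pcone E" for x
      using f(4)[OF that] cone_closed[OF that] by (simp add: \<phi>_def)
    ultimately have "\<phi> \<in> dual_cone \<real> E" by (simp add: dual_cone_def positive_ops_def)
    moreover have "op_norm E (scalar_space \<real>) \<phi> \<le> 2"
    proof (rule op_norm_le[OF nspace_axioms])
      fix x assume x: "x \<in> carrier E"
      show "vnorm (scalar_space \<real>) (\<phi> x) \<le> 2 * vnorm E x"
        using f(3)[OF x] norm_ge_zero[OF x] x by (simp add: \<phi>_def)
    qed simp
    ultimately have "cmod (\<phi> z) \<le> B" by (rule B)
    then have "\<bar>f z\<bar> \<le> B" using z by (simp add: \<phi>_def)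
    moreover have "\<bar>f x\<bar> = \<bar>f z\<bar>" using x f(2)[OF z, of "- 1"] z by (auto simp: uminus_smult)
    ultimately show ?thesis using f(5) norm_ge_zero[OF pos_part_closed[OF xc]] by linarith
  qed
  have "vnorm E (pos_part E z) \<le> B" "vnorm E (pos_part E (\<ominus> z)) \<le> B" "0 \<le> B"
    using part by blast+
  then show ?thesis using norm_le_pos_parts[OF z] by linarith
qed

lemma banach_lattice_cases:
  assumes "banach_lattice K E"
  obtains "K = \<real>" "real_lattice E" | "K = UNIV" "complex_lattice E"
  using assms by (auto simp: banach_lattice_def real_lattice_def complex_lattice_def)

lemma banach_lattice_nspace: "banach_lattice K E \<Longrightarrow> nspace K E"
  by (auto simp: nspace_def banach_lattice_def real_banach_lattice_def complex_banach_lattice_def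
      banach_space_def)

lemma banach_lattice_banach: "banach_lattice K E \<Longrightarrow> banach_space K E"
  by (auto simp: banach_lattice_def real_banach_lattice_def complex_banach_lattice_def)

lemma banach_lattice_cone: "banach_lattice K E \<Longrightarrow> x \<in> pcone E \<Longrightarrow> x \<in> carrier E"
  by (auto simp: banach_lattice_def real_banach_lattice_def complex_banach_lattice_def)

lemma positive_functionals_norming:
  assumes "banach_lattice K E" "z \<in> carrier E"
    "\<And>y. y \<in> dual_cone K E \<Longrightarrow> op_norm E (scalar_space K) y \<le> 2 \<Longrightarrow> cmod (y z) \<le> B"
  shows "vnorm E z \<le> 4 * B"
  using assms(1)
proof (cases rule: banach_lattice_cases)
  case 1
  then show ?thesis using real_lattice.positive_functional_norming[of E z B] assms by simp
next
  case 2
  then show ?thesis using complex_lattice.positive_functional_norming[of E z B] assms by simp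
qed

text \<open>The decomposition is \<open>x = x\<^sup>+ - (x\<^sup>+ - x)\<close>.\<close>

lemma (in real_lattice) difference_of_positives:
  assumes x: "x \<in> carrier E"
  obtains a b where "a \<in> pcone E" "b \<in> pcone E" "x = a \<ominus> b"
    "vnorm E a \<le> 2 * vnorm E x" "vnorm E b \<le> 2 * vnorm E x"
proof
  let ?a = "pos_part E x"
  note a = pos_part_closed[OF x]
  show "?a \<in> pcone E" "?a \<ominus> x \<in> pcone E" by (rule pos_part_cone[OF x], rule pos_part_ge[OF x])
  show "x = ?a \<ominus> (?a \<ominus> x)"
  proof -
    have "?a \<ominus> (?a \<ominus> x) = (?a \<oplus> \<ominus> ?a) \<oplus> x" using x a by (simp add: a_minus_def minus_add a_assoc)
    then show ?thesis using x a by (simp add: r_neg)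
  qed
  have n: "vnorm E ?a \<le> vnorm E x" "0 \<le> vnorm E x" using norm_pos_part x by auto
  show "vnorm E ?a \<le> 2 * vnorm E x" using n by simp
  show "vnorm E (?a \<ominus> x) \<le> 2 * vnorm E x" using norm_minus_le[OF a x] n by simp
qed

text \<open>The factor \<open>s\<close> is \<open>\<i>\<close> for complex lattices; in real ones it is 0.\<close>

lemma combination_of_positives:
  assumes E: "banach_lattice K E" and x: "x \<in> carrier E"
  obtains a b c d s where "a \<in> pcone E" "b \<in> pcone E" "c \<in> pcone E" "d \<in> pcone E" "s \<in> K" "cmod s \<le> 1"
    "x = (a \<ominus>\<^bsub>E\<^esub> b) \<oplus>\<^bsub>E\<^esub> s \<odot>\<^bsub>E\<^esub> (c \<ominus>\<^bsub>E\<^esub> d)"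
    "\<And>w. w \<in> {a, b, c, d} \<Longrightarrow> vnorm E w \<le> 2 * vnorm E x"
  using E
proof (cases rule: banach_lattice_cases)
  case 1
  interpret real_lattice E by (rule 1)
  obtain a b where ab: "a \<in> pcone E" "b \<in> pcone E" "x = a \<ominus>\<^bsub>E\<^esub> b"
    "vnorm E a \<le> 2 * vnorm E x" "vnorm E b \<le> 2 * vnorm E x"
    using difference_of_positives[OF x] by blast
  have "x = (a \<ominus>\<^bsub>E\<^esub> b) \<oplus>\<^bsub>E\<^esub> 0 \<odot>\<^bsub>E\<^esub> (a \<ominus>\<^bsub>E\<^esub> b)" using ab(3) x by simp
  then show ?thesis using that[of a b a b 0] ab 1 by auto
next
  case 2
  interpret complex_lattice E by (rule 2)
  obtain u v where uv: "u \<in> Re_carrier" "v \<in> Re_carrier" "x = u \<oplus>\<^bsub>E\<^esub> \<i> \<odot>\<^bsub>E\<^esub> v" using decomposition[OF x] .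
  note n = norm_decomposition[OF uv(1,2), folded uv(3)]
  obtain a b where ab: "a \<in> pcone E" "b \<in> pcone E" "u = a \<ominus>\<^bsub>real_part E\<^esub> b"
    "vnorm E a \<le> 2 * vnorm E u" "vnorm E b \<le> 2 * vnorm E u"
    using R.difference_of_positives[OF uv(1)] unfolding real_part_simps by blast
  obtain c d where cd: "c \<in> pcone E" "d \<in> pcone E" "v = c \<ominus>\<^bsub>real_part E\<^esub> d"
    "vnorm E c \<le> 2 * vnorm E v" "vnorm E d \<le> 2 * vnorm E v"
    using R.difference_of_positives[OF uv(2)] unfolding real_part_simps by blast
  have m: "y \<ominus>\<^bsub>real_part E\<^esub> w = y \<ominus>\<^bsub>E\<^esub> w" if "y \<in> pcone E" "w \<in> pcone E" for y w
    using R.minus_smult[of y w] minus_smult[of y w] R.cone_closed[of y] R.cone_closed[of w]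
      cone_carrier[of y] cone_carrier[of w] that by simp
  show ?thesis
  proof (rule that[OF ab(1,2) cd(1,2)])
    show "\<i> \<in> K" "cmod \<i> \<le> 1" using 2 by auto
    show "x = (a \<ominus>\<^bsub>E\<^esub> b) \<oplus>\<^bsub>E\<^esub> \<i> \<odot>\<^bsub>E\<^esub> (c \<ominus>\<^bsub>E\<^esub> d)"
      using uv(3) ab(1-3) cd(1-3) m by simp
    show "vnorm E w \<le> 2 * vnorm E x" if "w \<in> {a, b, c, d}" for w using that ab cd n by auto
  qed
qed

section \<open>Bounded multilinear operators\<close>

lemma mdomD: "x \<in> mdom E \<Longrightarrow> x j \<in> carrier (E j)"
  by (simp add: mdom_def)

lemma mdom_upd: "x \<in> mdom E \<Longrightarrow> a \<in> carrier (E j) \<Longrightarrow> x(j := a) \<in> mdom E"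
  by (simp add: mdom_def)

lemma multilinear_mapI:
  assumes E: "\<And>j. nspace K (E j)" and T: "T \<in> mdom E \<rightarrow>\<^sub>E carrier F"
    and add: "\<And>x j a b. x \<in> mdom E \<Longrightarrow> a \<in> carrier (E j) \<Longrightarrow> b \<in> carrier (E j) \<Longrightarrow>
      T (x(j := a \<oplus>\<^bsub>E j\<^esub> b)) = T (x(j := a)) \<oplus>\<^bsub>F\<^esub> T (x(j := b))"
    and smult: "\<And>x j c a. x \<in> mdom E \<Longrightarrow> c \<in> K \<Longrightarrow> a \<in> carrier (E j) \<Longrightarrow>
      T (x(j := c \<odot>\<^bsub>E j\<^esub> a)) = c \<odot>\<^bsub>F\<^esub> T (x(j := a))"
  shows "multilinear_map K E F T"
proof -
  have "linear_map K (E j) F (\<lambda>y\<in>carrier (E j). T (x(j := y)))" if x: "x \<in> mdom E" for x j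
  proof -
    interpret Ej: nspace K "E j" by (rule E)
    show ?thesis unfolding linear_map_def
    proof (intro conjI ballI)
      show "(\<lambda>y\<in>carrier (E j). T (x(j := y))) \<in> carrier (E j) \<rightarrow>\<^sub>E carrier F"
        using T mdom_upd[OF x] by (auto simp: PiE_iff)
    qed (use add smult x in auto)
  qed
  then show ?thesis using T by (simp add: multilinear_map_def)
qed

lemma multilinear_mapD:
  assumes T: "multilinear_map K E F T"
  shows "T \<in> mdom E \<rightarrow>\<^sub>E carrier F" "x \<in> mdom E \<Longrightarrow> T x \<in> carrier F"
  using T by (auto simp: multilinear_map_def)

lemma multilinear_map_coord:
  assumes T: "multilinear_map K E F T" and E: "\<And>j. nspace K (E j)" and x: "x \<in> mdom E"
  shows "a \<in> carrier (E j) \<Longrightarrow> b \<in> carrier (E j) \<Longrightarrow>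
      T (x(j := a \<oplus>\<^bsub>E j\<^esub> b)) = T (x(j := a)) \<oplus>\<^bsub>F\<^esub> T (x(j := b))"
    "c \<in> K \<Longrightarrow> a \<in> carrier (E j) \<Longrightarrow> T (x(j := c \<odot>\<^bsub>E j\<^esub> a)) = c \<odot>\<^bsub>F\<^esub> T (x(j := a))"
proof -
  interpret Ej: nspace K "E j" by (rule E)
  have lin: "linear_map K (E j) F (\<lambda>y\<in>carrier (E j). T (x(j := y)))"
    using T x by (simp add: multilinear_map_def)
  show "a \<in> carrier (E j) \<Longrightarrow> b \<in> carrier (E j) \<Longrightarrow>
      T (x(j := a \<oplus>\<^bsub>E j\<^esub> b)) = T (x(j := a)) \<oplus>\<^bsub>F\<^esub> T (x(j := b))"
    using linear_mapD(2)[OF lin, of a b] by simp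
  show "c \<in> K \<Longrightarrow> a \<in> carrier (E j) \<Longrightarrow> T (x(j := c \<odot>\<^bsub>E j\<^esub> a)) = c \<odot>\<^bsub>F\<^esub> T (x(j := a))"
    using linear_mapD(3)[OF lin, of c a] by simp
qed

lemma prod_upd:
  fixes f :: "'m::finite \<Rightarrow> 'a \<Rightarrow> 'b::comm_monoid_mult"
  shows "(\<Prod>k\<in>UNIV. f k ((x(j := a)) k)) = f j a * (\<Prod>k\<in>UNIV - {j}. f k (x k))"
  by (subst prod.remove[of _ j]) (auto intro!: prod.cong)

lemma prod_split:
  fixes f :: "'m::finite \<Rightarrow> 'b::comm_monoid_mult"
  shows "(\<Prod>k\<in>UNIV. f k) = f j * (\<Prod>k\<in>UNIV - {j}. f k)"
  by (rule prod.remove) auto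

lemma bounded_multilinear_bound:
  assumes E: "\<And>j. nspace K (E j)" and T: "T \<in> bounded_multilinear_ops K E F"
  obtains C where "0 \<le> C" "\<And>x. x \<in> mdom E \<Longrightarrow> vnorm F (T x) \<le> C * (\<Prod>j\<in>UNIV. vnorm (E j) (x j))"
proof -
  obtain C where C: "\<And>x. x \<in> mdom E \<Longrightarrow> vnorm F (T x) \<le> C * (\<Prod>j\<in>UNIV. vnorm (E j) (x j))"
    using T by (auto simp: bounded_multilinear_ops_def)
  have "vnorm F (T x) \<le> \<bar>C\<bar> * (\<Prod>j\<in>UNIV. vnorm (E j) (x j))" if x: "x \<in> mdom E" for x
  proof -
    have "0 \<le> (\<Prod>j\<in>UNIV. vnorm (E j) (x j))"
      using nspace.norm_ge_zero[OF E mdomD[OF x]] by (intro prod_nonneg) auto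
    then show ?thesis using C[OF x] by (meson abs_ge_self mult_right_mono order_trans)
  qed
  then show ?thesis using that[of "\<bar>C\<bar>"] by simp
qed

lemma bounded_multilinear_opsD: "T \<in> bounded_multilinear_ops K E F \<Longrightarrow> multilinear_map K E F T"
  by (simp add: bounded_multilinear_ops_def)

lemma bounded_multilinear_opsI:
  "multilinear_map K E F T \<Longrightarrow>
   (\<And>x. x \<in> mdom E \<Longrightarrow> vnorm F (T x) \<le> C * (\<Prod>j\<in>UNIV. vnorm (E j) (x j))) \<Longrightarrow>
   T \<in> bounded_multilinear_ops K E F"
  unfolding bounded_multilinear_ops_def by (intro CollectI conjI exI[of _ C]) auto

lemma bounded_multilinear_zero:
  assumes E: "\<And>j. nspace K (E j)" and F: "nspace K F"
  shows "(\<lambda>x\<in>mdom E. \<zero>\<^bsub>F\<^esub>) \<in> bounded_multilinear_ops K E F"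
proof -
  interpret F: nspace K F by (rule F)
  have cl: "a \<oplus>\<^bsub>E j\<^esub> b \<in> carrier (E j)" "c \<in> K \<Longrightarrow> c \<odot>\<^bsub>E j\<^esub> a \<in> carrier (E j)"
    if "a \<in> carrier (E j)" "b \<in> carrier (E j)" for a b c j
  proof -
    interpret Ej: nspace K "E j" by (rule E)
    show "a \<oplus>\<^bsub>E j\<^esub> b \<in> carrier (E j)" "c \<in> K \<Longrightarrow> c \<odot>\<^bsub>E j\<^esub> a \<in> carrier (E j)" using that by auto
  qed
  show ?thesis
    by (rule bounded_multilinear_opsI[where C = 0], rule multilinear_mapI[OF E])
       (auto simp: mdom_upd cl)
qed

lemma bounded_multilinear_add:
  assumes E: "\<And>j. nspace K (E j)" and F: "nspace K F"
    and S: "S \<in> bounded_multilinear_ops K E F" and T: "T \<in> bounded_multilinear_ops K E F"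
  shows "(\<lambda>x\<in>mdom E. S x \<oplus>\<^bsub>F\<^esub> T x) \<in> bounded_multilinear_ops K E F"
proof -
  interpret F: nspace K F by (rule F)
  note Sm = bounded_multilinear_opsD[OF S] and Tm = bounded_multilinear_opsD[OF T]
  have val: "S x \<in> carrier F" "T x \<in> carrier F" if "x \<in> mdom E" for x
    using multilinear_mapD(2)[OF Sm that] multilinear_mapD(2)[OF Tm that] .
  obtain C where C: "\<And>x. x \<in> mdom E \<Longrightarrow> vnorm F (S x) \<le> C * (\<Prod>j\<in>UNIV. vnorm (E j) (x j))"
    using bounded_multilinear_bound[OF E S] by blast
  obtain D where D: "\<And>x. x \<in> mdom E \<Longrightarrow> vnorm F (T x) \<le> D * (\<Prod>j\<in>UNIV. vnorm (E j) (x j))"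
    using bounded_multilinear_bound[OF E T] by blast
  show ?thesis
  proof (rule bounded_multilinear_opsI[where C = "C + D"], rule multilinear_mapI[OF E])
    show "(\<lambda>x\<in>mdom E. S x \<oplus>\<^bsub>F\<^esub> T x) \<in> mdom E \<rightarrow>\<^sub>E carrier F" using val by auto
    fix x j assume x: "x \<in> mdom E"
    interpret Ej: nspace K "E j" by (rule E)
    note m = multilinear_map_coord[OF Sm E x] multilinear_map_coord[OF Tm E x] mdom_upd[OF x]
    fix a assume a: "a \<in> carrier (E j)"
    note va = val[OF m(5)[OF a]]
    show "(\<lambda>x\<in>mdom E. S x \<oplus>\<^bsub>F\<^esub> T x) (x(j := a \<oplus>\<^bsub>E j\<^esub> b)) =
        (\<lambda>x\<in>mdom E. S x \<oplus>\<^bsub>F\<^esub> T x) (x(j := a)) \<oplus>\<^bsub>F\<^esub> (\<lambda>x\<in>mdom E. S x \<oplus>\<^bsub>F\<^esub> T x) (x(j := b))"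
      if b: "b \<in> carrier (E j)" for b
      using m va val[OF m(5)[OF b]] a b by (simp add: F.a_ac)
    show "(\<lambda>x\<in>mdom E. S x \<oplus>\<^bsub>F\<^esub> T x) (x(j := c \<odot>\<^bsub>E j\<^esub> a)) =
        c \<odot>\<^bsub>F\<^esub> (\<lambda>x\<in>mdom E. S x \<oplus>\<^bsub>F\<^esub> T x) (x(j := a))" if c: "c \<in> K" for c
      using m va a c by (simp add: F.smult_add_right)
  next
    fix x assume x: "x \<in> mdom E"
    have "vnorm F (S x \<oplus>\<^bsub>F\<^esub> T x) \<le> vnorm F (S x) + vnorm F (T x)" by (rule F.norm_triangle[OF val[OF x]])
    then show "vnorm F ((\<lambda>x\<in>mdom E. S x \<oplus>\<^bsub>F\<^esub> T x) x) \<le> (C + D) * (\<Prod>j\<in>UNIV. vnorm (E j) (x j))"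
      using C[OF x] D[OF x] x by (simp add: distrib_right)
  qed
qed

lemma bounded_multilinear_smult:
  assumes E: "\<And>j. nspace K (E j)" and F: "nspace K F" and s: "s \<in> K"
    and T: "T \<in> bounded_multilinear_ops K E F"
  shows "(\<lambda>x\<in>mdom E. s \<odot>\<^bsub>F\<^esub> T x) \<in> bounded_multilinear_ops K E F"
proof -
  interpret F: nspace K F by (rule F)
  note Tm = bounded_multilinear_opsD[OF T]
  note val = multilinear_mapD(2)[OF Tm]
  obtain D where D: "\<And>x. x \<in> mdom E \<Longrightarrow> vnorm F (T x) \<le> D * (\<Prod>j\<in>UNIV. vnorm (E j) (x j))"
    using bounded_multilinear_bound[OF E T] by blast
  show ?thesis
  proof (rule bounded_multilinear_opsI[where C = "cmod s * D"], rule multilinear_mapI[OF E])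
    show "(\<lambda>x\<in>mdom E. s \<odot>\<^bsub>F\<^esub> T x) \<in> mdom E \<rightarrow>\<^sub>E carrier F" using val s by auto
    fix x j assume x: "x \<in> mdom E"
    interpret Ej: nspace K "E j" by (rule E)
    note m = multilinear_map_coord[OF Tm E x] mdom_upd[OF x]
    fix a assume a: "a \<in> carrier (E j)"
    note va = val[OF m(3)[OF a]]
    show "(\<lambda>x\<in>mdom E. s \<odot>\<^bsub>F\<^esub> T x) (x(j := a \<oplus>\<^bsub>E j\<^esub> b)) =
        (\<lambda>x\<in>mdom E. s \<odot>\<^bsub>F\<^esub> T x) (x(j := a)) \<oplus>\<^bsub>F\<^esub> (\<lambda>x\<in>mdom E. s \<odot>\<^bsub>F\<^esub> T x) (x(j := b))"
      if b: "b \<in> carrier (E j)" for b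
      using m va val[OF m(3)[OF b]] a b s by (simp add: F.smult_add_right)
    show "(\<lambda>x\<in>mdom E. s \<odot>\<^bsub>F\<^esub> T x) (x(j := c \<odot>\<^bsub>E j\<^esub> a)) =
        c \<odot>\<^bsub>F\<^esub> (\<lambda>x\<in>mdom E. s \<odot>\<^bsub>F\<^esub> T x) (x(j := a))" if c: "c \<in> K" for c
      using m va a c s by (simp add: F.smult_smult mult.commute)
  next
    fix x assume x: "x \<in> mdom E"
    have "cmod s * vnorm F (T x) \<le> cmod s * (D * (\<Prod>j\<in>UNIV. vnorm (E j) (x j)))"
      by (rule mult_left_mono[OF D[OF x]]) simp
    then show "vnorm F ((\<lambda>x\<in>mdom E. s \<odot>\<^bsub>F\<^esub> T x) x) \<le> (cmod s * D) * (\<Prod>j\<in>UNIV. vnorm (E j) (x j))"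
      using val[OF x] x s by (simp add: F.norm_smult mult.assoc)
  qed
qed

lemma rank_one_bounded_multilinear:
  fixes E :: "'m::finite \<Rightarrow> ('a, 'c) nspace_scheme"
  assumes E: "\<And>j. nspace K (E j)" and F: "nspace K F"
    and \<phi>: "\<And>j. \<phi> j \<in> carrier (dual K (E j))" and y: "y \<in> carrier F"
  shows "(\<lambda>x\<in>mdom E. (\<Prod>j\<in>UNIV. \<phi> j (x j)) \<odot>\<^bsub>F\<^esub> y) \<in> bounded_multilinear_ops K E F"
proof -
  interpret F: nspace K F by (rule F)
  have lin: "\<phi> j \<in> bounded_linear_ops K (E j) (scalar_space K)" for j using \<phi>[of j] by simp
  note \<phi>l = bounded_linear_ops_linear[OF lin, simplified]
  have prodK: "(\<Prod>j\<in>J. f j) \<in> K" if "\<And>j. j \<in> J \<Longrightarrow> f j \<in> K" for J :: "'m set" and f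
    using that F.scalars by (induction J rule: infinite_finite_induct) auto
  show ?thesis
  proof (rule bounded_multilinear_opsI[where C = "(\<Prod>j\<in>UNIV. vnorm (dual K (E j)) (\<phi> j)) * vnorm F y"],
      rule multilinear_mapI[OF E])
    show "(\<lambda>x\<in>mdom E. (\<Prod>j\<in>UNIV. \<phi> j (x j)) \<odot>\<^bsub>F\<^esub> y) \<in> mdom E \<rightarrow>\<^sub>E carrier F"
      unfolding restrict_PiE_iff by (intro ballI F.smult_closed prodK \<phi>l(1) mdomD[of _ E] y)
    fix x j assume x: "x \<in> mdom E"
    interpret Ej: nspace K "E j" by (rule E)
    let ?P = "\<Prod>k\<in>UNIV - {j}. \<phi> k (x k)"
    have P: "?P \<in> K" using \<phi>l(1) mdomD[OF x] by (intro prodK) auto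
    fix a assume a: "a \<in> carrier (E j)"
    note m = mdom_upd[OF x]
    show "(\<lambda>x\<in>mdom E. (\<Prod>j\<in>UNIV. \<phi> j (x j)) \<odot>\<^bsub>F\<^esub> y) (x(j := a \<oplus>\<^bsub>E j\<^esub> b)) =
        (\<lambda>x\<in>mdom E. (\<Prod>j\<in>UNIV. \<phi> j (x j)) \<odot>\<^bsub>F\<^esub> y) (x(j := a)) \<oplus>\<^bsub>F\<^esub>
        (\<lambda>x\<in>mdom E. (\<Prod>j\<in>UNIV. \<phi> j (x j)) \<odot>\<^bsub>F\<^esub> y) (x(j := b))"
      if b: "b \<in> carrier (E j)" for b
      using m a b P \<phi>l(1)[OF a] \<phi>l(1)[OF b] y F.scalars(5)[of _ ?P]
      by (simp add: prod_upd \<phi>l(2) distrib_right F.smult_add_left del: fun_upd_apply)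
    show "(\<lambda>x\<in>mdom E. (\<Prod>j\<in>UNIV. \<phi> j (x j)) \<odot>\<^bsub>F\<^esub> y) (x(j := c \<odot>\<^bsub>E j\<^esub> a)) =
        c \<odot>\<^bsub>F\<^esub> (\<lambda>x\<in>mdom E. (\<Prod>j\<in>UNIV. \<phi> j (x j)) \<odot>\<^bsub>F\<^esub> y) (x(j := a))" if c: "c \<in> K" for c
      using m a c P \<phi>l(1)[OF a] y F.scalars(5)[of _ ?P]
      by (simp add: prod_upd \<phi>l(3) F.smult_smult mult.assoc del: fun_upd_apply)
  next
    fix x assume x: "x \<in> mdom E"
    have "cmod (\<Prod>j\<in>UNIV. \<phi> j (x j)) = (\<Prod>j\<in>UNIV. cmod (\<phi> j (x j)))" by (simp add: prod_norm)
    also have "\<dots> \<le> (\<Prod>j\<in>UNIV. vnorm (dual K (E j)) (\<phi> j) * vnorm (E j) (x j))"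
      by (intro prod_mono conjI dual_bound[OF E \<phi> mdomD[OF x]]) auto
    finally have "cmod (\<Prod>j\<in>UNIV. \<phi> j (x j)) * vnorm F y
        \<le> (\<Prod>j\<in>UNIV. vnorm (dual K (E j)) (\<phi> j)) * (\<Prod>j\<in>UNIV. vnorm (E j) (x j)) * vnorm F y"
      using y by (intro mult_right_mono) (auto simp: prod.distrib)
    then show "vnorm F ((\<lambda>x\<in>mdom E. (\<Prod>j\<in>UNIV. \<phi> j (x j)) \<odot>\<^bsub>F\<^esub> y) x) \<le>
        ((\<Prod>j\<in>UNIV. vnorm (dual K (E j)) (\<phi> j)) * vnorm F y) * (\<Prod>j\<in>UNIV. vnorm (E j) (x j))"
      using x y prodK[of UNIV "\<lambda>j. \<phi> j (x j)"] \<phi>l(1)[OF mdomD[OF x]]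
      by (simp add: F.norm_smult mult_ac del: dual_simps)
  qed
qed

lemma compose_bounded_multilinear:
  assumes E: "\<And>j. nspace K (E j)" and F: "nspace K F" and G: "\<And>j. nspace K (G j)" and H: "nspace K H"
    and T: "T \<in> bounded_multilinear_ops K E F" and u: "\<And>j. u j \<in> bounded_linear_ops K (G j) (E j)"
    and v: "v \<in> bounded_linear_ops K F H"
  shows "compose_ops G v T u \<in> bounded_multilinear_ops K G H"
proof -
  interpret F: nspace K F by (rule F)
  note Tm = bounded_multilinear_opsD[OF T]
  note ul = bounded_linear_ops_linear[OF u] and vl = bounded_linear_ops_linear[OF v]
  obtain D where D: "0 \<le> D" "\<And>x. x \<in> mdom E \<Longrightarrow> vnorm F (T x) \<le> D * (\<Prod>j\<in>UNIV. vnorm (E j) (x j))"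
    using bounded_multilinear_bound[OF E T] by blast
  have ux: "(\<lambda>j. u j (x j)) \<in> mdom E" if "x \<in> mdom G" for x
    using ul(1)[OF mdomD[OF that]] by (simp add: mdom_def)
  have upd: "(\<lambda>k. u k ((x(j := a)) k)) = (\<lambda>k. u k (x k))(j := u j a)" for x j a by auto
  show ?thesis
  proof (rule bounded_multilinear_opsI[where
        C = "op_norm F H v * (D * (\<Prod>j\<in>UNIV. op_norm (G j) (E j) (u j)))"],
      rule multilinear_mapI[OF G])
    show "compose_ops G v T u \<in> mdom G \<rightarrow>\<^sub>E carrier H"
      using ux multilinear_mapD(2)[OF Tm] vl(1) by (auto simp: compose_ops_def)
    fix x j assume x: "x \<in> mdom G"
    interpret Gj: nspace K "G j" by (rule G)
    note m = mdom_upd[OF x] and mu = multilinear_map_coord[OF Tm E ux[OF x]]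
    have Tc: "T ((\<lambda>k. u k (x k))(j := u j a)) \<in> carrier F" if "a \<in> carrier (G j)" for a
      using that by (intro multilinear_mapD(2)[OF Tm] mdom_upd ux[OF x] ul(1))
    fix a assume a: "a \<in> carrier (G j)"
    show "compose_ops G v T u (x(j := a \<oplus>\<^bsub>G j\<^esub> b)) =
        compose_ops G v T u (x(j := a)) \<oplus>\<^bsub>H\<^esub> compose_ops G v T u (x(j := b))"
      if b: "b \<in> carrier (G j)" for b
      using m a b ul(1)[OF a] ul(1)[OF b] Tc[OF a] Tc[OF b]
      by (simp add: compose_ops_def upd ul(2) mu vl(2) del: fun_upd_apply)
    show "compose_ops G v T u (x(j := c \<odot>\<^bsub>G j\<^esub> a)) = c \<odot>\<^bsub>H\<^esub> compose_ops G v T u (x(j := a))"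
      if c: "c \<in> K" for c
      using m a c ul(1)[OF a] Tc[OF a]
      by (simp add: compose_ops_def upd ul(3) mu vl(3) del: fun_upd_apply)
  next
    fix x assume x: "x \<in> mdom G"
    have "vnorm H (v (T (\<lambda>j. u j (x j)))) \<le> op_norm F H v * vnorm F (T (\<lambda>j. u j (x j)))"
      by (intro op_norm_bound[OF F H v] multilinear_mapD(2)[OF Tm] ux[OF x])
    also have "\<dots> \<le> op_norm F H v * (D * (\<Prod>j\<in>UNIV. vnorm (E j) (u j (x j))))"
      by (intro mult_left_mono D(2) ux[OF x] op_norm_nonneg[OF F H v])
    also have "\<dots> \<le> op_norm F H v * (D * (\<Prod>j\<in>UNIV. op_norm (G j) (E j) (u j) * vnorm (G j) (x j)))"
      using D(1) nspace.norm_ge_zero[OF E ul(1)[OF mdomD[OF x]]]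
      by (intro mult_left_mono prod_mono conjI op_norm_nonneg[OF F H v] op_norm_bound[OF G E u mdomD[OF x]]) auto
    finally show "vnorm H (compose_ops G v T u x) \<le>
        op_norm F H v * (D * (\<Prod>j\<in>UNIV. op_norm (G j) (E j) (u j))) * (\<Prod>j\<in>UNIV. vnorm (G j) (x j))"
      using x by (simp add: compose_ops_def prod.distrib mult_ac)
  qed
qed

section \<open>Positive dominated operators\<close>

lemma dual_cone_dual: "y \<in> dual_cone K F \<Longrightarrow> y \<in> carrier (dual K F)"
  by (simp add: dual_cone_def positive_ops_def)

lemma scalar_lattice_simps [simp]:
  "carrier (scalar_lattice K) = Inl ` K"
  "x \<oplus>\<^bsub>scalar_lattice K\<^esub> y = Inl (projl x + projl y)"
  "a \<odot>\<^bsub>scalar_lattice K\<^esub> x = Inl (a * projl x)"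
  "\<zero>\<^bsub>scalar_lattice K\<^esub> = Inl 0" "vnorm (scalar_lattice K) = (\<lambda>x. cmod (projl x))"
  "pcone (scalar_lattice K) = Inl ` \<real>\<^sub>\<ge>\<^sub>0"
  by (simp_all add: scalar_lattice_def)

lemma nspace_scalar_lattice:
  assumes K: "K = \<real> \<or> K = UNIV"
  shows "nspace K (scalar_lattice K)"
proof
  have "abelian_group (scalar_lattice K)"
  proof (rule abelian_groupI)
    fix x assume "x \<in> carrier (scalar_lattice K)"
    then show "\<exists>y\<in>carrier (scalar_lattice K). y \<oplus>\<^bsub>scalar_lattice K\<^esub> x = \<zero>\<^bsub>scalar_lattice K\<^esub>"
      using scalars_closed[OF K] by (intro bexI[of _ "Inl (- projl x)"]) auto
  qed (use scalars_closed[OF K] in auto)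
  then have "module (scalar_ring K) (scalar_lattice K)"
    by (intro moduleI scalar_ring_cring K) (use scalars_closed[OF K] in \<open>auto simp: algebra_simps\<close>)
  then show "normed_space K (scalar_lattice K)"
    by (auto simp: normed_space_def norm_mult norm_triangle_ineq)
qed (rule K)

locale exponents =
  fixes K :: "complex set" and p r :: ennreal and ps :: "'m::finite \<Rightarrow> ennreal"
  assumes K: "K = \<real> \<or> K = UNIV" and r: "1 \<le> r" and p: "1 \<le> p" and ps: "\<And>j. 1 \<le> ps j"
begin

text \<open>The right-hand side of the defining inequality without the constant.\<close>

definition weak_prod :: "('m \<Rightarrow> 'a blattice) \<Rightarrow> 'a blattice \<Rightarrow> nat \<Rightarrow> (nat \<Rightarrow> 'm \<Rightarrow> 'a) \<Rightarrow>
    (nat \<Rightarrow> 'a \<Rightarrow> complex) \<Rightarrow> real" where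
  "weak_prod E F n x y =
     (\<Prod>j\<in>UNIV. weak_norm K (E j) (ps j) n (\<lambda>i. x i j)) * weak_norm K (dual K F) r n y"

lemma dominated_byI:
  assumes "\<And>n x y. 1 \<le> n \<Longrightarrow> (\<And>i j. i < n \<Longrightarrow> x i j \<in> pcone (E j)) \<Longrightarrow>
    (\<And>i. i < n \<Longrightarrow> y i \<in> dual_cone K F) \<Longrightarrow>
    lp_norm p n (\<lambda>i. y i (T (x i))) \<le> C * weak_prod E F n x y"
  shows "dominated_by K p ps r E F T C"
  using assms unfolding dominated_by_def weak_prod_def by (auto simp: mult.assoc)

lemma dominated_byD:
  assumes "dominated_by K p ps r E F T C" "1 \<le> n" "\<And>i j. i < n \<Longrightarrow> x i j \<in> pcone (E j)"
    "\<And>i. i < n \<Longrightarrow> y i \<in> dual_cone K F"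
  shows "lp_norm p n (\<lambda>i. y i (T (x i))) \<le> C * weak_prod E F n x y"
  using assms unfolding dominated_by_def weak_prod_def by (simp add: mult.assoc)

end

locale exponents_lattices = exponents K p r ps
  for K p r and ps :: "'m::finite \<Rightarrow> ennreal" +
  fixes E :: "'m \<Rightarrow> 'a blattice" and F :: "'a blattice"
  assumes E: "\<And>j. nspace K (E j)" and F: "nspace K F"
    and cone_E: "\<And>j. pcone (E j) \<subseteq> carrier (E j)" and cone_F: "pcone F \<subseteq> carrier F"
begin

sublocale F: nspace K F by (rule F)

abbreviation dominated where "dominated \<equiv> dominated_by K p ps r E F"
abbreviation dominated_ops where "dominated_ops \<equiv> positive_dominated_ops K p ps r E F"
abbreviation dominated_norm where "dominated_norm \<equiv> positive_dominated_norm K p ps r E F"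

lemma dual_ns: "nspace K (dual K F)" by (rule nspace_dual[OF F])

lemma cone_mdom: "(\<And>j. x j \<in> pcone (E j)) \<Longrightarrow> x \<in> mdom E"
  using cone_E by (auto simp: mdom_def)

lemma weak_prod_nonneg:
  assumes "1 \<le> n" "\<And>i j. i < n \<Longrightarrow> x i j \<in> pcone (E j)" "\<And>i. i < n \<Longrightarrow> y i \<in> dual_cone K F"
  shows "0 \<le> weak_prod E F n x y"
  unfolding weak_prod_def using assms cone_E dual_cone_dual
  by (intro mult_nonneg_nonneg prod_nonneg ballI weak_norm_nonneg[OF E ps] weak_norm_nonneg[OF dual_ns r])
     blast+

lemma dominated_by_mono:
  assumes "dominated T C" "C \<le> C'"
  shows "dominated T C'"
proof (rule dominated_byI)
  fix n :: nat and x :: "nat \<Rightarrow> 'm \<Rightarrow> 'a" and y :: "nat \<Rightarrow> 'a \<Rightarrow> complex"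
  assume a: "1 \<le> n" "\<And>i j. i < n \<Longrightarrow> x i j \<in> pcone (E j)" "\<And>i. i < n \<Longrightarrow> y i \<in> dual_cone K F"
  have "C * weak_prod E F n x y \<le> C' * weak_prod E F n x y"
    using assms(2) weak_prod_nonneg[where x = x and y = y, OF a] by (rule mult_right_mono)
  then show "lp_norm p n (\<lambda>i. y i (T (x i))) \<le> C' * weak_prod E F n x y"
    using dominated_byD[where x = x and y = y, OF assms(1) a] by linarith
qed

lemma dominated_norm_le:
  assumes "dominated T C" "0 \<le> C"
  shows "dominated_norm T \<le> C"
proof (rule field_le_epsilon)
  fix e :: real assume e: "0 < e"
  show "dominated_norm T \<le> C + e"
    unfolding positive_dominated_norm_def
  proof (rule cInf_lower)
    show "C + e \<in> {C. 0 < C \<and> dominated T C}"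
      using assms e dominated_by_mono[OF assms(1), of "C + e"] by simp
  qed (auto intro!: bdd_belowI[of _ 0])
qed

lemma dominated_opsI:
  "T \<in> bounded_multilinear_ops K E F \<Longrightarrow> dominated T C \<Longrightarrow>
   T \<in> dominated_ops"
  unfolding positive_dominated_ops_def
  using dominated_by_mono[of T C "max C 1"] by (auto intro!: exI[of _ "max C 1"])

text \<open>The infimum that defines the norm is itself an admissible constant, possibly 0: for fixed test
  vectors, the inequality is a closed condition on the constant.\<close>

lemma dominated_opsD:
  assumes T: "T \<in> dominated_ops"
  shows "T \<in> bounded_multilinear_ops K E F"
    "0 \<le> dominated_norm T"
    "dominated T (dominated_norm T)"
proof -
  let ?S = "{C. 0 < C \<and> dominated T C}"
  have ne: "?S \<noteq> {}" using T by (auto simp: positive_dominated_ops_def)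
  show "T \<in> bounded_multilinear_ops K E F" using T by (simp add: positive_dominated_ops_def)
  show "0 \<le> dominated_norm T"
    unfolding positive_dominated_norm_def using ne by (intro cInf_greatest) auto
  show "dominated T (dominated_norm T)"
  proof (rule dominated_byI)
    fix n :: nat and x :: "nat \<Rightarrow> 'm \<Rightarrow> 'a" and y :: "nat \<Rightarrow> 'a \<Rightarrow> complex"
  assume a: "1 \<le> n" "\<And>i j. i < n \<Longrightarrow> x i j \<in> pcone (E j)" "\<And>i. i < n \<Longrightarrow> y i \<in> dual_cone K F"
    let ?A = "weak_prod E F n x y" and ?L = "lp_norm p n (\<lambda>i. y i (T (x i)))"
    have L: "?L \<le> C * ?A" if "C \<in> ?S" for C using that by (intro dominated_byD[OF _ a]) auto
    show "?L \<le> dominated_norm T * ?A"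
    proof (cases "?A = 0")
      case True
      then show ?thesis using ne L by fastforce
    next
      case False
      then have A: "0 < ?A" using weak_prod_nonneg[where x = x and y = y, OF a] by simp
      have "?L / ?A \<le> dominated_norm T"
        unfolding positive_dominated_norm_def using ne L A
        by (intro cInf_greatest) (auto simp: pos_divide_le_eq)
      then show ?thesis using A by (simp add: pos_divide_le_eq)
    qed
  qed
qed

lemma functional_linear:
  assumes "y \<in> dual_cone K F"
  shows "a \<in> carrier F \<Longrightarrow> b \<in> carrier F \<Longrightarrow> y (a \<oplus>\<^bsub>F\<^esub> b) = y a + y b"
    "c \<in> K \<Longrightarrow> a \<in> carrier F \<Longrightarrow> y (c \<odot>\<^bsub>F\<^esub> a) = c * y a"
    "a \<in> carrier F \<Longrightarrow> b \<in> carrier F \<Longrightarrow> y (a \<ominus>\<^bsub>F\<^esub> b) = y a - y b"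
    "y \<zero>\<^bsub>F\<^esub> = 0"
proof -
  have y: "y \<in> bounded_linear_ops K F (scalar_space K)" using dual_cone_dual[OF assms] by simp
  show add: "a \<in> carrier F \<Longrightarrow> b \<in> carrier F \<Longrightarrow> y (a \<oplus>\<^bsub>F\<^esub> b) = y a + y b" for a b
    using bounded_linear_ops_linear(2)[OF y] by simp
  show sm: "c \<in> K \<Longrightarrow> a \<in> carrier F \<Longrightarrow> y (c \<odot>\<^bsub>F\<^esub> a) = c * y a" for a c
    using bounded_linear_ops_linear(3)[OF y] by simp
  show "a \<in> carrier F \<Longrightarrow> b \<in> carrier F \<Longrightarrow> y (a \<ominus>\<^bsub>F\<^esub> b) = y a - y b"
    using add sm F.scalars by (simp add: F.minus_smult)
  show "y \<zero>\<^bsub>F\<^esub> = 0" using sm[of 0 "\<zero>\<^bsub>F\<^esub>"] F.scalars by simp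
qed

lemma multilinear_val:
  "T \<in> bounded_multilinear_ops K E F \<Longrightarrow> x \<in> mdom E \<Longrightarrow> T x \<in> carrier F"
  using multilinear_mapD(2)[OF bounded_multilinear_opsD] .

lemma dominated_zero: "dominated (\<lambda>x\<in>mdom E. \<zero>\<^bsub>F\<^esub>) 0"
proof (rule dominated_byI)
  fix n :: nat and x :: "nat \<Rightarrow> 'm \<Rightarrow> 'a" and y :: "nat \<Rightarrow> 'a \<Rightarrow> complex"
  assume a: "1 \<le> n" "\<And>i j. i < n \<Longrightarrow> x i j \<in> pcone (E j)" "\<And>i. i < n \<Longrightarrow> y i \<in> dual_cone K F"
  have "lp_norm p n (\<lambda>i. y i ((\<lambda>x\<in>mdom E. \<zero>\<^bsub>F\<^esub>) (x i))) \<le> 0 * lp_norm p n (\<lambda>_. 1)"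
    using a cone_mdom functional_linear(4) by (intro lp_norm_coord_bound[OF p a(1)]) auto
  then show "lp_norm p n (\<lambda>i. y i ((\<lambda>x\<in>mdom E. \<zero>\<^bsub>F\<^esub>) (x i))) \<le> 0 * weak_prod E F n x y" by simp
qed

lemma dominated_add:
  assumes S: "\<And>x. x \<in> mdom E \<Longrightarrow> S x \<in> carrier F" and T: "\<And>x. x \<in> mdom E \<Longrightarrow> T x \<in> carrier F"
    and dS: "dominated S C" and dT: "dominated T D"
  shows "dominated (\<lambda>x\<in>mdom E. S x \<oplus>\<^bsub>F\<^esub> T x) (C + D)"
proof (rule dominated_byI)
  fix n :: nat and x :: "nat \<Rightarrow> 'm \<Rightarrow> 'a" and y :: "nat \<Rightarrow> 'a \<Rightarrow> complex"
  assume a: "1 \<le> n" "\<And>i j. i < n \<Longrightarrow> x i j \<in> pcone (E j)" "\<And>i. i < n \<Longrightarrow> y i \<in> dual_cone K F"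
  have "lp_norm p n (\<lambda>i. y i ((\<lambda>x\<in>mdom E. S x \<oplus>\<^bsub>F\<^esub> T x) (x i)))
      \<le> lp_norm p n (\<lambda>i. y i (S (x i)) + y i (T (x i)))"
    using a cone_mdom S T by (intro lp_norm_mono[OF p a(1)]) (auto simp: functional_linear(1))
  also have "\<dots> \<le> lp_norm p n (\<lambda>i. y i (S (x i))) + lp_norm p n (\<lambda>i. y i (T (x i)))"
    by (rule lp_norm_triangle[OF p a(1)])
  also have "\<dots> \<le> C * weak_prod E F n x y + D * weak_prod E F n x y"
    by (intro add_mono dominated_byD[where x = x and y = y, OF dS a] dominated_byD[where x = x and y = y, OF dT a])
  finally show "lp_norm p n (\<lambda>i. y i ((\<lambda>x\<in>mdom E. S x \<oplus>\<^bsub>F\<^esub> T x) (x i))) \<le> (C + D) * weak_prod E F n x y"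
    by (simp add: distrib_right)
qed

lemma dominated_smult:
  assumes T: "\<And>x. x \<in> mdom E \<Longrightarrow> T x \<in> carrier F" and s: "s \<in> K"
    and dT: "dominated T D"
  shows "dominated (\<lambda>x\<in>mdom E. s \<odot>\<^bsub>F\<^esub> T x) (cmod s * D)"
proof (rule dominated_byI)
  fix n :: nat and x :: "nat \<Rightarrow> 'm \<Rightarrow> 'a" and y :: "nat \<Rightarrow> 'a \<Rightarrow> complex"
  assume a: "1 \<le> n" "\<And>i j. i < n \<Longrightarrow> x i j \<in> pcone (E j)" "\<And>i. i < n \<Longrightarrow> y i \<in> dual_cone K F"
  have "lp_norm p n (\<lambda>i. y i ((\<lambda>x\<in>mdom E. s \<odot>\<^bsub>F\<^esub> T x) (x i))) \<le> lp_norm p n (\<lambda>i. s * y i (T (x i)))"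
    using a cone_mdom T s by (intro lp_norm_mono[OF p a(1)]) (auto simp: functional_linear(2))
  also have "\<dots> = cmod s * lp_norm p n (\<lambda>i. y i (T (x i)))" by (rule lp_norm_scale[OF p a(1)])
  also have "\<dots> \<le> cmod s * (D * weak_prod E F n x y)"
    by (intro mult_left_mono dominated_byD[where x = x and y = y, OF dT a]) auto
  finally show "lp_norm p n (\<lambda>i. y i ((\<lambda>x\<in>mdom E. s \<odot>\<^bsub>F\<^esub> T x) (x i))) \<le> cmod s * D * weak_prod E F n x y"
    by (simp add: mult.assoc)
qed

text \<open>The pairing with \<open>y\<^sub>i\<close> is a product of \<open>m + 1\<close> scalars, to which Hoelder's inequality applies.
  The factors are indexed by \<open>'m option\<close>, where \<open>None\<close> belongs to the functionals \<open>y\<^sub>i\<close>.\<close>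

lemma dominated_rank_one:
  assumes pq: "1 / p = (\<Sum>j\<in>UNIV. 1 / ps j) + 1 / r"
    and \<phi>: "\<And>j. \<phi> j \<in> carrier (dual K (E j))" and z: "z \<in> carrier F"
  shows "dominated (\<lambda>x\<in>mdom E. (\<Prod>j\<in>UNIV. \<phi> j (x j)) \<odot>\<^bsub>F\<^esub> z)
    ((\<Prod>j\<in>UNIV. vnorm (dual K (E j)) (\<phi> j)) * vnorm F z)"
proof (rule dominated_byI)
  fix n :: nat and x :: "nat \<Rightarrow> 'm \<Rightarrow> 'a" and y :: "nat \<Rightarrow> 'a \<Rightarrow> complex"
  assume a: "1 \<le> n" "\<And>i j. i < n \<Longrightarrow> x i j \<in> pcone (E j)" "\<And>i. i < n \<Longrightarrow> y i \<in> dual_cone K F"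
  have xc: "x i j \<in> carrier (E j)" if "i < n" for i j using a(2)[OF that] cone_E by blast
  have yc: "y i \<in> carrier (dual K F)" if "i < n" for i by (rule dual_cone_dual[OF a(3)[OF that]])
  define b where "b k i = (case k of None \<Rightarrow> y i z | Some j \<Rightarrow> \<phi> j (x i j))" for k :: "'m option" and i
  define q where "q k = (case k of None \<Rightarrow> r | Some j \<Rightarrow> ps j)" for k :: "'m option"
  have prod_opt: "(\<Prod>k\<in>UNIV. f k) = f None * (\<Prod>j\<in>UNIV. f (Some j))" for f :: "'m option \<Rightarrow> 'c::comm_monoid_mult"
    by (simp add: UNIV_option_conv prod.reindex)
  have sum_opt: "(\<Sum>k\<in>UNIV. f k) = f None + (\<Sum>j\<in>UNIV. f (Some j))" for f :: "'m option \<Rightarrow> ennreal"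
    by (simp add: UNIV_option_conv sum.reindex)
  let ?ev = "\<lambda>f\<in>carrier (dual K F). f z"
  have \<phi>K: "\<phi> j (x i j) \<in> K" if "i < n" for i j
    using \<phi>[of j] xc[OF that, of j] bounded_linear_ops_linear(1) by fastforce
  have prodK: "(\<Prod>j\<in>J. f j) \<in> K" if "\<And>j. j \<in> J \<Longrightarrow> f j \<in> K" for J :: "'m set" and f
    using that F.scalars by (induction J rule: infinite_finite_induct) auto
  have "lp_norm p n (\<lambda>i. y i ((\<lambda>x\<in>mdom E. (\<Prod>j\<in>UNIV. \<phi> j (x j)) \<odot>\<^bsub>F\<^esub> z) (x i)))
      \<le> lp_norm p n (\<lambda>i. \<Prod>k\<in>UNIV. b k i)"
    using a cone_mdom z \<phi>K prodK
    by (intro lp_norm_mono[OF p a(1)]) (auto simp: functional_linear(2) b_def prod_opt mult.commute)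
  also have "\<dots> \<le> (\<Prod>k\<in>UNIV. lp_norm (q k) n (b k))"
    using pq r ps by (intro lp_norm_Hoelder[OF p _ _ _ a(1)])
      (auto simp: q_def sum_opt add.commute split: option.splits)
  also have "\<dots> = lp_norm r n (\<lambda>i. y i z) * (\<Prod>j\<in>UNIV. lp_norm (ps j) n (\<lambda>i. \<phi> j (x i j)))"
    by (simp add: prod_opt q_def b_def[abs_def])
  also have "\<dots> \<le> (vnorm F z * weak_norm K (dual K F) r n y) *
      (\<Prod>j\<in>UNIV. vnorm (dual K (E j)) (\<phi> j) * weak_norm K (E j) (ps j) n (\<lambda>i. x i j))"
  proof (intro mult_mono prod_mono conjI prod_nonneg)
    have "lp_norm r n (\<lambda>i. y i z) \<le> lp_norm r n (\<lambda>i. ?ev (y i))"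
      using yc by (intro lp_norm_mono[OF r a(1)]) (simp add: restrict_def)
    also have "\<dots> \<le> vnorm F z * weak_norm K (dual K F) r n y"
      by (rule lp_norm_functional_le[where x = y, OF dual_ns r a(1) yc evaluation_in_bidual[OF F z]])
    finally show "lp_norm r n (\<lambda>i. y i z) \<le> vnorm F z * weak_norm K (dual K F) r n y" .
    show "0 \<le> vnorm F z * weak_norm K (dual K F) r n y"
      using z weak_norm_nonneg[where x = y, OF dual_ns r a(1) yc] by simp
    fix j
    show "lp_norm (ps j) n (\<lambda>i. \<phi> j (x i j)) \<le>
        vnorm (dual K (E j)) (\<phi> j) * weak_norm K (E j) (ps j) n (\<lambda>i. x i j)"
      using xc by (intro lp_norm_functional_le[OF E ps a(1) _ \<phi>]) auto
    show "0 \<le> lp_norm (ps j) n (\<lambda>i. \<phi> j (x i j))" by (rule lp_norm_nonneg[OF a(1)])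
    then show "0 \<le> lp_norm (ps j) n (\<lambda>i. \<phi> j (x i j))" .
  qed
  also have "\<dots> = ((\<Prod>j\<in>UNIV. vnorm (dual K (E j)) (\<phi> j)) * vnorm F z) * weak_prod E F n x y"
    by (simp add: weak_prod_def prod.distrib mult_ac)
  finally show "lp_norm p n (\<lambda>i. y i ((\<lambda>x\<in>mdom E. (\<Prod>j\<in>UNIV. \<phi> j (x j)) \<odot>\<^bsub>F\<^esub> z) (x i)))
      \<le> ((\<Prod>j\<in>UNIV. vnorm (dual K (E j)) (\<phi> j)) * vnorm F z) * weak_prod E F n x y" .
qed

lemma zero_in_dominated: "(\<lambda>x\<in>mdom E. \<zero>\<^bsub>F\<^esub>) \<in> dominated_ops"
  by (rule dominated_opsI[OF bounded_multilinear_zero[OF E F] dominated_zero])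

lemma add_in_dominated:
  assumes S: "S \<in> dominated_ops" and T: "T \<in> dominated_ops"
  shows "(\<lambda>x\<in>mdom E. S x \<oplus>\<^bsub>F\<^esub> T x) \<in> dominated_ops"
    "dominated_norm (\<lambda>x\<in>mdom E. S x \<oplus>\<^bsub>F\<^esub> T x) \<le>
      dominated_norm S + dominated_norm T"
proof -
  note Sd = dominated_opsD[OF S] and Td = dominated_opsD[OF T]
  note d = dominated_add[OF multilinear_val[OF Sd(1)] multilinear_val[OF Td(1)] Sd(3) Td(3)]
  show "(\<lambda>x\<in>mdom E. S x \<oplus>\<^bsub>F\<^esub> T x) \<in> dominated_ops"
    by (rule dominated_opsI[OF bounded_multilinear_add[OF E F Sd(1) Td(1)] d])
  show "dominated_norm (\<lambda>x\<in>mdom E. S x \<oplus>\<^bsub>F\<^esub> T x) \<le>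
      dominated_norm S + dominated_norm T"
    using Sd(2) Td(2) by (intro dominated_norm_le[OF d]) auto
qed

lemma smult_in_dominated:
  assumes s: "s \<in> K" and T: "T \<in> dominated_ops"
  shows "(\<lambda>x\<in>mdom E. s \<odot>\<^bsub>F\<^esub> T x) \<in> dominated_ops"
    "dominated_norm (\<lambda>x\<in>mdom E. s \<odot>\<^bsub>F\<^esub> T x) \<le>
      cmod s * dominated_norm T"
proof -
  note Td = dominated_opsD[OF T]
  note d = dominated_smult[OF multilinear_val[OF Td(1)] s Td(3)]
  show "(\<lambda>x\<in>mdom E. s \<odot>\<^bsub>F\<^esub> T x) \<in> dominated_ops"
    by (rule dominated_opsI[OF bounded_multilinear_smult[OF E F s Td(1)] d])
  show "dominated_norm (\<lambda>x\<in>mdom E. s \<odot>\<^bsub>F\<^esub> T x) \<le>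
      cmod s * dominated_norm T"
    using Td(2) by (intro dominated_norm_le[OF d]) auto
qed

lemma finite_rank_in_dominated:
  assumes pq: "1 / p = (\<Sum>j\<in>UNIV. 1 / ps j) + 1 / r"
  shows "finite_rank_ops K E F \<subseteq> dominated_ops"
proof
  fix T assume "T \<in> finite_rank_ops K E F"
  then obtain k :: nat and \<phi> z where
    T: "T = (\<lambda>x\<in>mdom E. \<Oplus>\<^bsub>F\<^esub>i\<in>{..<k}. (\<Prod>j\<in>UNIV. \<phi> i j (x j)) \<odot>\<^bsub>F\<^esub> z i)"
    and c: "\<And>i. i < k \<Longrightarrow> z i \<in> carrier F" "\<And>i j. i < k \<Longrightarrow> \<phi> i j \<in> carrier (dual K (E j))"
    unfolding finite_rank_ops_def by blast
  have rank_one: "(\<lambda>x\<in>mdom E. (\<Prod>j\<in>UNIV. \<phi> i j (x j)) \<odot>\<^bsub>F\<^esub> z i) \<in> dominated_ops"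
    if "i < k" for i
    using c[OF that]
    by (intro dominated_opsI[OF rank_one_bounded_multilinear[OF E F] dominated_rank_one[OF pq]])
  have val: "(\<Prod>j\<in>UNIV. \<phi> i j (x j)) \<odot>\<^bsub>F\<^esub> z i \<in> carrier F" if "i < k" "x \<in> mdom E" for i x
    using multilinear_val[OF dominated_opsD(1)[OF rank_one[OF that(1)]] that(2)] that(2) by simp
  have "(\<lambda>x\<in>mdom E. \<Oplus>\<^bsub>F\<^esub>i\<in>{..<l}. (\<Prod>j\<in>UNIV. \<phi> i j (x j)) \<odot>\<^bsub>F\<^esub> z i) \<in> dominated_ops"
    if "l \<le> k" for l
    using that
  proof (induction l)
    case 0
    show ?case unfolding lessThan_0 F.finsum_empty by (rule zero_in_dominated)
  next
    case (Suc l)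
    let ?g = "\<lambda>i x. (\<Prod>j\<in>UNIV. \<phi> i j (x j)) \<odot>\<^bsub>F\<^esub> z i"
    have "(\<Oplus>\<^bsub>F\<^esub>i\<in>{..<Suc l}. ?g i x) = (\<Oplus>\<^bsub>F\<^esub>i\<in>{..<l}. ?g i x) \<oplus>\<^bsub>F\<^esub> ?g l x" if x: "x \<in> mdom E" for x
    proof -
      have v: "?g i x \<in> carrier F" if "i \<le> l" for i using val[OF _ x, of i] Suc.prems that by simp
      have "(\<Oplus>\<^bsub>F\<^esub>i\<in>{..<Suc l}. ?g i x) = ?g l x \<oplus>\<^bsub>F\<^esub> (\<Oplus>\<^bsub>F\<^esub>i\<in>{..<l}. ?g i x)"
        unfolding lessThan_Suc using v by (intro F.finsum_insert) auto
      also have "\<dots> = (\<Oplus>\<^bsub>F\<^esub>i\<in>{..<l}. ?g i x) \<oplus>\<^bsub>F\<^esub> ?g l x"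
        using v by (intro F.a_comm F.finsum_closed) auto
      finally show ?thesis .
    qed
    then have "(\<lambda>x\<in>mdom E. \<Oplus>\<^bsub>F\<^esub>i\<in>{..<Suc l}. ?g i x) =
        (\<lambda>x\<in>mdom E. (\<lambda>x\<in>mdom E. \<Oplus>\<^bsub>F\<^esub>i\<in>{..<l}. ?g i x) x \<oplus>\<^bsub>F\<^esub> (\<lambda>x\<in>mdom E. ?g l x) x)"
      by (auto intro!: restrict_ext)
    also have "\<dots> \<in> dominated_ops"
      using Suc by (intro add_in_dominated(1) rank_one) auto
    finally show ?case .
  qed
  then show "T \<in> dominated_ops" unfolding T by blast
qed

end

section \<open>The multi-ideal properties\<close>

locale exponents_banach = exponents K p r ps
  for K p r and ps :: "'m::finite \<Rightarrow> ennreal" +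
  fixes E :: "'m \<Rightarrow> 'a blattice" and F :: "'a blattice"
  assumes banach_E: "\<And>j. banach_lattice K (E j)" and banach_F: "banach_lattice K F"

sublocale exponents_banach \<subseteq> exponents_lattices K p r ps E F
  by (intro exponents_lattices.intro exponents_lattices_axioms.intro exponents_axioms
      banach_lattice_nspace banach_E banach_F subsetI, rule banach_lattice_cone[OF banach_E],
      assumption, rule banach_lattice_cone[OF banach_F])

context exponents_banach begin

text \<open>Test sequences of length one.  The factor 8 is the norming constant 4 times the bound 2 on the norms
  of the norming functionals.\<close>

lemma dominated_bound_on_cones:
  assumes T: "multilinear_map K E F T" and d: "dominated T C" and C: "0 \<le> C"
    and x: "\<And>j. x j \<in> pcone (E j)"
  shows "vnorm F (T x) \<le> 8 * C * (\<Prod>j\<in>UNIV. vnorm (E j) (x j))"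
proof -
  have xc: "x j \<in> carrier (E j)" for j using x cone_E by blast
  have "vnorm F (T x) \<le> 4 * (C * ((\<Prod>j\<in>UNIV. vnorm (E j) (x j)) * 2))"
  proof (rule positive_functionals_norming[OF banach_F multilinear_mapD(2)[OF T cone_mdom[of x, OF x]]])
    fix y assume y: "y \<in> dual_cone K F" "op_norm F (scalar_space K) y \<le> 2"
    note yc = dual_cone_dual[OF y(1)]
    have "cmod (y (T x)) = lp_norm p 1 (\<lambda>i. y (T x))" by (simp only: lp_norm_one[OF p])
    also have "\<dots> \<le> C * weak_prod E F 1 (\<lambda>_. x) (\<lambda>_. y)"
      by (rule dominated_byD[OF d, of 1 "\<lambda>_. x" "\<lambda>_. y"]) (use x y in auto)
    also have "\<dots> \<le> C * ((\<Prod>j\<in>UNIV. vnorm (E j) (x j)) * 2)"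
      unfolding weak_prod_def
    proof (intro mult_left_mono mult_mono prod_mono conjI C prod_nonneg)
      fix j
      show "weak_norm K (E j) (ps j) 1 (\<lambda>i. x j) \<le> vnorm (E j) (x j)"
        by (rule weak_norm_one[OF E ps xc])
      show "0 \<le> weak_norm K (E j) (ps j) 1 (\<lambda>i. x j)"
        by (rule weak_norm_nonneg[OF E ps]) (use xc in auto)
      show "0 \<le> vnorm (E j) (x j)" by (rule nspace.norm_ge_zero[OF E xc])
    next
      have "weak_norm K (dual K F) r 1 (\<lambda>_. y) \<le> vnorm (dual K F) y" by (rule weak_norm_one[OF dual_ns r yc])
      also have "\<dots> \<le> 2" using y(2) by simp
      finally show "weak_norm K (dual K F) r 1 (\<lambda>_. y) \<le> 2" .
      show "0 \<le> weak_norm K (dual K F) r 1 (\<lambda>_. y)"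
        by (rule weak_norm_nonneg[OF dual_ns r]) (use yc in auto)
    qed
    finally show "cmod (y (T x)) \<le> C * ((\<Prod>j\<in>UNIV. vnorm (E j) (x j)) * 2)" .
  qed
  then show ?thesis by simp
qed

text \<open>The coordinates in \<open>J\<close> are freed one after the other.  Each costs a factor 8, as it is expanded into
  four positive vectors of at most twice its norm.\<close>

lemma dominated_bound_partial:
  assumes T: "multilinear_map K E F T" and d: "dominated T C" and C: "0 \<le> C"
    and J: "finite J"
  shows "x \<in> mdom E \<Longrightarrow> (\<And>j. j \<notin> J \<Longrightarrow> x j \<in> pcone (E j)) \<Longrightarrow>
    vnorm F (T x) \<le> 8 ^ card J * (8 * C) * (\<Prod>j\<in>UNIV. vnorm (E j) (x j))"
  using J
proof (induction J arbitrary: x rule: finite_induct)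
  case empty
  then show ?case using dominated_bound_on_cones[OF T d C, of x] by simp
next
  case (insert j J)
  note x = insert.prems(1)
  interpret Ej: nspace K "E j" by (rule E)
  define M where "M = 8 ^ card J * (8 * C)"
  define R where "R = (\<Prod>k\<in>UNIV - {j}. vnorm (E k) (x k))"
  have M: "0 \<le> M" using C by (simp add: M_def)
  have R: "0 \<le> R" unfolding R_def by (intro prod_nonneg ballI nspace.norm_ge_zero[OF E mdomD[OF x]])
  obtain a b c e s where abce: "a \<in> pcone (E j)" "b \<in> pcone (E j)" "c \<in> pcone (E j)" "e \<in> pcone (E j)"
    "s \<in> K" "cmod s \<le> 1" "x j = (a \<ominus>\<^bsub>E j\<^esub> b) \<oplus>\<^bsub>E j\<^esub> s \<odot>\<^bsub>E j\<^esub> (c \<ominus>\<^bsub>E j\<^esub> e)"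
    "\<And>w. w \<in> {a, b, c, e} \<Longrightarrow> vnorm (E j) w \<le> 2 * vnorm (E j) (x j)"
    using combination_of_positives[OF banach_E mdomD[OF x, of j]] by metis
  have cl: "w \<in> carrier (E j)" if "w \<in> {a, b, c, e}" for w using that abce(1-4) cone_E[of j] by auto
  let ?T = "\<lambda>w. T (x(j := w))"
  have Tv: "?T w \<in> carrier F" if "w \<in> carrier (E j)" for w
    by (rule multilinear_mapD(2)[OF T mdom_upd[OF x that]])
  note lin = multilinear_map_coord[OF T E x, where j = j]
  have Tminus: "?T (u \<ominus>\<^bsub>E j\<^esub> w) = ?T u \<ominus>\<^bsub>F\<^esub> ?T w" if "u \<in> carrier (E j)" "w \<in> carrier (E j)" for u w
    using that Ej.scalars Tv by (simp add: Ej.minus_smult F.minus_smult lin del: fun_upd_apply)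
  have bd: "vnorm F (?T w) \<le> M * (2 * vnorm (E j) (x j) * R)" if w: "w \<in> {a, b, c, e}" for w
  proof -
    have "vnorm F (?T w) \<le> M * (\<Prod>k\<in>UNIV. vnorm (E k) ((x(j := w)) k))"
      unfolding M_def
    proof (rule insert.IH)
      show "x(j := w) \<in> mdom E" by (rule mdom_upd[OF x cl[OF w]])
      fix k assume "k \<notin> J"
      then show "(x(j := w)) k \<in> pcone (E k)" using insert.prems(2)[of k] w abce(1-4) by auto
    qed
    also have "\<dots> = M * (vnorm (E j) w * R)"
      using prod_upd[of "\<lambda>k. vnorm (E k)" x j w] by (simp add: R_def del: fun_upd_apply)
    also have "\<dots> \<le> M * (2 * vnorm (E j) (x j) * R)"
      using M R abce(8)[OF w] by (intro mult_left_mono mult_right_mono) auto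
    finally show ?thesis .
  qed
  have c4: "a \<in> carrier (E j)" "b \<in> carrier (E j)" "c \<in> carrier (E j)" "e \<in> carrier (E j)" using cl by auto
  have "T x = ?T (x j)" by simp
  also have "\<dots> = (?T a \<ominus>\<^bsub>F\<^esub> ?T b) \<oplus>\<^bsub>F\<^esub> s \<odot>\<^bsub>F\<^esub> (?T c \<ominus>\<^bsub>F\<^esub> ?T e)"
    unfolding abce(7) using c4 abce(5) by (simp add: lin Tminus del: fun_upd_apply)
  finally have "vnorm F (T x) \<le> vnorm F (?T a \<ominus>\<^bsub>F\<^esub> ?T b) + vnorm F (s \<odot>\<^bsub>F\<^esub> (?T c \<ominus>\<^bsub>F\<^esub> ?T e))"
    using c4 abce(5) Tv by (simp add: F.norm_triangle del: fun_upd_apply)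
  also have "\<dots> \<le> vnorm F (?T a \<ominus>\<^bsub>F\<^esub> ?T b) + 1 * vnorm F (?T c \<ominus>\<^bsub>F\<^esub> ?T e)"
    using c4 abce(5,6) Tv
    by (intro add_left_mono) (auto simp: F.norm_smult simp del: fun_upd_apply intro!: mult_left_le_one_le)
  also have "\<dots> \<le> (vnorm F (?T a) + vnorm F (?T b)) + 1 * (vnorm F (?T c) + vnorm F (?T e))"
    by (intro add_mono mult_left_mono F.norm_minus_le Tv c4) simp
  also have "\<dots> \<le> 4 * (M * (2 * vnorm (E j) (x j) * R))"
    using bd[of a] bd[of b] bd[of c] bd[of e] by simp
  also have "\<dots> = 8 ^ card (insert j J) * (8 * C) * (\<Prod>k\<in>UNIV. vnorm (E k) (x k))"
    using insert.hyps by (simp add: prod_split[of "\<lambda>k. vnorm (E k) (x k)" j] M_def R_def)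
  finally show ?case .
qed

definition \<kappa> :: real where "\<kappa> = 8 ^ CARD('m) * 8"

lemma dominated_bound:
  assumes "multilinear_map K E F T" "dominated T C" "0 \<le> C" "x \<in> mdom E"
  shows "vnorm F (T x) \<le> \<kappa> * C * (\<Prod>j\<in>UNIV. vnorm (E j) (x j))"
  using dominated_bound_partial[OF assms(1-3) finite, of x UNIV] assms(4) by (simp add: \<kappa>_def)

abbreviation dominated_space where
  "dominated_space \<equiv> map_space (mdom E) F dominated_ops dominated_norm"

lemma dominated_ops_extensional: "dominated_ops \<subseteq> mdom E \<rightarrow>\<^sub>E carrier F"
  using multilinear_mapD(1)[OF bounded_multilinear_opsD] dominated_opsD(1) by blast

lemma module_dominated_space: "module (scalar_ring K) dominated_space"
  by (rule map_space_module[OF F dominated_ops_extensional zero_in_dominated add_in_dominated(1) smult_in_dominated(1)])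

lemma minus_dominated_space: "S \<in> dominated_ops \<Longrightarrow> T \<in> dominated_ops \<Longrightarrow> S \<ominus>\<^bsub>dominated_space\<^esub> T = (\<lambda>x\<in>mdom E. S x \<ominus>\<^bsub>F\<^esub> T x)"
  by (rule map_space_minus[OF module_dominated_space F _ _ dominated_ops_extensional])

lemma dominated_norm_smult:
  assumes s: "s \<in> K" and T: "T \<in> dominated_ops"
  shows "dominated_norm (\<lambda>x\<in>mdom E. s \<odot>\<^bsub>F\<^esub> T x) = cmod s * dominated_norm T"
proof (cases "s = 0")
  case True
  then show ?thesis
    using smult_in_dominated[OF s T] dominated_opsD(2)[OF smult_in_dominated(1)[OF s T]] by simp
next
  case False
  have inv: "inverse s \<in> K" using K s by (auto simp: Reals_inverse)
  note sT = smult_in_dominated[OF s T]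
  note Tm = multilinear_mapD[OF bounded_multilinear_opsD[OF dominated_opsD(1)[OF T]]]
  have "(\<lambda>x\<in>mdom E. inverse s \<odot>\<^bsub>F\<^esub> (\<lambda>x\<in>mdom E. s \<odot>\<^bsub>F\<^esub> T x) x) = T"
    using Tm False s inv by (intro PiE_ext[of _ "mdom E" "\<lambda>_. carrier F"]) (auto simp: F.smult_smult)
  then have "dominated_norm T \<le> cmod (inverse s) * dominated_norm (\<lambda>x\<in>mdom E. s \<odot>\<^bsub>F\<^esub> T x)"
    using smult_in_dominated(2)[OF inv sT(1)] by simp
  then have "cmod s * dominated_norm T \<le> cmod s * (cmod (inverse s) * dominated_norm (\<lambda>x\<in>mdom E. s \<odot>\<^bsub>F\<^esub> T x))"
    by (rule mult_left_mono) simp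
  also have "\<dots> = dominated_norm (\<lambda>x\<in>mdom E. s \<odot>\<^bsub>F\<^esub> T x)" using False by (simp add: norm_inverse)
  finally show ?thesis using sT(2) by simp
qed

lemma nspace_dominated_space: "nspace K dominated_space"
proof
  show "normed_space K dominated_space"
    unfolding normed_space_def
  proof (intro conjI ballI module_dominated_space)
    fix T assume "T \<in> carrier dominated_space"
    then have T: "T \<in> dominated_ops" by simp
    note Td = dominated_opsD[OF T]
    show "0 \<le> vnorm dominated_space T" using Td(2) by simp
    show "vnorm dominated_space T = 0 \<longleftrightarrow> T = \<zero>\<^bsub>dominated_space\<^esub>"
    proof
      assume "vnorm dominated_space T = 0"
      then have "vnorm F (T x) \<le> 0" if "x \<in> mdom E" for x
        using dominated_bound[OF bounded_multilinear_opsD[OF Td(1)] Td(3,2) that] by simp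
      then have "T x = \<zero>\<^bsub>F\<^esub>" if "x \<in> mdom E" for x
        using that multilinear_val[OF Td(1) that] by (metis F.norm_eq_zero F.norm_ge_zero order_antisym)
      then show "T = \<zero>\<^bsub>dominated_space\<^esub>"
        using dominated_ops_extensional T by (intro PiE_ext[of T "mdom E" "\<lambda>_. carrier F"]) auto
    next
      assume "T = \<zero>\<^bsub>dominated_space\<^esub>"
      then have "T = (\<lambda>x\<in>mdom E. \<zero>\<^bsub>F\<^esub>)" by simp
      then have "dominated_norm T \<le> 0" using dominated_norm_le[OF dominated_zero] by (simp only: order_refl)
      then show "vnorm dominated_space T = 0" using Td(2) by simp
    qed
    show "vnorm dominated_space (T \<oplus>\<^bsub>dominated_space\<^esub> S) \<le> vnorm dominated_space T + vnorm dominated_space S" if "S \<in> carrier dominated_space" for S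
      using add_in_dominated(2)[OF T, of S] that by simp
  next
    fix s T assume "s \<in> K" "T \<in> carrier dominated_space"
    then show "vnorm dominated_space (s \<odot>\<^bsub>dominated_space\<^esub> T) = cmod s * vnorm dominated_space T" using dominated_norm_smult by simp
  qed
qed (rule K)

lemma submodule_dominated_ops: "submodule dominated_ops (scalar_ring K) (multilinear_space K E F)"
proof -
  have sub: "bounded_multilinear_ops K E F \<subseteq> mdom E \<rightarrow>\<^sub>E carrier F"
    using multilinear_mapD(1)[OF bounded_multilinear_opsD] by blast
  have mod: "module (scalar_ring K) (multilinear_space K E F)"
    unfolding multilinear_space_def
    by (rule map_space_module[OF F sub bounded_multilinear_zero[OF E F] bounded_multilinear_add[OF E F]
          bounded_multilinear_smult[OF E F]])
  have "\<ominus>\<^bsub>multilinear_space K E F\<^esub> T \<in> dominated_ops" if T: "T \<in> dominated_ops" for T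
  proof -
    have "\<ominus>\<^bsub>multilinear_space K E F\<^esub> T = (\<lambda>x\<in>mdom E. \<ominus>\<^bsub>F\<^esub> T x)"
      using map_space_uminus[OF mod[unfolded multilinear_space_def] F dominated_opsD(1)[OF T] sub]
      by (simp add: multilinear_space_def)
    also have "\<dots> = (\<lambda>x\<in>mdom E. (- 1) \<odot>\<^bsub>F\<^esub> T x)"
      using multilinear_val[OF dominated_opsD(1)[OF T]]
      by (intro restrict_ext) (simp add: F.uminus_smult)
    also have "\<dots> \<in> dominated_ops" by (rule smult_in_dominated(1)[OF _ T]) (use F.scalars in auto)
    finally show ?thesis .
  qed
  then show ?thesis
    using zero_in_dominated add_in_dominated(1) smult_in_dominated(1) dominated_opsD(1)
    by (intro module.submoduleI[OF mod]) (auto simp: multilinear_space_def)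
qed

text \<open>The inequality for \<open>s n - s k\<close> survives the limit in \<open>k\<close>, as it involves only the finitely
  many values \<open>s k (x i)\<close> for \<open>i < l\<close>.  Passing from \<open>s k\<close> to \<open>T\<close> costs an error \<open>\<delta> k\<close> in each coordinate.\<close>

lemma pointwise_limit_dominated:
  assumes s: "\<And>n. s n \<in> dominated_ops"
    and cauchy: "\<And>e. 0 < e \<Longrightarrow> \<exists>n0. \<forall>n\<ge>n0. \<forall>k\<ge>n0. dominated_norm (s n \<ominus>\<^bsub>dominated_space\<^esub> s k) < e"
    and lim: "\<And>x. x \<in> mdom E \<Longrightarrow> F.converges (\<lambda>n. s n x) (T x)"
    and e: "0 < e"
  shows "\<exists>n0. \<forall>n\<ge>n0. dominated (\<lambda>x\<in>mdom E. s n x \<ominus>\<^bsub>F\<^esub> T x) e"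
proof -
  interpret M: nspace K dominated_space by (rule nspace_dominated_space)
  obtain n0 where n0: "\<And>n k. n0 \<le> n \<Longrightarrow> n0 \<le> k \<Longrightarrow> dominated_norm (s n \<ominus>\<^bsub>dominated_space\<^esub> s k) < e"
    using cauchy[OF e] by blast
  have sv: "s n x \<in> carrier F" and Tv: "T x \<in> carrier F" if "x \<in> mdom E" for n x
    using lim[OF that] by (auto simp: F.converges_def)
  have "dominated (\<lambda>x\<in>mdom E. s n x \<ominus>\<^bsub>F\<^esub> T x) e" if n: "n0 \<le> n" for n
  proof (rule dominated_byI)
    fix l :: nat and x :: "nat \<Rightarrow> 'm \<Rightarrow> 'a" and y :: "nat \<Rightarrow> 'a \<Rightarrow> complex"
    assume a: "1 \<le> l" "\<And>i j. i < l \<Longrightarrow> x i j \<in> pcone (E j)" "\<And>i. i < l \<Longrightarrow> y i \<in> dual_cone K F"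
    have xm: "x i \<in> mdom E" if "i < l" for i using a(2)[OF that] by (rule cone_mdom)
    define \<delta> where "\<delta> k = (\<Sum>i<l. vnorm (dual K F) (y i) * vnorm F (s k (x i) \<ominus>\<^bsub>F\<^esub> T (x i)))" for k
    have \<delta>_lim: "\<delta> \<longlonglongrightarrow> 0"
    proof -
      have "(\<lambda>k. vnorm (dual K F) (y i) * vnorm F (s k (x i) \<ominus>\<^bsub>F\<^esub> T (x i))) \<longlonglongrightarrow> 0" if "i < l" for i
        using lim[OF xm[OF that]] by (intro tendsto_mult_right_zero) (simp add: F.converges_def)
      then show ?thesis unfolding \<delta>_def by (intro tendsto_null_sum) auto
    qed
    have term_nonneg: "0 \<le> vnorm (dual K F) (y i) * vnorm F (s k (x i) \<ominus>\<^bsub>F\<^esub> T (x i))" if "i < l" for i k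
      by (intro mult_nonneg_nonneg nspace.norm_ge_zero[OF dual_ns dual_cone_dual[OF a(3)[OF that]]]
          F.norm_ge_zero F.minus_closed sv Tv xm that)
    have \<delta>_ge: "cmod (y i (s k (x i)) - y i (T (x i))) \<le> \<delta> k" if i: "i < l" for i k
    proof -
      note v = sv[OF xm[OF i], of k] Tv[OF xm[OF i]]
      have "cmod (y i (s k (x i) \<ominus>\<^bsub>F\<^esub> T (x i))) \<le> vnorm (dual K F) (y i) * vnorm F (s k (x i) \<ominus>\<^bsub>F\<^esub> T (x i))"
        by (intro dual_bound[OF F dual_cone_dual[OF a(3)[OF i]]] F.minus_closed v)
      also have "\<dots> \<le> \<delta> k"
        unfolding \<delta>_def using i term_nonneg by (intro member_le_sum[where i = i]) auto
      finally show ?thesis using functional_linear(3)[OF a(3)[OF i] v] by simp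
    qed
    have bd: "lp_norm p l (\<lambda>i. y i ((\<lambda>x\<in>mdom E. s n x \<ominus>\<^bsub>F\<^esub> T x) (x i)))
        \<le> e * weak_prod E F l x y + \<delta> k * lp_norm p l (\<lambda>_. 1)" if k: "n0 \<le> k" for k
    proof -
      have "lp_norm p l (\<lambda>i. y i ((\<lambda>x\<in>mdom E. s n x \<ominus>\<^bsub>F\<^esub> T x) (x i)))
          \<le> lp_norm p l (\<lambda>i. y i ((s n \<ominus>\<^bsub>dominated_space\<^esub> s k) (x i)) + (y i (s k (x i)) - y i (T (x i))))"
        using xm sv Tv functional_linear(3)[OF a(3)]
        by (intro lp_norm_mono[OF p a(1)]) (simp add: minus_dominated_space[OF s s])
      also have "\<dots> \<le> lp_norm p l (\<lambda>i. y i ((s n \<ominus>\<^bsub>dominated_space\<^esub> s k) (x i)))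
          + lp_norm p l (\<lambda>i. y i (s k (x i)) - y i (T (x i)))"
        by (rule lp_norm_triangle[OF p a(1)])
      also have "\<dots> \<le> e * weak_prod E F l x y + \<delta> k * lp_norm p l (\<lambda>_. 1)"
      proof (intro add_mono)
        have "s n \<ominus>\<^bsub>dominated_space\<^esub> s k \<in> dominated_ops" using M.minus_closed[of "s n" "s k"] s by simp
        then have "dominated (s n \<ominus>\<^bsub>dominated_space\<^esub> s k) e"
          using dominated_opsD(3) dominated_by_mono less_imp_le[OF n0[OF n k]] by blast
        then show "lp_norm p l (\<lambda>i. y i ((s n \<ominus>\<^bsub>dominated_space\<^esub> s k) (x i))) \<le> e * weak_prod E F l x y"
          by (rule dominated_byD[where x = x and y = y, OF _ a])
        have "0 \<le> \<delta> k" unfolding \<delta>_def by (intro sum_nonneg term_nonneg) auto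
        then show "lp_norm p l (\<lambda>i. y i (s k (x i)) - y i (T (x i))) \<le> \<delta> k * lp_norm p l (\<lambda>_. 1)"
          by (rule lp_norm_coord_bound[OF p a(1)]) (rule \<delta>_ge)
      qed
      finally show ?thesis .
    qed
    have "(\<lambda>k. e * weak_prod E F l x y + \<delta> k * lp_norm p l (\<lambda>_. 1)) \<longlonglongrightarrow>
        e * weak_prod E F l x y + 0 * lp_norm p l (\<lambda>_. 1)"
      by (intro tendsto_intros \<delta>_lim)
    then have "lp_norm p l (\<lambda>i. y i ((\<lambda>x\<in>mdom E. s n x \<ominus>\<^bsub>F\<^esub> T x) (x i)))
        \<le> e * weak_prod E F l x y + 0 * lp_norm p l (\<lambda>_. 1)"
      by (rule LIMSEQ_le_const) (use bd in blast)
    then show "lp_norm p l (\<lambda>i. y i ((\<lambda>x\<in>mdom E. s n x \<ominus>\<^bsub>F\<^esub> T x) (x i))) \<le> e * weak_prod E F l x y"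
      by simp
  qed
  then show ?thesis by blast
qed

lemma pointwise_limit_multilinear:
  assumes s: "\<And>n. s n \<in> bounded_multilinear_ops K E F"
    and lim: "\<And>x. x \<in> mdom E \<Longrightarrow> F.converges (\<lambda>n. s n x) (T x)"
    and ext: "T \<in> extensional (mdom E)"
  shows "multilinear_map K E F T"
proof (rule multilinear_mapI[OF E])
  note sm = bounded_multilinear_opsD[OF s]
  show "T \<in> mdom E \<rightarrow>\<^sub>E carrier F"
    using lim ext by (auto simp: F.converges_def PiE_iff)
  fix x j assume x: "x \<in> mdom E"
  interpret Ej: nspace K "E j" by (rule E)
  fix a assume a: "a \<in> carrier (E j)"
  note la = lim[OF mdom_upd[OF x a]]
  show "T (x(j := a \<oplus>\<^bsub>E j\<^esub> b)) = T (x(j := a)) \<oplus>\<^bsub>F\<^esub> T (x(j := b))" if b: "b \<in> carrier (E j)" for b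
  proof (rule F.converges_unique)
    show "F.converges (\<lambda>n. s n (x(j := a \<oplus>\<^bsub>E j\<^esub> b))) (T (x(j := a \<oplus>\<^bsub>E j\<^esub> b)))"
      by (rule lim[OF mdom_upd[OF x Ej.a_closed[OF a b]]])
    show "F.converges (\<lambda>n. s n (x(j := a \<oplus>\<^bsub>E j\<^esub> b))) (T (x(j := a)) \<oplus>\<^bsub>F\<^esub> T (x(j := b)))"
      using F.converges_add[OF la lim[OF mdom_upd[OF x b]]] multilinear_map_coord(1)[OF sm E x a b] by simp
  qed
  show "T (x(j := c \<odot>\<^bsub>E j\<^esub> a)) = c \<odot>\<^bsub>F\<^esub> T (x(j := a))" if c: "c \<in> K" for c
  proof (rule F.converges_unique)
    show "F.converges (\<lambda>n. s n (x(j := c \<odot>\<^bsub>E j\<^esub> a))) (T (x(j := c \<odot>\<^bsub>E j\<^esub> a)))"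
      by (rule lim[OF mdom_upd[OF x Ej.smult_closed[OF c a]]])
    show "F.converges (\<lambda>n. s n (x(j := c \<odot>\<^bsub>E j\<^esub> a))) (c \<odot>\<^bsub>F\<^esub> T (x(j := a)))"
      using F.converges_smult[OF la c] multilinear_map_coord(2)[OF sm E x c a] by simp
  qed
qed

text \<open>By \<open>dominated_bound\<close>, a Cauchy sequence converges pointwise, to an operator that it also approaches
  in the dominated norm.\<close>

lemma banach_dominated_space: "banach_space K dominated_space"
  unfolding banach_space_def
proof
  interpret M: nspace K dominated_space by (rule nspace_dominated_space)
  show "normed_space K dominated_space" by (rule M.ns)
  show "Metric_space.mcomplete (carrier dominated_space) (vdist dominated_space)"
    unfolding M.complete_iff
  proof (intro allI impI)
    fix s :: "nat \<Rightarrow> ('m \<Rightarrow> 'a) \<Rightarrow> 'a"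
    assume "\<forall>n. s n \<in> carrier dominated_space"
      and "\<forall>e>0. \<exists>n0. \<forall>n\<ge>n0. \<forall>k\<ge>n0. vnorm dominated_space (s n \<ominus>\<^bsub>dominated_space\<^esub> s k) < e"
    then have s: "s n \<in> dominated_ops" and cauchy: "0 < e \<Longrightarrow> \<exists>n0. \<forall>n\<ge>n0. \<forall>k\<ge>n0. dominated_norm (s n \<ominus>\<^bsub>dominated_space\<^esub> s k) < e" for n e
      by auto
    note sb = dominated_opsD(1)[OF s]
    note sv = multilinear_val[OF sb]
    have pointwise: "\<exists>l. F.converges (\<lambda>n. s n x) l" if x: "x \<in> mdom E" for x
    proof (rule F.complete_converges)
      show "Metric_space.mcomplete (carrier F) (vdist F)"
        using banach_lattice_banach[OF banach_F] by (simp add: banach_space_def)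
      show "s n x \<in> carrier F" for n by (rule sv[OF x])
      define c where "c = \<kappa> * (\<Prod>j\<in>UNIV. vnorm (E j) (x j))"
      have c: "0 \<le> c"
        unfolding c_def \<kappa>_def by (intro mult_nonneg_nonneg prod_nonneg ballI nspace.norm_ge_zero[OF E mdomD[OF x]]) auto
      fix e :: real assume e: "0 < e"
      \<comment> \<open>The summand 1 avoids a division by 0, as \<open>c\<close> vanishes when some \<open>x j\<close> does.\<close>
      have "0 < e / (c + 1)" using c e by simp
      then obtain n0 where n0: "\<And>n k. n0 \<le> n \<Longrightarrow> n0 \<le> k \<Longrightarrow> dominated_norm (s n \<ominus>\<^bsub>dominated_space\<^esub> s k) < e / (c + 1)"
        using cauchy by blast
      have "vnorm F (s n x \<ominus>\<^bsub>F\<^esub> s k x) < e" if "n0 \<le> n" "n0 \<le> k" for n k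
      proof -
        have d: "s n \<ominus>\<^bsub>dominated_space\<^esub> s k \<in> dominated_ops" using M.minus_closed[of "s n" "s k"] s by simp
        note dd = dominated_opsD[OF d]
        have "vnorm F (s n x \<ominus>\<^bsub>F\<^esub> s k x) = vnorm F ((s n \<ominus>\<^bsub>dominated_space\<^esub> s k) x)" using x by (simp add: minus_dominated_space[OF s s])
        also have "\<dots> \<le> c * dominated_norm (s n \<ominus>\<^bsub>dominated_space\<^esub> s k)"
          using dominated_bound[OF bounded_multilinear_opsD[OF dd(1)] dd(3,2) x] by (simp add: c_def mult_ac)
        also have "\<dots> \<le> c * (e / (c + 1))" using n0[OF that] c by (intro mult_left_mono) auto
        also have "\<dots> < e" using c e by (simp add: field_simps)
        finally show ?thesis .
      qed
      then show "\<exists>n0. \<forall>n\<ge>n0. \<forall>k\<ge>n0. vnorm F (s n x \<ominus>\<^bsub>F\<^esub> s k x) < e" by blast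
    qed
    define T where "T = (\<lambda>x\<in>mdom E. SOME l. F.converges (\<lambda>n. s n x) l)"
    have lim: "F.converges (\<lambda>n. s n x) (T x)" if "x \<in> mdom E" for x
      using someI_ex[OF pointwise[OF that]] that by (simp add: T_def)
    have Tv: "T x \<in> carrier F" if "x \<in> mdom E" for x using lim[OF that] by (simp add: F.converges_def)
    have Tm: "multilinear_map K E F T"
      by (rule pointwise_limit_multilinear[OF sb lim]) (simp_all only: T_def restrict_extensional)
    have dom: "\<exists>n0. \<forall>n\<ge>n0. dominated (\<lambda>x\<in>mdom E. s n x \<ominus>\<^bsub>F\<^esub> T x) e" if "0 < e" for e
      using pointwise_limit_dominated[OF s cauchy lim that] by blast
    have TD: "T \<in> dominated_ops"
    proof -
      obtain n0 where n0: "dominated (\<lambda>x\<in>mdom E. s n0 x \<ominus>\<^bsub>F\<^esub> T x) 1"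
        using dom[of 1] by auto
      \<comment> \<open>\<open>T = s n0 - (s n0 - T)\<close> is dominated, and therefore bounded.\<close>
      let ?R = "\<lambda>x\<in>mdom E. s n0 x \<ominus>\<^bsub>F\<^esub> T x"
      let ?R' = "\<lambda>x\<in>mdom E. (- 1) \<odot>\<^bsub>F\<^esub> ?R x"
      have Rv: "?R x \<in> carrier F" if "x \<in> mdom E" for x using sv[OF that] Tv[OF that] that by simp
      have m1: "- 1 \<in> K" using F.scalars by simp
      have R': "dominated ?R' (cmod (- 1) * 1)" by (rule dominated_smult[OF Rv m1 n0])
      have R'v: "?R' x \<in> carrier F" if "x \<in> mdom E" for x using Rv[OF that] that m1 by simp
      have sum: "s n0 x \<oplus>\<^bsub>F\<^esub> ?R' x = T x" if x: "x \<in> mdom E" for x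
      proof -
        note v = sv[OF x, of n0] Tv[OF x]
        have "?R' x = T x \<ominus>\<^bsub>F\<^esub> s n0 x"
          using x v by (simp add: F.minus_minus_swap flip: F.uminus_smult)
        then show ?thesis using v by (simp add: F.a_comm[of "s n0 x"] F.minus_add_cancel)
      qed
      have "(\<lambda>x\<in>mdom E. s n0 x \<oplus>\<^bsub>F\<^esub> ?R' x) = T"
      proof
        show "(\<lambda>x\<in>mdom E. s n0 x \<oplus>\<^bsub>F\<^esub> ?R' x) x = T x" for x
          using sum[of x] by (cases "x \<in> mdom E") (simp_all add: T_def)
      qed
      then have Td: "dominated T (dominated_norm (s n0) + cmod (- 1) * 1)"
        using dominated_add[OF sv R'v dominated_opsD(3)[OF s] R', of n0] by simp
      have "0 \<le> dominated_norm (s n0) + cmod (- 1) * 1" using dominated_opsD(2)[OF s] by simp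
      then have "T \<in> bounded_multilinear_ops K E F"
        using dominated_bound[OF Tm Td]
        by (intro bounded_multilinear_opsI[OF Tm, where C = "\<kappa> * (dominated_norm (s n0) + cmod (- 1) * 1)"]) blast
      then show ?thesis using Td by (rule dominated_opsI)
    qed
    show "\<exists>l\<in>carrier dominated_space. \<forall>e>0. \<exists>n0. \<forall>n\<ge>n0. vnorm dominated_space (s n \<ominus>\<^bsub>dominated_space\<^esub> l) < e"
    proof (intro bexI[of _ T] allI impI)
      fix e :: real assume e: "0 < e"
      obtain n0 where n0: "\<And>n. n0 \<le> n \<Longrightarrow> dominated (\<lambda>x\<in>mdom E. s n x \<ominus>\<^bsub>F\<^esub> T x) (e / 2)"
        using dom[of "e / 2"] e by auto
      have "dominated_norm (s n \<ominus>\<^bsub>dominated_space\<^esub> T) < e" if "n0 \<le> n" for n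
        using dominated_norm_le[OF n0[OF that]] e by (simp add: minus_dominated_space[OF s TD])
      then show "\<exists>n0. \<forall>n\<ge>n0. vnorm dominated_space (s n \<ominus>\<^bsub>dominated_space\<^esub> T) < e" by auto
    qed (use TD in simp)
  qed
qed

end

text \<open>The inequality for \<open>T\<close> is applied to the vectors \<open>u\<^sub>j x\<close> and the functionals \<open>y \<circ> v\<close>, which are again
  positive.\<close>

lemma compose_in_dominated:
  fixes E G :: "'m::finite \<Rightarrow> 'a blattice"
  assumes EF: "exponents_lattices K p r ps E F" and GH: "exponents_lattices K p r ps G H"
    and T: "T \<in> positive_dominated_ops K p ps r E F"
    and u: "\<And>j. u j \<in> positive_ops K (G j) (E j)" and v: "v \<in> positive_ops K F H"
  shows "compose_ops G v T u \<in> positive_dominated_ops K p ps r G H"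
    "positive_dominated_norm K p ps r G H (compose_ops G v T u) \<le>
      op_norm F H v * positive_dominated_norm K p ps r E F T * (\<Prod>j\<in>UNIV. op_norm (G j) (E j) (u j))"
proof -
  interpret EF: exponents_lattices K p r ps E F by (rule EF)
  interpret GH: exponents_lattices K p r ps G H by (rule GH)
  note Td = EF.dominated_opsD[OF T]
  have ub: "u j \<in> bounded_linear_ops K (G j) (E j)" "x \<in> pcone (G j) \<Longrightarrow> u j x \<in> pcone (E j)" for j x
    using u[of j] by (auto simp: positive_ops_def)
  have vb: "v \<in> bounded_linear_ops K F H" "x \<in> pcone F \<Longrightarrow> v x \<in> pcone H" for x
    using v by (auto simp: positive_ops_def)
  note vadj = adjoint[OF EF.F GH.F vb(1)]
  let ?v' = "\<lambda>y\<in>carrier (dual K H). \<lambda>x\<in>carrier F. y (v x)"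
  let ?N = "positive_dominated_norm K p ps r E F T"
  let ?C = "op_norm F H v * ?N * (\<Prod>j\<in>UNIV. op_norm (G j) (E j) (u j))"
  have u0: "0 \<le> op_norm (G j) (E j) (u j)" for j by (rule op_norm_nonneg[OF GH.E EF.E ub(1)])
  have v0: "0 \<le> op_norm F H v" by (rule op_norm_nonneg[OF EF.F GH.F vb(1)])
  have C0: "0 \<le> ?C" using u0 v0 Td(2) by (intro mult_nonneg_nonneg prod_nonneg) auto
  have d: "dominated_by K p ps r G H (compose_ops G v T u) ?C"
  proof (rule EF.dominated_byI)
    fix n :: nat and x :: "nat \<Rightarrow> 'm \<Rightarrow> 'a" and y :: "nat \<Rightarrow> 'a \<Rightarrow> complex"
    assume a: "1 \<le> n" "\<And>i j. i < n \<Longrightarrow> x i j \<in> pcone (G j)" "\<And>i. i < n \<Longrightarrow> y i \<in> dual_cone K H"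
    let ?x = "\<lambda>i j. u j (x i j)" and ?y = "\<lambda>i. ?v' (y i)"
    have xc: "x i j \<in> carrier (G j)" if "i < n" for i j using a(2)[OF that] GH.cone_E by blast
    have yc: "y i \<in> carrier (dual K H)" if "i < n" for i by (rule dual_cone_dual[OF a(3)[OF that]])
    have x': "?x i j \<in> pcone (E j)" if "i < n" for i j by (rule ub(2)[OF a(2)[OF that]])
    have y': "?y i \<in> dual_cone K F" if i: "i < n" for i
    proof -
      have "?y i z \<in> \<real>\<^sub>\<ge>\<^sub>0" if z: "z \<in> pcone F" for z
      proof -
        have "?y i z = y i (v z)" using yc[OF i] EF.cone_F z by (simp add: subsetD)
        also have "\<dots> \<in> \<real>\<^sub>\<ge>\<^sub>0" using a(3)[OF i] vb(2)[OF z] by (simp add: dual_cone_def positive_ops_def)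
        finally show ?thesis .
      qed
      moreover have "?y i \<in> carrier (dual K F)" using bounded_linear_ops_linear(1)[OF vadj(1) yc[OF i]] .
      ultimately show ?thesis unfolding dual_cone_def positive_ops_def by (simp only: dual_simps) simp
    qed
    have xm: "x i \<in> mdom G" if "i < n" for i by (rule GH.cone_mdom[OF a(2)[OF that]])
    have "lp_norm p n (\<lambda>i. y i (compose_ops G v T u (x i))) \<le> lp_norm p n (\<lambda>i. ?y i (T (?x i)))"
      using xm yc EF.multilinear_val[OF Td(1) EF.cone_mdom[OF x']]
      by (intro lp_norm_mono[OF EF.p a(1)]) (simp add: compose_ops_def del: dual_simps)
    also have "\<dots> \<le> ?N * EF.weak_prod E F n ?x ?y"
      by (rule EF.dominated_byD[where x = ?x and y = ?y, OF Td(3) a(1) x' y'])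
    also have "\<dots> \<le> ?N * ((\<Prod>j\<in>UNIV. op_norm (G j) (E j) (u j) * weak_norm K (G j) (ps j) n (\<lambda>i. x i j))
        * (op_norm F H v * weak_norm K (dual K H) r n y))"
      unfolding EF.weak_prod_def
    proof (intro mult_left_mono mult_mono prod_mono conjI prod_nonneg Td(2))
      fix j
      have xcj: "x i j \<in> carrier (G j)" if "i < n" for i by (rule xc[OF that])
      show w: "weak_norm K (E j) (ps j) n (\<lambda>i. u j (x i j)) \<le>
          op_norm (G j) (E j) (u j) * weak_norm K (G j) (ps j) n (\<lambda>i. x i j)"
        by (rule weak_norm_image[where x = "\<lambda>i. x i j", OF GH.E EF.E EF.ps a(1) xcj ub(1)])
      show w0: "0 \<le> weak_norm K (E j) (ps j) n (\<lambda>i. u j (x i j))"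
        using bounded_linear_ops_linear(1)[OF ub(1) xcj]
        by (intro weak_norm_nonneg[OF EF.E EF.ps a(1)])
      show "0 \<le> op_norm (G j) (E j) (u j) * weak_norm K (G j) (ps j) n (\<lambda>i. x i j)"
        using w w0 by (rule order_trans[rotated])
    next
      have "weak_norm K (dual K F) r n ?y \<le> op_norm (dual K H) (dual K F) ?v' * weak_norm K (dual K H) r n y"
        by (rule weak_norm_image[where x = y, OF GH.dual_ns EF.dual_ns EF.r a(1) yc vadj(1)])
      also have "\<dots> \<le> op_norm F H v * weak_norm K (dual K H) r n y"
        by (intro mult_right_mono vadj(2) weak_norm_nonneg[where x = y, OF GH.dual_ns EF.r a(1) yc])
      finally show "weak_norm K (dual K F) r n ?y \<le> op_norm F H v * weak_norm K (dual K H) r n y" .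
      show "0 \<le> weak_norm K (dual K F) r n ?y"
        using bounded_linear_ops_linear(1)[OF vadj(1) yc]
        by (intro weak_norm_nonneg[OF EF.dual_ns EF.r a(1)])
    qed
    also have "\<dots> = ?C * EF.weak_prod G H n x y"
      by (simp add: EF.weak_prod_def prod.distrib mult_ac)
    finally show "lp_norm p n (\<lambda>i. y i (compose_ops G v T u (x i))) \<le> ?C * EF.weak_prod G H n x y" .
  qed
  show "compose_ops G v T u \<in> positive_dominated_ops K p ps r G H"
    by (rule GH.dominated_opsI[OF compose_bounded_multilinear[OF EF.E EF.F GH.E GH.F Td(1) ub(1) vb(1)] d])
  show "positive_dominated_norm K p ps r G H (compose_ops G v T u) \<le> ?C"
    by (rule GH.dominated_norm_le[OF d C0])
qed

text \<open>The form is of rank one with factors of norm at most 1.  Conversely, length one, the vectors 1 and the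
  identity functional force every admissible constant to be at least 1.\<close>

lemma (in exponents) scalar_form_norm:
  assumes pq: "1 / p = (\<Sum>j\<in>UNIV. 1 / ps j) + 1 / r"
  shows "positive_dominated_norm K p ps r (\<lambda>_. scalar_lattice K) (scalar_lattice K :: (complex + 'a) blattice)
    (scalar_form K) = 1"
proof -
  let ?S = "scalar_lattice K :: (complex + 'a) blattice"
  let ?E = "\<lambda>_::'m. ?S"
  have nsS: "nspace K ?S" by (rule nspace_scalar_lattice[OF K])
  interpret S: nspace K ?S by (rule nsS)
  have coneS: "pcone ?S \<subseteq> carrier ?S"
    using K by (auto simp: nonneg_Reals_def)
  interpret exponents_lattices K p r ps ?E ?S
    by (intro exponents_lattices.intro exponents_lattices_axioms.intro exponents_axioms nsS
      coneS)
  define \<phi> where "\<phi> = (\<lambda>x\<in>carrier ?S. projl x)"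
  have \<phi>_bl: "\<phi> \<in> bounded_linear_ops K ?S (scalar_space K)"
    using S.scalars by (intro bounded_linear_opsI[where C = 1]) (auto simp: \<phi>_def)
  then have \<phi>: "\<phi> \<in> carrier (dual K ?S)" by simp
  have \<phi>_norm: "vnorm (dual K ?S) \<phi> \<le> 1"
    unfolding dual_simps by (rule op_norm_le[OF nsS]) (auto simp: \<phi>_def)
  have one: "Inl 1 \<in> carrier ?S" using S.scalars by simp
  have form: "scalar_form K = (\<lambda>x\<in>mdom ?E. (\<Prod>j\<in>UNIV. \<phi> (x j)) \<odot>\<^bsub>?S\<^esub> Inl 1)"
    unfolding scalar_form_def by (intro restrict_ext) (simp add: \<phi>_def mdom_def)
  have n1: "(\<Prod>j\<in>(UNIV::'m set). vnorm (dual K ?S) \<phi>) * vnorm ?S (Inl 1) \<le> 1"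
    using \<phi>_norm nspace.norm_ge_zero[OF dual_ns \<phi>] by (simp add: power_le_one)
  have dom: "dominated_by K p ps r ?E ?S (scalar_form K) 1"
    unfolding form by (rule dominated_by_mono[OF dominated_rank_one[OF pq \<phi> one] n1])
  have pos1: "Inl 1 \<in> pcone ?S" by simp
  have \<phi>_cone: "\<phi> \<in> dual_cone K ?S"
    using \<phi>_bl coneS by (auto simp: dual_cone_def positive_ops_def \<phi>_def)
  show ?thesis
  proof (rule antisym)
    show "positive_dominated_norm K p ps r ?E ?S (scalar_form K) \<le> 1" by (rule dominated_norm_le[OF dom]) simp
    show "1 \<le> positive_dominated_norm K p ps r ?E ?S (scalar_form K)"
      unfolding positive_dominated_norm_def
    proof (rule cInf_greatest)
      show "{C. 0 < C \<and> dominated_by K p ps r ?E ?S (scalar_form K) C} \<noteq> {}"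
        using dom zero_less_one by blast
      fix C assume "C \<in> {C. 0 < C \<and> dominated_by K p ps r ?E ?S (scalar_form K) C}"
      then have C: "0 < C" "dominated_by K p ps r ?E ?S (scalar_form K) C" by auto
      let ?x = "\<lambda>(_::nat) (_::'m). Inl 1 :: complex + 'a" and ?y = "\<lambda>_::nat. \<phi>"
      have v: "\<phi> (scalar_form K (\<lambda>_. Inl 1)) = 1"
        using one by (simp add: scalar_form_def mdom_def \<phi>_def)
      have "lp_norm p 1 (\<lambda>i. ?y i (scalar_form K (?x i))) \<le> C * weak_prod ?E ?S 1 ?x ?y"
        by (rule dominated_byD[OF C(2)]) (use pos1 \<phi>_cone in auto)
      then have "1 \<le> C * weak_prod ?E ?S 1 ?x ?y" by (simp only: lp_norm_one[OF p] v norm_one)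
      also have "weak_prod ?E ?S 1 ?x ?y \<le> (\<Prod>j\<in>(UNIV::'m set). 1) * 1"
        unfolding weak_prod_def
      proof (intro mult_mono prod_mono conjI prod_nonneg)
        fix j :: 'm
        have "weak_norm K ?S (ps j) 1 (\<lambda>_. Inl 1) \<le> vnorm ?S (Inl 1)" by (rule weak_norm_one[OF nsS ps one])
        then show "weak_norm K ?S (ps j) 1 (\<lambda>_. Inl 1) \<le> 1" by simp
        show "0 \<le> weak_norm K ?S (ps j) 1 (\<lambda>_. Inl 1)" by (rule weak_norm_nonneg[OF nsS ps]) (use one in auto)
      next
        show "weak_norm K (dual K ?S) r 1 (\<lambda>_. \<phi>) \<le> 1"
          using weak_norm_one[where x = "\<lambda>_. \<phi>", OF dual_ns r \<phi>] \<phi>_norm by linarith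
        show "0 \<le> weak_norm K (dual K ?S) r 1 (\<lambda>_. \<phi>)" by (rule weak_norm_nonneg[OF dual_ns r]) (use \<phi> in auto)
      qed simp
      finally show "1 \<le> C" using C(1) by simp
    qed
  qed
qed

theorem proposition3p3:
  fixes K :: "complex set" and r p :: ennreal and ps :: "'m::finite \<Rightarrow> ennreal"
  assumes "K = \<real> \<or> K = UNIV"
    and "1 \<le> r" and "1 \<le> p" and "\<forall>j. 1 \<le> ps j"
    and "1 / p = (\<Sum>j\<in>UNIV. 1 / ps j) + 1 / r"
  shows "positive_banach_multi_ideal K
    (positive_dominated_ops K p ps r ::
      ('m \<Rightarrow> (complex + 'a) blattice) \<Rightarrow> (complex + 'a) blattice \<Rightarrow>
        (('m \<Rightarrow> complex + 'a) \<Rightarrow> complex + 'a) set)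
    (positive_dominated_norm K p ps r)"
proof -
  interpret exponents K p r ps by unfold_locales (use assms in auto)
  have ban: "exponents_banach K p r ps E F" if "\<forall>j. banach_lattice K (E j)" "banach_lattice K F"
    for E :: "'m \<Rightarrow> (complex + 'a) blattice" and F :: "(complex + 'a) blattice"
    using that by (intro exponents_banach.intro exponents_axioms exponents_banach_axioms.intro) auto
  show ?thesis
    unfolding positive_banach_multi_ideal_def
  proof (intro conjI allI impI)
    fix E :: "'m \<Rightarrow> (complex + 'a) blattice" and F :: "(complex + 'a) blattice"
    assume "(\<forall>j. banach_lattice K (E j)) \<and> banach_lattice K F"
    then interpret exponents_banach K p r ps E F by (intro ban) auto
    show "submodule dominated_ops (scalar_ring K) (multilinear_space K E F)" by (rule submodule_dominated_ops)
    show "finite_rank_ops K E F \<subseteq> dominated_ops" by (rule finite_rank_in_dominated[OF assms(5)])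
    show "banach_space K dominated_space" by (rule banach_dominated_space)
  next
    fix E G :: "'m \<Rightarrow> (complex + 'a) blattice" and F H :: "(complex + 'a) blattice" and T u v
    assume a: "(\<forall>j. banach_lattice K (E j)) \<and> banach_lattice K F \<and>
      (\<forall>j. banach_lattice K (G j)) \<and> banach_lattice K H \<and> T \<in> positive_dominated_ops K p ps r E F \<and>
      (\<forall>j. u j \<in> positive_ops K (G j) (E j)) \<and> v \<in> positive_ops K F H"
    interpret EF: exponents_banach K p r ps E F using a by (intro ban) auto
    interpret GH: exponents_banach K p r ps G H using a by (intro ban) auto
    note c = compose_in_dominated[OF EF.exponents_lattices_axioms GH.exponents_lattices_axioms, of T u v]
    show "compose_ops G v T u \<in> positive_dominated_ops K p ps r G H" using c(1) a by blast
    show "positive_dominated_norm K p ps r G H (compose_ops G v T u) \<le>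
        op_norm F H v * positive_dominated_norm K p ps r E F T * (\<Prod>j\<in>UNIV. op_norm (G j) (E j) (u j))"
      using c(2) a by blast
  next
    show "positive_dominated_norm K p ps r (\<lambda>_. scalar_lattice K) (scalar_lattice K :: (complex + 'a) blattice)
      (scalar_form K) = 1" by (rule scalar_form_norm[OF assms(5)])
  qed
qed

end
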